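(* Let $n\ge1$ be an integer, $p>1$ with $p>n$, and $l,\theta>0$. Then the origin $(0,0)$ is regular (for the $p$-parabolic equation) with respect to $$\Theta_{l,\theta}=\{(x,t)\in\mathbf{R}^{n}\times\mathbf{R}: 0<-t<\theta|x|^l<\theta\}.$$
   Context: Let $n\ge1$ be an integer, $1<p<\infty$, and let $\Theta\subset\mathbf{R}^{n+1}$ be a nonempty bounded open set, with points written $(x,t)$, $x\in\mathbf{R}^n$, $t\in\mathbf{R}$. $\nabla$ and $\operatorname{div}$ are taken with respect to $x$ only, and $\partial\Theta$ is the full topological boundary. The $p$-parabolic equation is $\partial_t u-\Delta_p u=0$, where $\Delta_p u=\operatorname{div}(|\nabla u|^{p-2}\nabla u)$ (the heat equation if $p=2$). Solutions: $u:\Theta\to[-\infty,\infty]$ is a (weak) solution if for every open cylinder $U_{t_1,t_2}=U\times(t_1,t_2)\Subset\Theta$ we have $u\in C([t_1,t_2];L^2(U))\cap L^p(t_1,t_2;W^{1,p}(U))$ and $$\int_{t_1}^{t_2}\int_U|\nabla u|^{p-2}\nabla u\cdot\nabla\varphi\,dx\,dt-\int_{t_1}^{t_2}\int_U u\,\frac{\partial\varphi}{\partial t}\,dx\,dt=0\quad\text{for all }\varphi\in C_0^\infty(U_{t_1,t_2}).$$ A $p$-parabolic function is a continuous solution. Superparabolic functions: $u:\Theta\to(-\infty,\infty]$ is $p$-superparabolic if (i) $u$ is lower semicontinuous; (ii) $u$ is finite in a dense subset of $\Theta$; (iii) for every space-time box $Q_{t_1,t_2}=Q\times(t_1,t_2)\Subset\Theta$,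 $Q=(a_1,b_1)\times\dots\times(a_n,b_n)$, and every $h$ that is $p$-parabolic in $Q_{t_1,t_2}$, continuous on $\overline{Q_{t_1,t_2}}$ and satisfies $h\le u$ on the parabolic boundary $(\overline{Q}\times\{t_1\})\cup(\partial Q\times(t_1,t_2])$, we have $h\le u$ in $Q_{t_1,t_2}$. Perron solution: for bounded $f:\partial\Theta\to\mathbf{R}$, let $\mathcal{U}_f$ be the set of $p$-superparabolic $u$ on $\Theta$ with $\liminf_{\Theta\ni\eta\to\xi}u(\eta)\ge f(\xi)$ for all $\xi\in\partial\Theta$, and $\overline{H}_\Theta f(\xi)=\inf_{u\in\mathcal{U}_f}u(\xi)$ for $\xi\in\Theta$. Regularity: $\xi_0\in\partial\Theta$ is regular with respect to $\Theta$ if $\lim_{\Theta\ni\xi\to\xi_0}\overline{H}_\Theta f(\xi)=f(\xi_0)$ for all $f\in C(\partial\Theta)$; otherwise it is irregular. *)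

theory Defs
  imports "HOL-Analysis.Analysis"
begin

text \<open>
  Points of space-time are pairs \<open>(x, t)\<close> of type \<open>(real^'n) \<times> real\<close>. Functions on a set are
  total functions whose values outside that set are irrelevant.
\<close>

definition compactly_contained :: "'a::topological_space set \<Rightarrow> 'a set \<Rightarrow> bool" where
  "compactly_contained A B \<longleftrightarrow> compact (closure A) \<and> closure A \<subseteq> B"


subsection \<open>Test functions\<close>

text \<open>A function is \<open>C\<^sup>k\<^sup>+\<^sup>1\<close> iff it is differentiable with \<open>C\<^sup>k\<close> partial derivatives.\<close>

primrec Ck :: "nat \<Rightarrow> ('a::euclidean_space \<Rightarrow> real) \<Rightarrow> bool" where
  "Ck 0 f \<longleftrightarrow> continuous_on UNIV f"
| "Ck (Suc k) f \<longleftrightarrow> (\<forall>x. f differentiable (at x)) \<and>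
     (\<forall>b\<in>Basis. Ck k (\<lambda>x. frechet_derivative f (at x) b))"

definition test_function :: "'a::euclidean_space set \<Rightarrow> ('a \<Rightarrow> real) \<Rightarrow> bool" where
  "test_function W \<phi> \<longleftrightarrow> (\<forall>k. Ck k \<phi>) \<and> compactly_contained {z. \<phi> z \<noteq> 0} W"

definition grad :: "(real^'n \<Rightarrow> real) \<Rightarrow> real^'n \<Rightarrow> real^'n" where
  "grad \<phi> x = (\<chi> i. frechet_derivative \<phi> (at x) (axis i 1))"


subsection \<open>Lebesgue, Sobolev and Bochner spaces\<close>

text \<open>
  Elements of Lebesgue spaces are described by Borel representatives. Weak solutions below only
  require the existence of such a representative, so nothing is lost against Lebesgue measurable
  functions.
\<close>

definition in_Lp ::
  "real \<Rightarrow> 'a::euclidean_space set \<Rightarrow> ('a \<Rightarrow> 'b::euclidean_space) \<Rightarrow> bool" where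
  "in_Lp q A f \<longleftrightarrow> set_borel_measurable lborel A f \<and>
     set_integrable lborel A (\<lambda>x. norm (f x) powr q)"

text \<open>\<open>v\<close> is in \<open>W\<^sup>1\<^sup>,\<^sup>p(U)\<close> with weak gradient \<open>G\<close>.\<close>

definition in_W1p ::
  "real \<Rightarrow> (real^'n) set \<Rightarrow> (real^'n \<Rightarrow> real) \<Rightarrow> (real^'n \<Rightarrow> real^'n) \<Rightarrow> bool" where
  "in_W1p p U v G \<longleftrightarrow> in_Lp p U v \<and> in_Lp p U G \<and>
     (\<forall>\<phi>. test_function U \<phi> \<longrightarrow>
       (\<forall>i. (LINT x:U|lborel. v x * grad \<phi> x $ i) = - (LINT x:U|lborel. G x $ i * \<phi> x)))"

text \<open>\<open>v\<close> is in \<open>C([t\<^sub>1,t\<^sub>2]; L\<^sup>2(U))\<close>.\<close>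

definition in_C_L2 :: "real \<Rightarrow> real \<Rightarrow> (real^'n) set \<Rightarrow> ((real^'n) \<times> real \<Rightarrow> real) \<Rightarrow> bool" where
  "in_C_L2 t\<^sub>1 t\<^sub>2 U v \<longleftrightarrow>
     (\<forall>t\<in>{t\<^sub>1..t\<^sub>2}. in_Lp 2 U (\<lambda>x. v (x, t))) \<and>
     (\<forall>s\<in>{t\<^sub>1..t\<^sub>2}.
       ((\<lambda>t. LINT x:U|lborel. (v (x, t) - v (x, s))\<^sup>2) \<longlongrightarrow> 0) (at s within {t\<^sub>1..t\<^sub>2}))"

text \<open>
  \<open>v\<close> is in \<open>L\<^sup>p(t\<^sub>1,t\<^sub>2; W\<^sup>1\<^sup>,\<^sup>p(U))\<close> with spatial weak gradient \<open>G\<close>. By Tonelli, the joint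
  \<open>L\<^sup>p\<close> conditions say that the \<open>p\<close>-th power of the \<open>W\<^sup>1\<^sup>,\<^sup>p(U)\<close>-norm is integrable in time;
  joint measurability of \<open>v\<close> and \<open>G\<close> stands for strong measurability in time.
\<close>

definition in_Lp_W1p ::
  "real \<Rightarrow> real \<Rightarrow> real \<Rightarrow> (real^'n) set \<Rightarrow> ((real^'n) \<times> real \<Rightarrow> real) \<Rightarrow>
    ((real^'n) \<times> real \<Rightarrow> real^'n) \<Rightarrow> bool" where
  "in_Lp_W1p p t\<^sub>1 t\<^sub>2 U v G \<longleftrightarrow>
     in_Lp p (U \<times> {t\<^sub>1<..<t\<^sub>2}) v \<and> in_Lp p (U \<times> {t\<^sub>1<..<t\<^sub>2}) G \<and>
     (AE t in lborel. t \<in> {t\<^sub>1<..<t\<^sub>2} \<longrightarrow> in_W1p p U (\<lambda>x. v (x, t)) (\<lambda>x. G (x, t)))"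


subsection \<open>Solutions of the \<open>p\<close>-parabolic equation\<close>

text \<open>
  As members of the function spaces above, solutions are determined up to null sets; \<open>v\<close> is a
  real-valued representative of \<open>u\<close> on the cylinder and \<open>G\<close> its spatial gradient. Since
  \<open>0 powr a = 0\<close>, the vector field \<open>|G|\<^sup>p\<^sup>-\<^sup>2 G\<close> vanishes where \<open>G\<close> does, also for \<open>p < 2\<close>.
\<close>

definition weak_solution ::
  "real \<Rightarrow> ((real^'n) \<times> real) set \<Rightarrow> ((real^'n) \<times> real \<Rightarrow> ereal) \<Rightarrow> bool" where
  "weak_solution p \<Theta> u \<longleftrightarrow>
     (\<forall>U t\<^sub>1 t\<^sub>2. open U \<and> t\<^sub>1 < t\<^sub>2 \<and> compactly_contained (U \<times> {t\<^sub>1<..<t\<^sub>2}) \<Theta> \<longrightarrow>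
       (\<exists>v G.
          (AE z in lborel. z \<in> U \<times> {t\<^sub>1<..<t\<^sub>2} \<longrightarrow> u z = ereal (v z)) \<and>
          in_C_L2 t\<^sub>1 t\<^sub>2 U v \<and> in_Lp_W1p p t\<^sub>1 t\<^sub>2 U v G \<and>
          (\<forall>\<phi>. test_function (U \<times> {t\<^sub>1<..<t\<^sub>2}) \<phi> \<longrightarrow>
             (LINT t:{t\<^sub>1<..<t\<^sub>2}|lborel. LINT x:U|lborel.
                (norm (G (x, t)) powr (p - 2) *\<^sub>R G (x, t)) \<bullet> grad (\<lambda>y. \<phi> (y, t)) x)
             - (LINT t:{t\<^sub>1<..<t\<^sub>2}|lborel. LINT x:U|lborel.
                v (x, t) * deriv (\<lambda>s. \<phi> (x, s)) t)
             = 0)))"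

definition p_parabolic ::
  "real \<Rightarrow> ((real^'n) \<times> real) set \<Rightarrow> ((real^'n) \<times> real \<Rightarrow> real) \<Rightarrow> bool" where
  "p_parabolic p \<Theta> h \<longleftrightarrow> continuous_on \<Theta> h \<and> weak_solution p \<Theta> (\<lambda>z. ereal (h z))"


subsection \<open>Superparabolic functions\<close>

definition parabolic_boundary ::
  "(real^'n) set \<Rightarrow> real \<Rightarrow> real \<Rightarrow> ((real^'n) \<times> real) set" where
  "parabolic_boundary Q t\<^sub>1 t\<^sub>2 = closure Q \<times> {t\<^sub>1} \<union> frontier Q \<times> {t\<^sub>1<..t\<^sub>2}"

definition superparabolic ::
  "real \<Rightarrow> ((real^'n) \<times> real) set \<Rightarrow> ((real^'n) \<times> real \<Rightarrow> ereal) \<Rightarrow> bool" where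
  "superparabolic p \<Theta> u \<longleftrightarrow>
     (\<forall>z\<in>\<Theta>. u z \<noteq> -\<infinity>) \<and>
     (\<forall>c. openin (top_of_set \<Theta>) {z \<in> \<Theta>. c < u z}) \<and>
     \<Theta> \<subseteq> closure {z \<in> \<Theta>. \<bar>u z\<bar> \<noteq> \<infinity>} \<and>
     (\<forall>a b t\<^sub>1 t\<^sub>2 h.
        box a b \<noteq> {} \<and> t\<^sub>1 < t\<^sub>2 \<and> compactly_contained (box a b \<times> {t\<^sub>1<..<t\<^sub>2}) \<Theta> \<and>
        p_parabolic p (box a b \<times> {t\<^sub>1<..<t\<^sub>2}) h \<and>
        continuous_on (closure (box a b \<times> {t\<^sub>1<..<t\<^sub>2})) h \<and>
        (\<forall>z\<in>parabolic_boundary (box a b) t\<^sub>1 t\<^sub>2. ereal (h z) \<le> u z)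
        \<longrightarrow> (\<forall>z\<in>box a b \<times> {t\<^sub>1<..<t\<^sub>2}. ereal (h z) \<le> u z))"


subsection \<open>Perron solutions and boundary regularity\<close>

definition upper_class ::
  "real \<Rightarrow> ((real^'n) \<times> real) set \<Rightarrow> ((real^'n) \<times> real \<Rightarrow> real) \<Rightarrow>
    ((real^'n) \<times> real \<Rightarrow> ereal) set" where
  "upper_class p \<Theta> f =
     {u. superparabolic p \<Theta> u \<and> (\<forall>\<xi>\<in>frontier \<Theta>. ereal (f \<xi>) \<le> Liminf (at \<xi> within \<Theta>) u)}"

definition upper_perron ::
  "real \<Rightarrow> ((real^'n) \<times> real) set \<Rightarrow> ((real^'n) \<times> real \<Rightarrow> real) \<Rightarrow> (real^'n) \<times> real \<Rightarrow> ereal" where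
  "upper_perron p \<Theta> f \<xi> = (INF u\<in>upper_class p \<Theta> f. u \<xi>)"

definition regular_point ::
  "real \<Rightarrow> ((real^'n) \<times> real) set \<Rightarrow> (real^'n) \<times> real \<Rightarrow> bool" where
  "regular_point p \<Theta> \<xi>\<^sub>0 \<longleftrightarrow> \<xi>\<^sub>0 \<in> frontier \<Theta> \<and>
     (\<forall>f. continuous_on (frontier \<Theta>) f \<longrightarrow>
       (upper_perron p \<Theta> f \<longlongrightarrow> ereal (f \<xi>\<^sub>0)) (at \<xi>\<^sub>0 within \<Theta>))"


definition Theta_dom :: "real \<Rightarrow> real \<Rightarrow> ((real^'n) \<times> real) set" where
  "Theta_dom l \<theta> = {(x, t). 0 < - t \<and> - t < \<theta> * norm x powr l \<and> \<theta> * norm x powr l < \<theta>}"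

end

theory Submission
  imports Defs "HOL-Computational_Algebra.Polynomial"
begin

text \<open>
  Put \<open>\<alpha> = (p - n) / (p - 1)\<close>, which lies in \<open>(0, 1]\<close> since \<open>p > n\<close>. The stationary functions
  \<open>c + K |x - y|\<^sup>\<alpha>\<close> are \<open>p\<close>-harmonic off \<open>y\<close>, hence \<open>p\<close>-parabolic on cylinders over sets that avoid
  \<open>y\<close>. No point of the domain has \<open>x = 0\<close>, and \<open>|t| \<le> \<theta> |x|\<^sup>l\<close> on its boundary, so time-independent
  barriers centred at \<open>y = 0\<close> control the boundary data near the origin.

  Upper bound: \<open>f(0) + \<epsilon> + K |x|\<^sup>\<alpha>\<close> belongs to the upper class. That it is superparabolic is the
  comparison principle for two continuous weak solutions, obtained by testing the difference of the
  equations with the mollification of \<open>((D\<^sub>r - \<epsilon>)\<^sub>+)\<^sup>2 ((T - t)\<^sub>+)\<^sup>2\<close>, where \<open>D\<^sub>r\<close> is the mollified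
  difference of the solutions. Mollification on both sides makes the time derivative a total
  derivative, and in the limit the monotonicity of \<open>G \<mapsto> |G|\<^sup>p\<^sup>-\<^sup>2 G\<close> gives the sign of the flux term.

  Lower bound: every \<open>u\<close> in the upper class lies above
  \<open>v = f(0) - 2\<epsilon> - K |x|\<^sup>\<beta> - \<delta> t\<close> with \<open>\<beta> < \<alpha>\<close>. At an interior negative minimum of \<open>u - v\<close>, a
  function \<open>c - K' |x - y|\<^sup>\<alpha>\<close>, with \<open>y\<close> a small multiple of the touching point \<open>x\<^sub>0\<close>, touches \<open>v\<close>
  strictly from below in space, and \<open>- \<delta> t\<close> makes the inequality strict at earlier times. Raised by
  a small constant, it violates the comparison property of \<open>u\<close> on a small box.
\<close>

subsection \<open>Smooth functions\<close>

text \<open>The assumption p > n enters through the sign of \<alpha>: for \<alpha> > 0 the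
  fundamental solution is finite and continuous at its pole, so it can serve as a barrier there. The
  two bounds need different arguments because superparabolicity only offers comparison with
  p-parabolic functions on boxes. For the upper bound, one explicit member of the upper class is
  enough. For the lower bound u is arbitrary, so the barrier is made a strict subsolution:
  -|x|^\<beta> with \<beta> < \<alpha> is strictly p-subharmonic off 0, and -\<delta> t decreases in
  time. Strictness leaves room to slip a p-parabolic function between barrier and u on a box and to
  raise it; -|x|^\<alpha> itself would leave none. In the comparison principle the obstacle is that
  weak solutions have no time derivative, while a mollified flux is not the flux of a mollified
  gradient. Monotonicity is therefore applied to the unmollified fields. The price is an L^1 error
  for the product of flux difference and gradient difference, which lie in dual Lebesgue
  spaces.\<close>

lemma Ck_SucI:
  assumes "\<And>x. (f has_derivative f' x) (at x)" "\<And>b. b \<in> Basis \<Longrightarrow> Ck k (\<lambda>x. f' x b)"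
  shows "Ck (Suc k) f"
proof -
  have "frechet_derivative f (at x) = f' x" for x
    using assms(1) frechet_derivative_at by metis
  then show ?thesis
    using assms by (auto simp: differentiable_def)
qed

lemma Ck_Suc_has_derivative:
  "Ck (Suc k) f \<Longrightarrow> (f has_derivative frechet_derivative f (at x)) (at x)"
  using frechet_derivative_works by auto

lemma Ck_Suc_imp_Ck: "Ck (Suc k) f \<Longrightarrow> Ck k f"
proof (induction k arbitrary: f)
  case 0
  then show ?case
    by (auto intro!: continuous_at_imp_continuous_on differentiable_imp_continuous_within)
qed auto

lemma Ck_const [simp]: "Ck k (\<lambda>x. c)"
proof (induction k arbitrary: c)
  case (Suc k)
  show ?case by (rule Ck_SucI[where f' = "\<lambda>_ _. 0"]) (auto intro: Suc)
qed simp

lemma Ck_add: "Ck k f \<Longrightarrow> Ck k g \<Longrightarrow> Ck k (\<lambda>x. f x + g x)"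
proof (induction k arbitrary: f g)
  case (Suc k)
  show ?case
    by (rule Ck_SucI[OF has_derivative_add[OF Ck_Suc_has_derivative Ck_Suc_has_derivative]])
       (use Suc in auto)
qed (auto intro: continuous_intros)

lemma Ck_mult: "Ck k f \<Longrightarrow> Ck k g \<Longrightarrow> Ck k (\<lambda>x. f x * g x)"
proof (induction k arbitrary: f g)
  case (Suc k)
  show ?case
    by (rule Ck_SucI[OF has_derivative_mult[OF Ck_Suc_has_derivative Ck_Suc_has_derivative]])
       (use Suc Ck_Suc_imp_Ck in \<open>auto intro!: Ck_add Suc.IH\<close>)
qed (auto intro: continuous_intros)

lemma Ck_sum: "(\<And>i. i \<in> I \<Longrightarrow> Ck k (f i)) \<Longrightarrow> Ck k (\<lambda>x. \<Sum>i\<in>I. f i x)"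
  by (induction I rule: infinite_finite_induct) (auto intro: Ck_add)

lemma has_derivative_basis_expansion:
  fixes f :: "'a::euclidean_space \<Rightarrow> real"
  assumes "(f has_derivative f') F"
  shows "f' v = (\<Sum>b\<in>Basis. (v \<bullet> b) * f' b)"
proof -
  have l: "linear f'" using assms has_derivative_linear by blast
  have "f' v = f' (\<Sum>b\<in>Basis. (v \<bullet> b) *\<^sub>R b)" by (simp add: euclidean_representation)
  then show ?thesis by (simp add: linear_sum[OF l] linear_cmul[OF l])
qed

text \<open>\<open>L b\<close> need not be a basis vector, so the derivative is expanded over the
  partials of \<open>f\<close>; the induction hypothesis then applies to each of them.\<close>

lemma Ck_compose_affine:
  assumes "bounded_linear L"
  shows "Ck k f \<Longrightarrow> Ck k (\<lambda>y. f (c + L y))"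
proof (induction k arbitrary: f)
  case 0
  then show ?case
    using continuous_on_compose2[of UNIV f UNIV "\<lambda>y. c + L y"] 
      continuous_on_add[OF continuous_on_const linear_continuous_on[OF assms]] by auto
next
  case (Suc k)
  have d: "((\<lambda>y. f (c + L y)) has_derivative (\<lambda>v. frechet_derivative f (at (c + L y)) (L v))) (at y)" for y
    by (rule has_derivative_compose[OF _ Ck_Suc_has_derivative[OF Suc.prems], of "\<lambda>y. c + L y"])
       (auto intro!: derivative_eq_intros bounded_linear_imp_has_derivative assms)
  note e = has_derivative_basis_expansion[OF Ck_Suc_has_derivative[OF Suc.prems]]
  show ?case
  proof (rule Ck_SucI[OF d])
    fix b :: 'a assume "b \<in> Basis"
    show "Ck k (\<lambda>y. frechet_derivative f (at (c + L y)) (L b))"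
      unfolding e[of _ "L b"] using Suc by (auto intro!: Ck_sum Ck_mult)
  qed
qed

lemma Ck_inner: "Ck k (\<lambda>z::'a::euclidean_space. z \<bullet> b)"
proof (cases k)
  case (Suc j)
  show ?thesis unfolding Suc
    by (rule Ck_SucI[where f' = "\<lambda>_ v. v \<bullet> b"]) (auto intro!: derivative_eq_intros)
qed (auto intro: continuous_intros)

text \<open>The flat function exp(-1/s), with a polynomial in 1/s as a factor so that the family is
  closed under differentiation.\<close>

definition exp_flat :: "real poly \<Rightarrow> real \<Rightarrow> real" where
  "exp_flat P s = (if s > 0 then poly P (1 / s) * exp (- (1 / s)) else 0)"

lemma poly_div_exp_tendsto_0: "((\<lambda>y::real. poly P y * exp (- y)) \<longlongrightarrow> 0) at_top"
proof -
  have "((\<lambda>y::real. \<Sum>i\<le>degree P. coeff P i * (y ^ i / exp y)) \<longlongrightarrow> (\<Sum>i\<le>degree P. coeff P i * 0)) at_top"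
    by (intro tendsto_intros tendsto_power_div_exp_0)
  then show ?thesis
    by (simp add: poly_altdef sum_distrib_right exp_minus divide_inverse mult.assoc)
qed

text \<open>For s > 0 the derivative of P(1/s) exp(-1/s) is s^(-2) (P - P')(1/s) exp(-1/s), whence
  the factor X^2 in the new polynomial. At 0 both one-sided difference quotients tend to 0, the
  right one because the exponential beats every power of 1/s.\<close>

lemma exp_flat_has_derivative:
  "(exp_flat P has_real_derivative exp_flat ([:0, 0, 1:] * (P - pderiv P)) s) (at s)"
proof -
  consider "s > 0" | "s < 0" | "s = 0" by linarith
  then show ?thesis
  proof cases
    case 1
    have "((\<lambda>s. poly P (1 / s) * exp (- (1 / s))) has_real_derivative
        exp_flat ([:0, 0, 1:] * (P - pderiv P)) s) (at s)"
      using 1 by (auto intro!: derivative_eq_intros DERIV_chain2[OF poly_DERIV]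
          simp: exp_flat_def field_simps power2_eq_square)
    then show ?thesis
      by (rule has_field_derivative_transform_within_open[where S = "{0<..}"]) (use 1 in \<open>auto simp: exp_flat_def\<close>)
  next
    case 2
    have "((\<lambda>s. 0) has_real_derivative exp_flat ([:0, 0, 1:] * (P - pderiv P)) s) (at s)"
      using 2 by (auto simp: exp_flat_def)
    then show ?thesis
      by (rule has_field_derivative_transform_within_open[where S = "{..<0}"]) (use 2 in \<open>auto simp: exp_flat_def\<close>)
  next
    case 3
    have "((\<lambda>h. poly ([:0, 1:] * P) (inverse h) * exp (- inverse h)) \<longlongrightarrow> 0) (at_right 0)"
      by (rule filterlim_compose[OF poly_div_exp_tendsto_0 filterlim_inverse_at_top_right])
    then have r: "((\<lambda>h. (exp_flat P h - exp_flat P 0) / h) \<longlongrightarrow> 0) (at_right 0)"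
      by (rule Lim_transform_eventually)
         (auto simp: eventually_at_right_less exp_flat_def field_simps eventually_at_filter)
    have "((\<lambda>h. 0) \<longlongrightarrow> 0) (at_left (0::real))" by simp
    then have l: "((\<lambda>h. (exp_flat P h - exp_flat P 0) / h) \<longlongrightarrow> 0) (at_left 0)"
      by (rule Lim_transform_eventually) (auto simp: exp_flat_def eventually_at_filter)
    show ?thesis
      using filterlim_split_at[OF l r] 3 by (simp add: DERIV_def exp_flat_def)
  qed
qed

text \<open>The induction runs over all polynomials at once, since differentiating replaces P by
  another one. The argument is quadratic in z, so the composition stays smooth at the centre, where
  the norm itself is not.\<close>

lemma Ck_exp_flat_ball: "Ck k (\<lambda>z::'a::euclidean_space. exp_flat P (c - z \<bullet> z))"
proof (induction k arbitrary: P)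
  case 0
  have "continuous_on UNIV (exp_flat P)"
    using exp_flat_has_derivative by (meson DERIV_isCont continuous_at_imp_continuous_on)
  then show ?case
    by (auto intro!: continuous_on_compose2[of UNIV "exp_flat P"] continuous_intros)
next
  case (Suc k)
  let ?Q = "[:0, 0, 1:] * (P - pderiv P)"
  have d: "((\<lambda>z. exp_flat P (c - z \<bullet> z)) has_derivative
      (\<lambda>v. (- 2 * (z \<bullet> v)) * exp_flat ?Q (c - z \<bullet> z))) (at z)" for z :: 'a
    by (rule DERIV_compose_FDERIV[OF exp_flat_has_derivative]) 
       (auto intro!: derivative_eq_intros simp: inner_commute)
  show ?case
    by (rule Ck_SucI[OF d]) (intro Ck_mult Ck_const Ck_inner Suc.IH)
qed

section \<open>Support, bounds and uniform continuity of test functions\<close>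

lemma test_functionD:
  assumes "test_function W \<phi>"
  shows "Ck k \<phi>" "compact (closure {z. \<phi> z \<noteq> 0})" "closure {z. \<phi> z \<noteq> 0} \<subseteq> W"
    "(\<phi> has_derivative frechet_derivative \<phi> (at z)) (at z)"
    "b \<in> Basis \<Longrightarrow> continuous_on UNIV (\<lambda>z. frechet_derivative \<phi> (at z) b)"
    "continuous_on UNIV \<phi>"
  using assms Ck_Suc_has_derivative[of 0 \<phi>] unfolding test_function_def compactly_contained_def
  by (force dest: spec[of _ 0] spec[of _ 1] simp del: Ck.simps(2) simp: Ck.simps(2)[of 0])+

lemma frechet_derivative_eq_0_outside_support:
  assumes "z \<notin> closure {z. \<phi> z \<noteq> 0}"
  shows "frechet_derivative \<phi> (at z) v = (0::real)"
proof -
  have "((\<lambda>z. 0::real) has_derivative (\<lambda>v. 0)) (at z)" by simp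
  then have "(\<phi> has_derivative (\<lambda>v. 0)) (at z)"
    by (rule has_derivative_transform_within_open[OF _ open_Compl[OF closed_closure[of "{z. \<phi> z \<noteq> 0}"]]])
       (use assms closure_subset in force)+
  then show ?thesis
    using frechet_derivative_at by metis
qed

lemma test_function_partial:
  assumes "test_function W \<phi>" "b \<in> Basis"
  shows "test_function W (\<lambda>z. frechet_derivative \<phi> (at z) b)"
proof -
  have "{z. frechet_derivative \<phi> (at z) b \<noteq> 0} \<subseteq> closure {z. \<phi> z \<noteq> 0}"
    using frechet_derivative_eq_0_outside_support by blast
  then have sub: "closure {z. frechet_derivative \<phi> (at z) b \<noteq> 0} \<subseteq> closure {z. \<phi> z \<noteq> 0}"
    by (simp add: closure_minimal)
  then have "compact (closure {z. frechet_derivative \<phi> (at z) b \<noteq> 0})"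
    using test_functionD(2)[OF assms(1)] compact_Int_closed[OF _ closed_closure] by (metis inf.absorb2)
  moreover have "Ck k (\<lambda>z. frechet_derivative \<phi> (at z) b)" for k
    using test_functionD(1)[OF assms(1), of "Suc k"] assms(2) by simp
  ultimately show ?thesis
    using sub test_functionD(3)[OF assms(1)] unfolding test_function_def compactly_contained_def by auto
qed

lemma test_function_bounded:
  fixes \<phi> :: "'a::euclidean_space \<Rightarrow> real"
  assumes "test_function W \<phi>"
  obtains B where "B > 0" "\<And>z. \<bar>\<phi> z\<bar> \<le> B"
proof -
  have "compact (\<phi> ` closure {z. \<phi> z \<noteq> 0})"
    using test_functionD(2,6)[OF assms] compact_continuous_image continuous_on_subset by blast
  then obtain B where B: "B > 0" "\<And>y. y \<in> \<phi> ` closure {z. \<phi> z \<noteq> 0} \<Longrightarrow> norm y \<le> B"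
    using compact_imp_bounded bounded_pos by metis
  have "\<bar>\<phi> z\<bar> \<le> B" for z
    using B closure_subset[of "{z. \<phi> z \<noteq> 0}"] by (cases "\<phi> z = 0") auto
  then show ?thesis using that B(1) by blast
qed

lemma test_function_uniformly_continuous:
  fixes \<phi> :: "'a::euclidean_space \<Rightarrow> real"
  assumes "test_function W \<phi>" "e > 0"
  obtains d where "d > 0" "\<And>x y::'a. dist x y < d \<Longrightarrow> dist (\<phi> x) (\<phi> y) < e"
proof -
  let ?K = "closure {z. \<phi> z \<noteq> 0}"
  obtain R where R: "\<And>z. z \<in> ?K \<Longrightarrow> norm z \<le> R"
    using compact_imp_bounded[OF test_functionD(2)[OF assms(1)]] bounded_iff by metis
  have "uniformly_continuous_on (cball 0 (R + 1)) \<phi>"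
    using test_functionD(6)[OF assms(1)] by (auto intro!: compact_uniformly_continuous continuous_on_subset[of UNIV])
  then obtain d where d: "d > 0" "\<And>x y. x \<in> cball 0 (R + 1) \<Longrightarrow> y \<in> cball 0 (R + 1) \<Longrightarrow> dist y x < d \<Longrightarrow> dist (\<phi> y) (\<phi> x) < e"
    using \<open>e > 0\<close> unfolding uniformly_continuous_on_def by metis
  have out: "\<phi> z = 0" if "norm z > R" for z
    using that R[of z] closure_subset[of "{z. \<phi> z \<noteq> 0}"] by force
  show ?thesis
  \<comment> \<open>Points at distance below 1 that do not both lie in the ball of radius R + 1 both
    lie outside the ball of radius R, where \<phi> vanishes.\<close>
  proof (rule that[of "min d 1"])
    fix x y :: 'a assume xy: "dist x y < min d 1"
    have n: "\<bar>norm x - norm y\<bar> < 1"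
      using xy norm_triangle_ineq3[of x y] by (simp add: dist_norm)
    show "dist (\<phi> x) (\<phi> y) < e"
    proof (cases "norm x \<le> R + 1 \<and> norm y \<le> R + 1")
      case True
      then show ?thesis using d(2)[of y x] xy by simp
    next
      case False
      then have "norm x > R" "norm y > R" using n by auto
      then show ?thesis using \<open>e > 0\<close> by (simp add: out)
    qed
  qed (use d in auto)
qed

text \<open>Evenness is part of the notion because it makes convolution with \<open>k\<close>
  self-adjoint and convolution with its partial derivatives skew-adjoint. The radius only bounds the
  support from outside, so that one kernel can serve several prescribed radii.\<close>

definition mollifier :: "real \<Rightarrow> ('a::euclidean_space \<Rightarrow> real) \<Rightarrow> bool" where
  "mollifier r k \<longleftrightarrow> test_function UNIV k \<and> (\<forall>z. 0 \<le> k z) \<and> (\<forall>z. r \<le> norm z \<longrightarrow> k z = 0) \<and>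
     (\<forall>z. k (- z) = k z) \<and> integrable lborel k \<and> integral\<^sup>L lborel k = 1"

lemma mollifier_exists:
  assumes "r > 0"
  shows "\<exists>k::'a::euclidean_space \<Rightarrow> real. mollifier r k"
proof -
  define m where "m = (\<lambda>z::'a. exp_flat 1 (r\<^sup>2 - z \<bullet> z))"
  have e: "z \<bullet> z < r\<^sup>2 \<longleftrightarrow> norm z < r" for z :: 'a
    using \<open>r > 0\<close> by (subst norm_lt_square) simp
  have nz: "m z \<noteq> 0 \<longleftrightarrow> norm z < r" and nn: "m z \<ge> 0" for z
    by (simp_all add: m_def exp_flat_def e)
  have supp: "{z. m z \<noteq> 0} = ball 0 r"
    by (rule set_eqI) (simp only: nz mem_Collect_eq mem_ball_0)
  have ck: "Ck k m" for k unfolding m_def by (rule Ck_exp_flat_ball)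
  have cont: "continuous_on UNIV m" using ck[of 0] by simp
  have "integrable lborel (\<lambda>z. indicator (cball 0 r) z *\<^sub>R m z)"
    using borel_integrable_compact[of "cball 0 r" m] cont continuous_on_subset by auto
  moreover have "(\<lambda>z. indicator (cball 0 r) z *\<^sub>R m z) = m"
    using nz by (force simp: indicator_def)
  ultimately have int: "integrable lborel m" by simp
  have "integral\<^sup>L lborel m \<noteq> 0"
  proof
    assume "integral\<^sup>L lborel m = 0"
    then have "AE z in lborel. m z = 0"
      using integral_nonneg_eq_0_iff_AE[OF int] nn by auto
    then have "emeasure lborel (ball (0::'a) r) = 0"
      using supp by (subst (asm) AE_iff_measurable[OF _ refl]) auto
    then show False using content_ball_pos[OF \<open>r > 0\<close>, of "0::'a"] by (simp add: measure_def)
  qed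
  moreover have "integral\<^sup>L lborel m \<ge> 0" by (simp add: nn)
  ultimately have I: "integral\<^sup>L lborel m > 0" by simp
  define k where "k = (\<lambda>z. inverse (integral\<^sup>L lborel m) * m z)"
  have "{z. k z \<noteq> 0} = ball 0 r" using I supp by (auto simp: k_def)
  then have "test_function UNIV k"
    using ck by (auto simp: test_function_def compactly_contained_def k_def intro!: Ck_mult)
  then have "mollifier r k"
    unfolding mollifier_def
  proof (intro conjI allI impI)
    show "0 \<le> k z" for z using nn I by (simp add: k_def)
    show "k z = 0" if "r \<le> norm z" for z using nz[of z] that by (simp add: k_def)
    show "k (- z) = k z" for z by (simp add: k_def m_def)
    show "integrable lborel k" using int by (simp add: k_def)
    show "integral\<^sup>L lborel k = 1" using I int by (simp add: k_def)
  qed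
  then show ?thesis by blast
qed

subsection \<open>Integration by parts and convolution\<close>

lemma lborel_distr_reflect:
  fixes c :: "'a::euclidean_space"
  shows "distr lborel borel (\<lambda>x. c - x) = lborel"
  using lborel_affine[of "-1" c] by (simp add: density_1)

lemma integrable_lborel_plus:
  fixes f :: "'a::euclidean_space \<Rightarrow> 'b::{banach, second_countable_topology}"
  assumes "integrable lborel f"
  shows "integrable lborel (\<lambda>x. f (c + x))" "integral\<^sup>L lborel (\<lambda>x. f (c + x)) = integral\<^sup>L lborel f"
  using assms integrable_distr_eq[of "(+) c" lborel borel f] integral_distr[of "(+) c" lborel borel f]
  by (simp_all add: lborel_distr_plus)

lemma integrable_lborel_reflect:
  fixes f :: "'a::euclidean_space \<Rightarrow> 'b::{banach, second_countable_topology}"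
  assumes "integrable lborel f"
  shows "integrable lborel (\<lambda>x. f (c - x))" "integral\<^sup>L lborel (\<lambda>x. f (c - x)) = integral\<^sup>L lborel f"
  using assms integrable_distr_eq[of "\<lambda>x. c - x" lborel borel f] integral_distr[of "\<lambda>x. c - x" lborel borel f]
  by (simp_all add: lborel_distr_reflect)

lemma integrable_compact_support:
  fixes g :: "'a::euclidean_space \<Rightarrow> 'b::{banach, second_countable_topology}"
  assumes "continuous_on UNIV g" "compact K" "\<And>z. z \<notin> K \<Longrightarrow> g z = 0"
  shows "integrable lborel g"
proof -
  have "integrable lborel (\<lambda>z. indicator K z *\<^sub>R g z)"
    using assms(1) continuous_on_subset by (auto intro!: borel_integrable_compact assms(2))
  moreover have "(\<lambda>z. indicator K z *\<^sub>R g z) = g"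
    using assms(3) by (force simp: indicator_def)
  ultimately show ?thesis by simp
qed

text \<open>By translation invariance every difference quotient of \<open>g\<close> in direction
  \<open>b\<close> has integral 0; dominated convergence carries this over to the derivative. No
  slicing along lines is involved, so \<open>b\<close> may be any vector and continuity of the
  derivative is asked for in this direction only.\<close>

lemma integral_directional_derivative_eq_0:
  fixes g :: "'a::euclidean_space \<Rightarrow> real"
  assumes der: "\<And>z. (g has_derivative g' z) (at z)" and cont: "continuous_on UNIV (\<lambda>z. g' z b)"
    and K: "compact K" "\<And>z. z \<notin> K \<Longrightarrow> g z = 0"
  shows "(LBINT z. g' z b) = 0"
proof -
  have contg: "continuous_on UNIV g"
    using der has_derivative_continuous by (blast intro: continuous_at_imp_continuous_on)
  have intg: "integrable lborel g" by (rule integrable_compact_support[OF contg K])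
  obtain R where R: "\<And>z. z \<in> K \<Longrightarrow> norm z \<le> R"
    using compact_imp_bounded[OF K(1)] bounded_iff by metis
  define C where "C = cball (0::'a) (R + 2 * norm b)"
  have "compact ((\<lambda>z. g' z b) ` C)"
    using cont continuous_on_subset by (auto simp: C_def intro!: compact_continuous_image)
  then obtain M where M: "\<And>z. z \<in> C \<Longrightarrow> \<bar>g' z b\<bar> \<le> M" and "M > 0"
    using compact_imp_bounded bounded_pos by (metis imageI real_norm_def)
  define s where "s = (\<lambda>n. inverse (real (Suc n)))"
  have s: "0 < s n" "s n \<le> 1" for n by (auto simp: s_def field_simps)
  have s0: "s \<longlonglongrightarrow> 0" unfolding s_def by (rule LIMSEQ_inverse_real_of_nat)
  define q where "q = (\<lambda>n z. (g (s n *\<^sub>R b + z) - g z) / s n)"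
  have line: "((\<lambda>t. g (t *\<^sub>R b + z)) has_real_derivative g' (t *\<^sub>R b + z) b) (at t)" for z t
  proof -
    have "((\<lambda>t. g (t *\<^sub>R b + z)) has_derivative (\<lambda>h. g' (t *\<^sub>R b + z) (h *\<^sub>R b))) (at t)"
      by (rule has_derivative_compose[OF _ der, of "\<lambda>t. t *\<^sub>R b + z"]) (auto intro!: derivative_eq_intros)
    then show ?thesis
      using linear_cmul[OF has_derivative_linear[OF der]]
      by (simp add: has_field_derivative_def mult.commute[of _ "g' _ b"])
  qed
  have bound: "norm (q n z) \<le> indicator C z * M" for n z
  proof (cases "norm z \<le> R + norm b")
    case True
    obtain \<xi> where \<xi>: "0 < \<xi>" "\<xi> < s n" "g (s n *\<^sub>R b + z) - g (0 *\<^sub>R b + z) = (s n - 0) * g' (\<xi> *\<^sub>R b + z) b"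
      using MVT2[of 0 "s n" "\<lambda>t. g (t *\<^sub>R b + z)", OF _ line] s(1)[of n] by auto
    have "norm (\<xi> *\<^sub>R b) \<le> norm b" 
      using \<xi>(1,2) s(2)[of n] by (simp add: mult_left_le_one_le)
    then have "\<xi> *\<^sub>R b + z \<in> C"
      using True norm_triangle_ineq[of "\<xi> *\<^sub>R b" z] by (auto simp: C_def)
    then have "norm (q n z) \<le> M"
      using M \<xi>(3) s(1)[of n] by (simp add: q_def)
    moreover have "z \<in> C" using True norm_ge_zero[of b] unfolding C_def mem_cball_0 by linarith
    ultimately show ?thesis by simp
  next
    case False
    have "norm (s n *\<^sub>R b) \<le> norm b" 
      using s[of n] by (simp add: mult_left_le_one_le)
    then have "norm (s n *\<^sub>R b + z) > R" 
      using False norm_triangle_ineq4[of "s n *\<^sub>R b + z" "s n *\<^sub>R b"] by simp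
    moreover have "norm z > R" using False norm_ge_zero[of b] by linarith
    ultimately have "z \<notin> K" "s n *\<^sub>R b + z \<notin> K" using R by force+
    then show ?thesis using K(2) \<open>M > 0\<close> by (simp add: q_def)
  qed
  have "(\<lambda>n. LBINT z. q n z) \<longlonglongrightarrow> (LBINT z. g' z b)"
  proof (rule integral_dominated_convergence[where w = "\<lambda>z. indicator C z * M"])
    show "(\<lambda>z. g' z b) \<in> borel_measurable lborel"
      using borel_measurable_continuous_onI[OF cont] by simp
    show "q n \<in> borel_measurable lborel" for n
      unfolding q_def using borel_measurable_continuous_onI[OF contg] by measurable
    show "integrable lborel (\<lambda>z. indicator C z * M)"
      by (intro integrable_mult_left integrable_real_indicator) (auto simp: C_def intro!: emeasure_bounded_finite[unfolded infinity_ennreal_def])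
    show "AE z in lborel. (\<lambda>n. q n z) \<longlonglongrightarrow> g' z b"
    proof (rule AE_I2)
      fix z
      have "((\<lambda>t. (g (t *\<^sub>R b + z) - g z) / t) \<longlongrightarrow> g' z b) (at 0)"
        using line[of z 0] by (simp add: DERIV_def)
      moreover have "filterlim s (at 0) sequentially"
        using s0 s(1) by (auto simp: filterlim_at less_imp_neq[symmetric])
      ultimately show "(\<lambda>n. q n z) \<longlonglongrightarrow> g' z b"
        unfolding q_def by (rule filterlim_compose)
    qed
    show "AE z in lborel. norm (q n z) \<le> indicator C z * M" for n using bound by simp
  qed
  moreover have "(LBINT z. q n z) = 0" for n
    unfolding q_def using integrable_lborel_plus[OF intg, of "s n *\<^sub>R b"] intg by simp
  ultimately show ?thesis by (simp add: LIMSEQ_const_iff)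
qed

lemma test_function_measurable [measurable_dest]:
  "test_function W \<phi> \<Longrightarrow> \<phi> \<in> borel_measurable borel"
  using test_functionD(6) borel_measurable_continuous_onI by blast

text \<open>The partials are uniformly continuous, and the mean value inequality turns this into a
  remainder bound with \<open>d\<close> independent of the base point. This uniformity allows
  integrating the remainder against an arbitrary integrable function.\<close>

lemma test_function_uniformly_differentiable:
  fixes k :: "'a::euclidean_space \<Rightarrow> real"
  assumes k: "test_function W k" and "e > 0"
  obtains d where "d > 0"
    "\<And>u v. norm v < d \<Longrightarrow> \<bar>k (u + v) - k u - frechet_derivative k (at u) v\<bar> \<le> e * norm v"
proof -
  let ?k' = "\<lambda>u. frechet_derivative k (at u)"
  have e': "e / DIM('a) > 0" using \<open>e > 0\<close> by simp
  have "\<exists>d>0. \<forall>x y. dist x y < d \<longrightarrow> dist (?k' x b) (?k' y b) < e / DIM('a)" if "b \<in> Basis" for b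
    using test_function_uniformly_continuous[OF test_function_partial[OF k that] e'] by metis
  then obtain d where d: "\<And>b. b \<in> Basis \<Longrightarrow> d b > 0"
    "\<And>b x y. b \<in> Basis \<Longrightarrow> dist x y < d b \<Longrightarrow> dist (?k' x b) (?k' y b) < e / DIM('a)"
    by metis
  define \<delta> where "\<delta> = Min (d ` Basis)"
  have "\<delta> > 0" using d(1) by (auto simp: \<delta>_def)
  have \<delta>: "\<bar>?k' x b - ?k' y b\<bar> \<le> e / DIM('a)" if "b \<in> Basis" "dist x y < \<delta>" for b x y
    using d(2)[of b x y] that by (fastforce simp: \<delta>_def dist_real_def)
  show ?thesis
  proof (rule that[OF \<open>\<delta> > 0\<close>])
    fix u v :: 'a assume v: "norm v < \<delta>"
    have "norm (k (u + v) - k u - ?k' u ((u + v) - u)) \<le> norm ((u + v) - u) * e"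
    proof (rule differentiable_bound_linearization[where S = "ball u \<delta>"])
      show "u + t *\<^sub>R (u + v - u) \<in> ball u \<delta>" if "t \<in> {0..1}" for t
      proof -
        have "norm (t *\<^sub>R v) \<le> norm v" using that by (simp add: mult_left_le_one_le)
        then show ?thesis using v by (simp add: dist_norm)
      qed
      show "(k has_derivative ?k' x) (at x within ball u \<delta>)" for x
        using test_functionD(4)[OF k] has_derivative_at_withinI by blast
      show "u \<in> ball u \<delta>" using \<open>\<delta> > 0\<close> by simp
      fix x assume x: "x \<in> ball u \<delta>"
      show "onorm (?k' x - ?k' u) \<le> e"
      proof (rule onorm_le)
        fix w
        have "(?k' x - ?k' u) w = (\<Sum>b\<in>Basis. (w \<bullet> b) * (?k' x b - ?k' u b))"
          using has_derivative_basis_expansion[OF test_functionD(4)[OF k], of _ w]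
          by (simp add: right_diff_distrib sum_subtractf)
        also have "norm \<dots> \<le> (\<Sum>b\<in>(Basis::'a set). norm w * (e / DIM('a)))"
          using \<delta>[of _ x u] x Basis_le_norm[of _ w]
          by (intro sum_norm_le, unfold real_norm_def abs_mult, intro mult_mono) (auto simp: dist_commute)
        finally show "norm ((?k' x - ?k' u) w) \<le> e * norm w" by (simp add: mult.commute)
      qed
    qed
    then show "\<bar>k (u + v) - k u - ?k' u v\<bar> \<le> e * norm v" by (simp add: mult.commute)
  qed
qed

section \<open>Convolution of an integrable function with a test function\<close>

definition conv :: "('a::euclidean_space \<Rightarrow> real) \<Rightarrow> ('a \<Rightarrow> real) \<Rightarrow> 'a \<Rightarrow> real" where
  "conv k f z = (LBINT y. k (z - y) * f y)"

lemma integrable_bounded_mult: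
  fixes f g :: "'a \<Rightarrow> real"
  assumes "integrable M f" "g \<in> borel_measurable M" "\<And>x. \<bar>g x\<bar> \<le> B"
  shows "integrable M (\<lambda>x. g x * f x)"
proof (rule Bochner_Integration.integrable_bound[of _ "\<lambda>x. B * f x"])
  show "AE x in M. norm (g x * f x) \<le> norm (B * f x)"
    using assms(3) by (auto simp: abs_mult intro!: AE_I2 mult_right_mono order_trans[OF assms(3)])
qed (use assms in auto)

lemma integrable_mult_test_function:
  fixes f \<phi> :: "'a::euclidean_space \<Rightarrow> real"
  assumes f: "integrable lborel f" and \<phi>: "test_function W \<phi>"
  shows "integrable lborel (\<lambda>z. f z * \<phi> z)"
proof -
  obtain B where "\<And>z. \<bar>\<phi> z\<bar> \<le> B" using test_function_bounded[OF \<phi>] by metis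
  then show ?thesis
    using integrable_bounded_mult[OF f, of \<phi> B] test_function_measurable[OF \<phi>] by (simp add: mult.commute)
qed

lemma integrable_conv_kernel:
  assumes "test_function W k" "integrable lborel f"
  shows "integrable lborel (\<lambda>y. k (z - y) * f y)"
proof -
  obtain B where "\<And>z. \<bar>k z\<bar> \<le> B" using test_function_bounded[OF assms(1)] by metis
  moreover have "(\<lambda>y. k (z - y)) \<in> borel_measurable lborel"
    using test_function_measurable[OF assms(1)] by measurable
  ultimately show ?thesis using integrable_bounded_mult[OF assms(2)] by metis
qed

text \<open>All increments fall on the kernel, whose first-order remainder is uniformly small and
  stays small when integrated against |f|. Dividing by N + 1, with N the L^1 norm of
  \<open>f\<close>, also covers N = 0.\<close>

lemma conv_has_derivative:
  fixes k :: "'a::euclidean_space \<Rightarrow> real"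
  assumes k: "test_function W k" and f: "integrable lborel f"
  shows "(conv k f has_derivative (\<lambda>v. conv (\<lambda>u. frechet_derivative k (at u) v) f z)) (at z)"
proof -
  let ?k' = "\<lambda>u. frechet_derivative k (at u)"
  let ?D = "\<lambda>v. conv (\<lambda>u. ?k' u v) f z"
  have expand: "?k' u v = (\<Sum>b\<in>Basis. (v \<bullet> b) * ?k' u b)" for u v
    by (rule has_derivative_basis_expansion[OF test_functionD(4)[OF k]])
  have intb: "integrable lborel (\<lambda>y. ?k' (z - y) b * f y)" if "b \<in> Basis" for b
    by (rule integrable_conv_kernel[OF test_function_partial[OF k that] f])
  have inteq: "(\<lambda>y. ?k' (z - y) v * f y) = (\<lambda>y. \<Sum>b\<in>Basis. (v \<bullet> b) * (?k' (z - y) b * f y))" for v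
    by (subst expand) (simp add: sum_distrib_right mult.assoc)
  have int: "integrable lborel (\<lambda>y. ?k' (z - y) v * f y)" for v
    unfolding inteq using intb by simp
  have D: "?D v = (\<Sum>b\<in>Basis. (v \<bullet> b) * ?D b)" for v
  proof -
    have "?D v = (LBINT y. (\<Sum>b\<in>Basis. (v \<bullet> b) * (?k' (z - y) b * f y)))"
      unfolding conv_def by (simp only: inteq)
    then show ?thesis using intb by (simp add: conv_def)
  qed
  have "bounded_linear (\<lambda>v. \<Sum>b\<in>Basis. (v \<bullet> b) * ?D b)"
    by (intro bounded_linear_sum bounded_linear_mult_const[THEN bounded_linear_compose] bounded_linear_inner_left
        bounded_linear_mult_left[THEN bounded_linear_compose])
  then have lin: "bounded_linear ?D" by (simp only: D[symmetric])
  show ?thesis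
    unfolding has_derivative_at_alt
  proof (intro conjI lin allI impI)
    fix e :: real assume "e > 0"
    define N where "N = (LBINT y. \<bar>f y\<bar>)"
    have "N \<ge> 0" by (simp add: N_def)
    then have "e / (N + 1) > 0" using \<open>e > 0\<close> by simp
    then obtain d where d: "d > 0"
      "\<And>u v. norm v < d \<Longrightarrow> \<bar>k (u + v) - k u - ?k' u v\<bar> \<le> e / (N + 1) * norm v"
      using test_function_uniformly_differentiable[OF k] by metis
    show "\<exists>d>0. \<forall>y. norm (y - z) < d \<longrightarrow> norm (conv k f y - conv k f z - ?D (y - z)) \<le> e * norm (y - z)"
    proof (intro exI conjI allI impI)
      fix y assume y: "norm (y - z) < d"
      have "conv k f y - conv k f z - ?D (y - z) =
          (LBINT x. (k (y - x) - k (z - x) - ?k' (z - x) (y - z)) * f x)"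
        using integrable_conv_kernel[OF k f] int by (simp add: conv_def left_diff_distrib)
      also have "norm \<dots> \<le> (LBINT x. e / (N + 1) * norm (y - z) * \<bar>f x\<bar>)"
      proof (rule Bochner_Integration.integral_norm_bound_integral)
        show "integrable lborel (\<lambda>x. (k (y - x) - k (z - x) - ?k' (z - x) (y - z)) * f x)"
          using integrable_conv_kernel[OF k f] int by (simp add: left_diff_distrib)
        show "integrable lborel (\<lambda>x. e / (N + 1) * norm (y - z) * \<bar>f x\<bar>)"
          using f by auto
        fix x
        show "norm ((k (y - x) - k (z - x) - ?k' (z - x) (y - z)) * f x) \<le> e / (N + 1) * norm (y - z) * \<bar>f x\<bar>"
          using mult_right_mono[OF d(2)[OF y, of "z - x"], of "\<bar>f x\<bar>"] by (simp add: abs_mult)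
      qed
      also have "\<dots> = (e * norm (y - z)) * (N / (N + 1))" by (simp add: N_def)
      also have "\<dots> \<le> (e * norm (y - z)) * 1"
        using \<open>N \<ge> 0\<close> \<open>e > 0\<close> by (intro mult_left_mono) auto
      finally show "norm (conv k f y - conv k f z - ?D (y - z)) \<le> e * norm (y - z)" by simp
    qed (rule d(1))
  qed
qed

lemma Ck_conv:
  assumes "test_function W k" "integrable lborel f"
  shows "Ck m (conv k f)"
  using assms(1)
proof (induction m arbitrary: k)
  case 0
  show ?case
    using has_derivative_continuous[OF conv_has_derivative[OF 0 assms(2)]]
    by (simp add: continuous_at_imp_continuous_on)
next
  case (Suc m)
  show ?case
    by (rule Ck_SucI[OF conv_has_derivative[OF Suc.prems assms(2)]])
       (rule Suc.IH[OF test_function_partial[OF Suc.prems]])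
qed

lemma conv_continuous:
  "test_function W k \<Longrightarrow> integrable lborel f \<Longrightarrow> continuous_on UNIV (conv k f)"
  using Ck_conv[of W k f 0] by simp

lemma integrable_mult_kernel_pair:
  fixes f g :: "'a::euclidean_space \<Rightarrow> real"
  assumes k: "test_function W k" and f: "integrable lborel f" and g: "integrable lborel g"
  shows "integrable (lborel \<Otimes>\<^sub>M lborel) (\<lambda>(z, y). f z * (k (z - y) * g y))"
proof -
  obtain B where B: "B > 0" "\<And>z. \<bar>k z\<bar> \<le> B" using test_function_bounded[OF k] by metis
  have [measurable]: "k \<in> borel_measurable borel" "f \<in> borel_measurable borel" "g \<in> borel_measurable borel"
    using test_function_measurable[OF k] f g by auto
  have fg: "integrable (lborel \<Otimes>\<^sub>M lborel) (\<lambda>(z, y). f z * g y)"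
  proof (rule lborel_pair.Fubini_integrable)
    show "integrable lborel (\<lambda>x. LBINT y. norm (case (x, y) of (z, y) \<Rightarrow> f z * g y))"
      using f g by (simp add: abs_mult)
    show "AE x in lborel. integrable lborel (\<lambda>y. case (x, y) of (z, y) \<Rightarrow> f z * g y)"
      using g by simp
  qed measurable
  show ?thesis
  proof (rule Bochner_Integration.integrable_bound[of _ "\<lambda>x. B * (case x of (z, y) \<Rightarrow> f z * g y)"])
    show "integrable (lborel \<Otimes>\<^sub>M lborel) (\<lambda>x. B * (case x of (z, y) \<Rightarrow> f z * g y))" using fg by simp
    have "\<bar>f z\<bar> * (\<bar>k (z - y)\<bar> * \<bar>g y\<bar>) \<le> B * (\<bar>f z\<bar> * \<bar>g y\<bar>)" for z y
      using mult_right_mono[OF B(2)[of "z - y"], of "\<bar>f z\<bar> * \<bar>g y\<bar>"] by (simp add: mult_ac)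
    then show "AE x in lborel \<Otimes>\<^sub>M lborel. norm (case x of (z, y) \<Rightarrow> f z * (k (z - y) * g y))
        \<le> norm (B * (case x of (z, y) \<Rightarrow> f z * g y))"
      using B(1) by (auto simp: abs_mult)
  qed measurable
qed

text \<open>Fubini's theorem. This is how a mollifier is moved from the test function to the
  solution.\<close>

lemma integral_mult_conv:
  fixes f g :: "'a::euclidean_space \<Rightarrow> real"
  assumes k: "test_function W k" and f: "integrable lborel f" and g: "integrable lborel g"
  shows "(LBINT z. f z * conv k g z) = (LBINT y. g y * conv (\<lambda>u. k (- u)) f y)"
proof -
  have "(LBINT y. LBINT z. (case (z, y) of (z, y) \<Rightarrow> f z * (k (z - y) * g y)))
      = (LBINT z. LBINT y. (case (z, y) of (z, y) \<Rightarrow> f z * (k (z - y) * g y)))"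
    using lborel_pair.Fubini_integral[of "\<lambda>z y. f z * (k (z - y) * g y)"] integrable_mult_kernel_pair[OF assms]
    by simp
  moreover have "(LBINT z. f z * (k (z - y) * g y)) = g y * conv (\<lambda>u. k (- u)) f y" for y
    unfolding conv_def integral_mult_right_zero[symmetric]
    by (rule Bochner_Integration.integral_cong) (auto simp: mult_ac)
  ultimately show ?thesis by (simp add: conv_def)
qed

lemma conv_eq_0:
  assumes "\<And>y. k (z - y) \<noteq> 0 \<Longrightarrow> f y = 0"
  shows "conv k f z = 0"
proof -
  have "(\<lambda>y. k (z - y) * f y) = (\<lambda>y. 0)" using assms by force
  then show ?thesis unfolding conv_def by simp
qed

lemma mollifierD:
  assumes "mollifier r k"
  shows "test_function UNIV k" "0 \<le> k z" "r \<le> norm z \<Longrightarrow> k z = 0" "k (- z) = k z"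
    "integrable lborel k" "integral\<^sup>L lborel k = 1"
    "integrable lborel (\<lambda>y. k (z - y))" "(LBINT y. k (z - y)) = 1"
  using assms integrable_lborel_reflect[of k z] unfolding mollifier_def by metis+

text \<open>\<open>k\<close> is a probability density concentrated within distance r, so only the
  values of \<open>f\<close> that close to z count.\<close>

lemma conv_mollifier_le:
  assumes k: "mollifier r k" and f: "integrable lborel f" and le: "\<And>y. dist z y < r \<Longrightarrow> f y \<le> c"
  shows "conv k f z \<le> c"
proof -
  have "conv k f z \<le> (LBINT y. k (z - y) * c)"
    unfolding conv_def
  proof (rule integral_mono)
    show "integrable lborel (\<lambda>y. k (z - y) * f y)" by (rule integrable_conv_kernel[OF mollifierD(1)[OF k] f])
    show "integrable lborel (\<lambda>y. k (z - y) * c)" using mollifierD(7)[OF k] by simp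
    show "k (z - y) * f y \<le> k (z - y) * c" for y
    proof (cases "dist z y < r")
      case True
      show ?thesis by (rule mult_left_mono[OF le[OF True] mollifierD(2)[OF k]])
    next
      case False
      then have "k (z - y) = 0" by (intro mollifierD(3)[OF k]) (simp add: dist_norm)
      then show ?thesis by simp
    qed
  qed
  then show ?thesis using mollifierD(8)[OF k, of z] by simp
qed

lemma conv_mollifier_ge:
  assumes k: "mollifier r k" and f: "integrable lborel f" and ge: "\<And>y. dist z y < r \<Longrightarrow> c \<le> f y"
  shows "c \<le> conv k f z"
proof -
  have "conv k (\<lambda>y. - f y) z \<le> - c"
    using f ge by (intro conv_mollifier_le[OF k]) auto
  then show ?thesis by (simp add: conv_def)
qed

subsection \<open>Mollification in Lebesgue spaces\<close>

text \<open>Young's inequality for the factors s y and x / s, where s^p = \<mu> p makes the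
  coefficient of y^p equal to \<mu>. A factor that is merely bounded in L^p thus gets a small
  weight, at the cost of a large constant on the factor that will be made small.\<close>

lemma Youngs_inequality_scaled:
  fixes p q \<mu> :: real
  assumes "p > 1" "q > 1" "1 / p + 1 / q = 1" "\<mu> > 0"
  obtains \<Lambda> where "\<Lambda> > 0" "\<And>x y. 0 \<le> x \<Longrightarrow> 0 \<le> y \<Longrightarrow> x * y \<le> \<Lambda> * x powr q + \<mu> * y powr p"
proof -
  define s where "s = (\<mu> * p) powr (1 / p)"
  have s: "s > 0" "s powr p = \<mu> * p" using assms by (auto simp: s_def powr_powr)
  show ?thesis
  proof (rule that[of "1 / (s powr q * q)"])
    show "1 / (s powr q * q) > 0" using s(1) assms by simp
    fix x y :: real assume xy: "0 \<le> x" "0 \<le> y"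
    have "x * y = (s * y) * (x / s)" using s(1) by simp
    also have "\<dots> \<le> (s * y) powr p / p + (x / s) powr q / q"
      by (rule Youngs_inequality[OF assms(1-3)]) (use xy s(1) in auto)
    also have "\<dots> = 1 / (s powr q * q) * x powr q + \<mu> * y powr p"
      using xy s assms by (simp add: powr_mult powr_divide)
    finally show "x * y \<le> 1 / (s powr q * q) * x powr q + \<mu> * y powr p" .
  qed
qed

lemma powr_sum3_le:
  fixes a b c p :: real
  assumes "0 \<le> a" "0 \<le> b" "0 \<le> c" "p > 0"
  shows "(a + b + c) powr p \<le> 3 powr p * (a powr p + b powr p + c powr p)"
proof -
  define m where "m = max a (max b c)"
  have "(a + b + c) powr p \<le> (3 * m) powr p"
    using assms by (intro powr_mono2) (auto simp: m_def)
  also have "\<dots> = 3 powr p * m powr p" using assms by (simp add: powr_mult m_def)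
  also have "m powr p \<le> a powr p + b powr p + c powr p"
    unfolding m_def max_def by simp
  finally show ?thesis by (simp add: mult_left_mono)
qed

lemma nn_integral_lborel_minus:
  fixes f :: "'a::euclidean_space \<Rightarrow> ennreal"
  assumes [measurable]: "f \<in> borel_measurable borel"
  shows "(\<integral>\<^sup>+z. f (z - a) \<partial>lborel) = (\<integral>\<^sup>+z. f z \<partial>lborel)"
proof -
  have "(\<integral>\<^sup>+z. f z \<partial>distr lborel borel ((+) (- a))) = (\<integral>\<^sup>+z. f (- a + z) \<partial>lborel)"
    by (rule nn_integral_distr) auto
  then show ?thesis by (simp add: lborel_distr_plus)
qed

text \<open>The p-th power of the L^p norm, kept without the root and with values in
  \<open>ennreal\<close>: no integrability side conditions arise, and the triangle inequality is
  replaced by the constant 3^p of \<open>powr_sum3_le\<close>.\<close>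

definition Lp_mass :: "real \<Rightarrow> ('a::euclidean_space \<Rightarrow> real) \<Rightarrow> ennreal" where
  "Lp_mass p F = (\<integral>\<^sup>+z. ennreal (\<bar>F z\<bar> powr p) \<partial>lborel)"

lemma Lp_mass_minus:
  assumes [measurable]: "F \<in> borel_measurable borel"
  shows "Lp_mass p (\<lambda>z. F (z - a)) = Lp_mass p F"
  unfolding Lp_mass_def by (rule nn_integral_lborel_minus) measurable

lemma Lp_mass_le_sum3:
  assumes [measurable]: "F \<in> borel_measurable borel" "G \<in> borel_measurable borel" "H \<in> borel_measurable borel"
    and "p > 0" and le: "\<And>z. \<bar>K z\<bar> \<le> \<bar>F z\<bar> + \<bar>G z\<bar> + \<bar>H z\<bar>"
  shows "Lp_mass p K \<le> ennreal (3 powr p) * (Lp_mass p F + Lp_mass p G + Lp_mass p H)"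
proof -
  have "\<bar>K z\<bar> powr p \<le> 3 powr p * (\<bar>F z\<bar> powr p + \<bar>G z\<bar> powr p + \<bar>H z\<bar> powr p)" for z
    using powr_mono2[OF _ _ le[of z], of p] powr_sum3_le[of "\<bar>F z\<bar>" "\<bar>G z\<bar>" "\<bar>H z\<bar>" p] \<open>p > 0\<close> by simp
  then have "Lp_mass p K \<le> (\<integral>\<^sup>+z. ennreal (3 powr p) * (ennreal (\<bar>F z\<bar> powr p) + ennreal (\<bar>G z\<bar> powr p) + ennreal (\<bar>H z\<bar> powr p)) \<partial>lborel)"
    unfolding Lp_mass_def
    by (intro nn_integral_mono) (simp add: ennreal_mult[symmetric] ennreal_plus[symmetric] del: ennreal_plus)
  also have "\<dots> = ennreal (3 powr p) * (Lp_mass p F + Lp_mass p G + Lp_mass p H)"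
    unfolding Lp_mass_def by (simp add: nn_integral_cmult nn_integral_add)
  finally show ?thesis .
qed

lemma Lp_mass_tendsto_0:
  fixes F :: "nat \<Rightarrow> 'a::euclidean_space \<Rightarrow> real"
  assumes [measurable]: "\<And>n. F n \<in> borel_measurable borel" "w \<in> borel_measurable borel"
    and "p > 0" "(\<integral>\<^sup>+z. ennreal (w z) \<partial>lborel) < \<infinity>"
    and "\<And>n z. \<bar>F n z\<bar> powr p \<le> w z"
    and lim: "AE z in lborel. (\<lambda>n. F n z) \<longlonglongrightarrow> 0"
  shows "(\<lambda>n. Lp_mass p (F n)) \<longlonglongrightarrow> 0"
proof -
  have "(\<lambda>n. \<integral>\<^sup>+z. ennreal (\<bar>F n z\<bar> powr p) \<partial>lborel) \<longlonglongrightarrow> (\<integral>\<^sup>+(z::'a). 0 \<partial>lborel)"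
  proof (rule nn_integral_dominated_convergence[where w = "\<lambda>z. ennreal (w z)"])
    show "AE z in lborel. (\<lambda>n. ennreal (\<bar>F n z\<bar> powr p)) \<longlonglongrightarrow> 0"
      using lim
    proof eventually_elim
      case (elim z)
      have "(\<lambda>n. \<bar>F n z\<bar> powr p) \<longlonglongrightarrow> 0 powr p"
        using tendsto_rabs[OF elim] \<open>p > 0\<close> by (intro tendsto_powr') auto
      then show ?case using tendsto_ennrealI by fastforce
    qed
  qed (use assms in \<open>auto intro: ennreal_leI\<close>)
  then show ?thesis by (simp add: Lp_mass_def)
qed

lemma Lp_approx_continuous:
  fixes F :: "'a::euclidean_space \<Rightarrow> real"
  assumes [measurable]: "F \<in> borel_measurable borel" and p: "p > 0" and fin: "Lp_mass p F < \<infinity>" and e: "e > (0::real)"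
  obtains g R where "continuous_on UNIV g" "\<And>z. norm z > R \<Longrightarrow> g z = 0" "Lp_mass p (\<lambda>z. F z - g z) < ennreal e"
proof -
  define c where "c = 3 powr p"
  have c: "c > 0" by (simp add: c_def)
  define e' where "e' = e / (3 * c)"
  have e': "e' > 0" using e c by (simp add: e'_def)
  \<comment> \<open>Truncation in value and in space: \<open>T n\<close> is bounded, has bounded
    support and is dominated by \<open>F\<close>.\<close>
  define T where "T = (\<lambda>n z. if \<bar>F z\<bar> \<le> real n \<and> norm z \<le> real n then F z else 0)"
  have [measurable]: "T n \<in> borel_measurable borel" for n unfolding T_def by measurable
  have "(\<lambda>n. Lp_mass p (\<lambda>z. F z - T n z)) \<longlonglongrightarrow> 0"
  proof (rule Lp_mass_tendsto_0[where w = "\<lambda>z. \<bar>F z\<bar> powr p"])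
    show "(\<integral>\<^sup>+z. ennreal (\<bar>F z\<bar> powr p) \<partial>lborel) < \<infinity>" using fin by (simp add: Lp_mass_def)
    show "\<bar>F z - T n z\<bar> powr p \<le> \<bar>F z\<bar> powr p" for n z by (auto simp: T_def)
    show "AE z in lborel. (\<lambda>n. F z - T n z) \<longlonglongrightarrow> 0"
    proof (rule AE_I2)
      fix z
      obtain N :: nat where N: "max \<bar>F z\<bar> (norm z) \<le> N" using real_arch_simple by blast
      have "eventually (\<lambda>n. F z - T n z = 0) sequentially"
        using eventually_ge_at_top[of N] by eventually_elim (use N in \<open>auto simp: T_def\<close>)
      then show "(\<lambda>n. F z - T n z) \<longlonglongrightarrow> 0" by (rule tendsto_eventually)
    qed
  qed (use p in auto)
  then have "eventually (\<lambda>n. Lp_mass p (\<lambda>z. F z - T n z) < ennreal e') sequentially"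
    using e' by (simp add: order_tendsto_iff)
  then obtain n where n: "Lp_mass p (\<lambda>z. F z - T n z) < ennreal e'"
    using eventually_happens'[OF sequentially_bot] by blast
  have "T n measurable_on UNIV"
    by (rule lebesgue_measurable_imp_measurable_on) (auto intro: measurable_completion)
  then obtain N g where N: "negligible N" and g: "\<And>m. continuous_on UNIV (g m)"
    and lim: "\<And>z. z \<notin> N \<Longrightarrow> (\<lambda>m. g m z) \<longlonglongrightarrow> T n z"
    unfolding measurable_on_def by auto
  \<comment> \<open>Clipping to [-n, n] and cutting off between the radii n and n + 1 leaves the
    limit \<open>T n\<close> unchanged, and it gives the continuous approximants a common integrable
    bound.\<close>
  define h where "h = (\<lambda>m z. max 0 (min 1 (real n + 1 - norm z)) * max (- real n) (min (real n) (g m z)))"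
  have conth: "continuous_on UNIV (h m)" for m
    unfolding h_def by (intro continuous_intros g)
  have [measurable]: "h m \<in> borel_measurable borel" for m
    by (rule borel_measurable_continuous_onI[OF conth])
  have Tn: "\<bar>T n z\<bar> \<le> n" "norm z > n \<Longrightarrow> T n z = 0" for z by (auto simp: T_def)
  have hn: "\<bar>h m z\<bar> \<le> n" "norm z > real n + 1 \<Longrightarrow> h m z = 0" for m z
  proof -
    have "\<bar>max (- real n) (min (real n) (g m z))\<bar> \<le> n" by auto
    moreover have "0 \<le> max 0 (min 1 (real n + 1 - norm z))" "max 0 (min 1 (real n + 1 - norm z)) \<le> 1" by auto
    ultimately show "\<bar>h m z\<bar> \<le> n" unfolding h_def abs_mult
      by (metis abs_ge_zero abs_of_nonneg mult_left_le_one_le order_trans)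
  qed (auto simp: h_def)
  have "(\<lambda>m. Lp_mass p (\<lambda>z. T n z - h m z)) \<longlonglongrightarrow> 0"
  proof (rule Lp_mass_tendsto_0[where w = "\<lambda>z. (2 * n) powr p * indicator (cball 0 (real n + 1)) z"])
    show "(\<integral>\<^sup>+(z::'a). ennreal ((2 * n) powr p * indicator (cball 0 (real n + 1)) z) \<partial>lborel) < \<infinity>"
      by (simp add: ennreal_mult' ennreal_indicator nn_integral_cmult_indicator ennreal_mult_less_top
          emeasure_bounded_finite[OF bounded_cball, unfolded infinity_ennreal_def])
    show "\<bar>T n z - h m z\<bar> powr p \<le> (2 * n) powr p * indicator (cball 0 (real n + 1)) z" for m z
    proof (cases "norm z \<le> real n + 1")
      case True
      have "\<bar>T n z - h m z\<bar> \<le> 2 * n" using Tn(1)[of z] hn(1)[of m z] by linarith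
      then show ?thesis using True p by (auto intro: powr_mono2)
    qed (use Tn(2)[of z] hn(2)[of z m] in auto)
    show "AE z in lborel. (\<lambda>m. T n z - h m z) \<longlonglongrightarrow> 0"
    proof -
      have "AE z in lebesgue. z \<notin> N" using N by (simp add: negligible_iff_null_sets AE_not_in)
      then have "AE z in lborel. z \<notin> N" by (simp add: AE_completion_iff)
      then show ?thesis
      proof eventually_elim
        case (elim z)
        have "(\<lambda>m. h m z) \<longlonglongrightarrow> max 0 (min 1 (real n + 1 - norm z)) * max (- real n) (min (real n) (T n z))"
          unfolding h_def by (intro tendsto_intros lim elim)
        also have "max 0 (min 1 (real n + 1 - norm z)) * max (- real n) (min (real n) (T n z)) = T n z"
          using Tn[of z] by (cases "norm z \<le> n") auto
        finally show ?case using tendsto_diff[OF tendsto_const[of "T n z"]] by fastforce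
      qed
    qed
    show "(\<lambda>z. T n z - h m z) \<in> borel_measurable borel" for m by measurable
    show "(\<lambda>z::'a. (2 * n) powr p * indicator (cball 0 (real n + 1)) z) \<in> borel_measurable borel"
      by (intro borel_measurable_times borel_measurable_const borel_measurable_indicator borel_closed closed_cball)
  qed (rule p)
  then have "eventually (\<lambda>m. Lp_mass p (\<lambda>z. T n z - h m z) < ennreal e') sequentially"
    using e' by (simp add: order_tendsto_iff)
  then obtain m where m: "Lp_mass p (\<lambda>z. T n z - h m z) < ennreal e'"
    using eventually_happens'[OF sequentially_bot] by blast
  have "Lp_mass p (\<lambda>z. F z - h m z) \<le> ennreal c * (Lp_mass p (\<lambda>z. F z - T n z)
      + Lp_mass p (\<lambda>z. T n z - h m z) + Lp_mass p (\<lambda>z::'a. 0))"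
    unfolding c_def by (rule Lp_mass_le_sum3) (use p in auto)
  also have "\<dots> \<le> ennreal c * (ennreal e' + ennreal e' + 0)"
    using n m by (intro mult_left_mono add_mono) (auto simp: Lp_mass_def)
  also have "\<dots> = ennreal (2 * c * e')"
    using c e' by (simp add: ennreal_plus[symmetric] ennreal_mult[symmetric] del: ennreal_plus)
  also have "\<dots> < ennreal e" using c e by (auto simp: e'_def intro!: ennreal_lessI)
  finally have "Lp_mass p (\<lambda>z. F z - h m z) < ennreal e" .
  then show ?thesis using that[of "h m" "real n + 1"] conth hn(2) by blast
qed

text \<open>Clear for a continuous function of bounded support, by uniform continuity. A general
  \<open>F\<close> inherits it by approximation, since the approximation error is invariant under
  translation.\<close>

lemma Lp_translation_continuous:
  fixes F :: "'a::euclidean_space \<Rightarrow> real"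
  assumes [measurable]: "F \<in> borel_measurable borel" and p: "p > 0" and fin: "Lp_mass p F < \<infinity>" and e: "e > (0::real)"
  obtains d where "d > 0" "\<And>a. norm a < d \<Longrightarrow> Lp_mass p (\<lambda>z. F (z - a) - F z) \<le> ennreal e"
proof -
  define c where "c = 3 powr p"
  have c: "c > 0" by (simp add: c_def)
  define e' where "e' = e / (3 * c)"
  have e': "e' > 0" using e c by (simp add: e'_def)
  obtain g R where contg: "continuous_on UNIV g" and supp: "\<And>z. norm z > R \<Longrightarrow> g z = 0"
    and g: "Lp_mass p (\<lambda>z. F z - g z) < ennreal e'"
    using Lp_approx_continuous[OF assms(1) p fin e'] by blast
  have [measurable]: "g \<in> borel_measurable borel" by (rule borel_measurable_continuous_onI[OF contg])
  define V where "V = measure lborel (cball (0::'a) (R + 1))"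
  have V: "emeasure lborel (cball (0::'a) (R + 1)) = ennreal V"
    unfolding V_def
    by (rule emeasure_eq_ennreal_measure) (metis emeasure_bounded_finite bounded_cball less_irrefl infinity_ennreal_def)
  have "V \<ge> 0" by (simp add: V_def)
  \<comment> \<open>Chosen so that s^p (V + 1) = e': an oscillation of at most s on a ball of volume
    V then costs at most e'.\<close>
  define s where "s = (e' / (V + 1)) powr (1 / p)"
  have s: "s > 0" using e' \<open>V \<ge> 0\<close> by (simp add: s_def)
  have "s powr p = e' / (V + 1)" using e' \<open>V \<ge> 0\<close> p by (simp add: s_def powr_powr)
  then have "s powr p * V + s powr p = e'" using \<open>V \<ge> 0\<close> by (simp add: field_simps)
  then have sV: "s powr p * V \<le> e'" using powr_ge_zero[of s p] by linarith
  have "uniformly_continuous_on (cball 0 (R + 2)) g"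
    using contg by (auto intro!: compact_uniformly_continuous continuous_on_subset[of UNIV])
  then obtain d where d: "d > 0" "\<And>x y. x \<in> cball 0 (R + 2) \<Longrightarrow> y \<in> cball 0 (R + 2) \<Longrightarrow> dist y x < d \<Longrightarrow> dist (g y) (g x) < s"
    using s unfolding uniformly_continuous_on_def by metis
  show ?thesis
  proof (rule that[of "min d 1"])
    show "min d 1 > 0" using d by simp
    fix a :: 'a assume a: "norm a < min d 1"
    have gb: "\<bar>g (z - a) - g z\<bar> powr p \<le> s powr p * indicator (cball 0 (R + 1)) z" for z
    proof (cases "norm z \<le> R + 1")
      case True
      have "z - a \<in> cball 0 (R + 2)" using True a norm_triangle_ineq4[of z a] by simp
      then have "dist (g (z - a)) (g z) < s" using d(2)[of z "z - a"] a True by (simp add: dist_norm[of "z - a" z])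
      then show ?thesis using True p by (auto simp: dist_real_def intro!: powr_mono2)
    next
      case False
      have "norm (z - a) > R" using False a norm_triangle_ineq2[of z a] by simp
      then show ?thesis using False by (simp add: supp)
    qed
    have "Lp_mass p (\<lambda>z. g (z - a) - g z) \<le> (\<integral>\<^sup>+(z::'a). ennreal (s powr p * indicator (cball 0 (R + 1)) z) \<partial>lborel)"
      unfolding Lp_mass_def by (intro nn_integral_mono ennreal_leI gb)
    also have "\<dots> = ennreal (s powr p) * ennreal V"
      by (simp add: ennreal_mult' ennreal_indicator nn_integral_cmult_indicator V)
    also have "\<dots> \<le> ennreal e'" using sV \<open>V \<ge> 0\<close> by (simp add: ennreal_mult[symmetric] ennreal_leI)
    finally have ga: "Lp_mass p (\<lambda>z. g (z - a) - g z) \<le> ennreal e'" .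
    have "Lp_mass p (\<lambda>z. F (z - a) - F z) \<le> ennreal c * (Lp_mass p (\<lambda>z. F (z - a) - g (z - a))
        + Lp_mass p (\<lambda>z. g (z - a) - g z) + Lp_mass p (\<lambda>z. F z - g z))"
      unfolding c_def by (rule Lp_mass_le_sum3) (use p in auto)
    also have "Lp_mass p (\<lambda>z. F (z - a) - g (z - a)) = Lp_mass p (\<lambda>z. F z - g z)"
      by (rule Lp_mass_minus[of "\<lambda>z. F z - g z"]) measurable
    also have "ennreal c * (Lp_mass p (\<lambda>z. F z - g z) + Lp_mass p (\<lambda>z. g (z - a) - g z) + Lp_mass p (\<lambda>z. F z - g z))
        \<le> ennreal c * (ennreal e' + ennreal e' + ennreal e')"
      using g ga by (intro mult_left_mono add_mono) auto
    also have "\<dots> = ennreal e"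
      using c e' by (simp add: ennreal_plus[symmetric] ennreal_mult[symmetric] e'_def del: ennreal_plus) 
    finally show "Lp_mass p (\<lambda>z. F (z - a) - F z) \<le> ennreal e" .
  qed
qed


text \<open>The product of the mollifications is a double average of A(z - s) B(z - t) over small
  shifts s and t. Its distance from A(z) B(z) is split into one translation difference for each
  factor, bounded by Young's inequality and the continuity of translations. The radius is found
  before \<open>k\<close>, so it serves every mollifier of that radius, and several pairs of
  functions can share one kernel.\<close>

lemma mollifier_L1_convergence:
  fixes A B :: "'a::euclidean_space \<Rightarrow> real"
  assumes pq: "p > 1" "q > 1" "1 / p + 1 / q = 1"
    and A: "integrable lborel A" "Lp_mass q A < \<infinity>" and B: "integrable lborel B" "Lp_mass p B < \<infinity>"
    and "e > (0::real)"
  obtains r where "r > 0" "\<And>k. mollifier r k \<Longrightarrow>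
    (\<integral>\<^sup>+z. ennreal \<bar>conv k A z * conv k B z - A z * B z\<bar> \<partial>lborel) \<le> ennreal e"
proof -
  have [measurable]: "A \<in> borel_measurable borel" "B \<in> borel_measurable borel"
    using A(1) B(1) by auto
  obtain a where a: "Lp_mass q A = ennreal a" "a \<ge> 0" using A(2) by (cases "Lp_mass q A") auto
  obtain b where b: "Lp_mass p B = ennreal b" "b \<ge> 0" using B(2) by (cases "Lp_mass p B") auto
  \<comment> \<open>This weight keeps the two terms without a translation difference below e / 4
    each; the constants \<Lambda> and \<Lambda>' that it forces are absorbed by the choice of r1 and
    r2.\<close>
  define \<mu> where "\<mu> = e / (4 * (a + b + 1))"
  have \<mu>: "\<mu> > 0" using \<open>e > 0\<close> a b by (simp add: \<mu>_def)
  have \<mu>ab: "\<mu> * b \<le> e / 4" "\<mu> * a \<le> e / 4"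
    using \<open>e > 0\<close> a b by (auto simp: \<mu>_def field_simps)
  obtain \<Lambda> where \<Lambda>: "\<Lambda> > 0" "\<And>x y. 0 \<le> x \<Longrightarrow> 0 \<le> y \<Longrightarrow> x * y \<le> \<Lambda> * x powr q + \<mu> * y powr p"
    using Youngs_inequality_scaled[OF pq \<mu>] by metis
  obtain \<Lambda>' where \<Lambda>': "\<Lambda>' > 0" "\<And>x y. 0 \<le> x \<Longrightarrow> 0 \<le> y \<Longrightarrow> x * y \<le> \<Lambda>' * x powr p + \<mu> * y powr q"
    using Youngs_inequality_scaled[of q p, OF pq(2,1) _ \<mu>] pq(3) by (metis add.commute)
  obtain r1 where r1: "r1 > 0" "\<And>a. norm a < r1 \<Longrightarrow> Lp_mass q (\<lambda>z. A (z - a) - A z) \<le> ennreal (e / (4 * \<Lambda>))"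
    using Lp_translation_continuous[of A q "e / (4 * \<Lambda>)"] A(2) pq \<open>e > 0\<close> \<Lambda>(1) by auto
  obtain r2 where r2: "r2 > 0" "\<And>a. norm a < r2 \<Longrightarrow> Lp_mass p (\<lambda>z. B (z - a) - B z) \<le> ennreal (e / (4 * \<Lambda>'))"
    using Lp_translation_continuous[of B p "e / (4 * \<Lambda>')"] B(2) pq \<open>e > 0\<close> \<Lambda>'(1) by auto
  let ?G = "\<lambda>s t z. \<bar>A (z - s) * B (z - t) - A z * B z\<bar>"
  have G: "(\<integral>\<^sup>+z. ennreal (?G s t z) \<partial>lborel) \<le> ennreal e" if "norm s < min r1 r2" "norm t < min r1 r2" for s t
  proof -
    have "?G s t z \<le> \<Lambda> * \<bar>A (z - s) - A z\<bar> powr q + \<mu> * \<bar>B (z - t)\<bar> powr p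
        + \<Lambda>' * \<bar>B (z - t) - B z\<bar> powr p + \<mu> * \<bar>A z\<bar> powr q" for z
    proof -
      have "A (z - s) * B (z - t) - A z * B z = (A (z - s) - A z) * B (z - t) + (B (z - t) - B z) * A z"
        by (simp add: algebra_simps)
      then have "?G s t z \<le> \<bar>A (z - s) - A z\<bar> * \<bar>B (z - t)\<bar> + \<bar>B (z - t) - B z\<bar> * \<bar>A z\<bar>"
        by (metis abs_mult abs_triangle_ineq)
      then show ?thesis
        using \<Lambda>(2)[of "\<bar>A (z - s) - A z\<bar>" "\<bar>B (z - t)\<bar>"] \<Lambda>'(2)[of "\<bar>B (z - t) - B z\<bar>" "\<bar>A z\<bar>"] by simp
    qed
    then have "(\<integral>\<^sup>+z. ennreal (?G s t z) \<partial>lborel) \<le> (\<integral>\<^sup>+z. ennreal \<Lambda> * ennreal (\<bar>A (z - s) - A z\<bar> powr q)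
        + ennreal \<mu> * ennreal (\<bar>B (z - t)\<bar> powr p) + ennreal \<Lambda>' * ennreal (\<bar>B (z - t) - B z\<bar> powr p)
        + ennreal \<mu> * ennreal (\<bar>A z\<bar> powr q) \<partial>lborel)"
      using \<Lambda>(1) \<Lambda>'(1) \<mu>
      by (intro nn_integral_mono) (simp add: ennreal_mult[symmetric] ennreal_plus[symmetric] del: ennreal_plus)
    also have "\<dots> = ennreal \<Lambda> * Lp_mass q (\<lambda>z. A (z - s) - A z) + ennreal \<mu> * Lp_mass p (\<lambda>z. B (z - t))
        + ennreal \<Lambda>' * Lp_mass p (\<lambda>z. B (z - t) - B z) + ennreal \<mu> * Lp_mass q A"
      unfolding Lp_mass_def by (simp add: nn_integral_cmult nn_integral_add)
    also have "\<dots> \<le> ennreal \<Lambda> * ennreal (e / (4 * \<Lambda>)) + ennreal \<mu> * ennreal b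
        + ennreal \<Lambda>' * ennreal (e / (4 * \<Lambda>')) + ennreal \<mu> * ennreal a"
      using r1(2)[of s] r2(2)[of t] that a b by (intro add_mono mult_left_mono) (auto simp: Lp_mass_minus)
    also have "\<dots> = ennreal (e / 4 + \<mu> * b + e / 4 + \<mu> * a)"
      using \<open>e > 0\<close> \<Lambda>(1) \<Lambda>'(1) \<mu> a b
      by (simp add: ennreal_mult[symmetric] ennreal_plus[symmetric] del: ennreal_plus)
    also have "\<dots> \<le> ennreal e" using \<mu>ab by (intro ennreal_leI) linarith
    finally show ?thesis .
  qed
  show ?thesis
  proof (rule that[of "min r1 r2"])
    show "min r1 r2 > 0" using r1 r2 by simp
    fix k :: "'a \<Rightarrow> real" assume k: "mollifier (min r1 r2) k"
    have [measurable]: "k \<in> borel_measurable borel" using test_function_measurable[OF mollifierD(1)[OF k]] .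
    have shift: "conv k f z = (LBINT s. k s * f (z - s))" "integrable lborel (\<lambda>s. k s * f (z - s))"
      if "integrable lborel f" for f :: "'a \<Rightarrow> real" and z
      using integrable_lborel_reflect[OF integrable_conv_kernel[OF mollifierD(1)[OF k] that, of z], of z]
      by (simp_all add: conv_def)
    have k1: "(\<integral>\<^sup>+s. ennreal (k s) \<partial>lborel) = 1"
      using nn_integral_eq_integral[OF mollifierD(5)[OF k]] mollifierD(2,6)[OF k] by simp
    \<comment> \<open>Since \<open>k\<close> has mass 1, the product A(z) B(z) can be put under the
      average; the averages over the two shifts are treated one at a time.\<close>
    have inner: "ennreal \<bar>A (z - s) * conv k B z - A z * B z\<bar> \<le> (\<integral>\<^sup>+t. ennreal (k t) * ennreal (?G s t z) \<partial>lborel)" for s z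
    proof -
      have "A (z - s) * conv k B z - A z * B z = (LBINT t. A (z - s) * (k t * B (z - t)) - A z * B z * k t)"
        using shift[OF B(1), of z] mollifierD(5,6)[OF k] by simp
      also have "ennreal \<bar>\<dots>\<bar> \<le> (\<integral>\<^sup>+t. ennreal (norm (A (z - s) * (k t * B (z - t)) - A z * B z * k t)) \<partial>lborel)"
        using shift[OF B(1), of z] mollifierD(5)[OF k]
        by (subst real_norm_def[symmetric], intro integral_norm_bound_ennreal) auto
      also have "\<dots> = (\<integral>\<^sup>+t. ennreal (k t) * ennreal (?G s t z) \<partial>lborel)"
      proof (rule nn_integral_cong)
        fix t
        have "norm (A (z - s) * (k t * B (z - t)) - A z * B z * k t) = \<bar>k t * (A (z - s) * B (z - t) - A z * B z)\<bar>"
          by (simp add: algebra_simps)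
        then show "ennreal (norm (A (z - s) * (k t * B (z - t)) - A z * B z * k t)) = ennreal (k t) * ennreal (?G s t z)"
          using mollifierD(2)[OF k] by (simp add: abs_mult ennreal_mult)
      qed
      finally show ?thesis .
    qed
    have outer: "ennreal \<bar>conv k A z * conv k B z - A z * B z\<bar>
        \<le> (\<integral>\<^sup>+s. ennreal (k s) * (\<integral>\<^sup>+t. ennreal (k t) * ennreal (?G s t z) \<partial>lborel) \<partial>lborel)" for z
    proof -
      have "conv k A z * conv k B z - A z * B z
          = (LBINT s. (k s * A (z - s)) * conv k B z - A z * B z * k s)"
        using shift[OF A(1), of z] mollifierD(5,6)[OF k] by simp
      also have "ennreal \<bar>\<dots>\<bar> \<le> (\<integral>\<^sup>+s. ennreal (norm ((k s * A (z - s)) * conv k B z - A z * B z * k s)) \<partial>lborel)"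
        using shift[OF A(1), of z] mollifierD(5)[OF k]
        by (subst real_norm_def[symmetric], intro integral_norm_bound_ennreal) auto
      also have "\<dots> \<le> (\<integral>\<^sup>+s. ennreal (k s) * (\<integral>\<^sup>+t. ennreal (k t) * ennreal (?G s t z) \<partial>lborel) \<partial>lborel)"
      proof (rule nn_integral_mono)
        fix s
        have "norm ((k s * A (z - s)) * conv k B z - A z * B z * k s) = \<bar>k s * (A (z - s) * conv k B z - A z * B z)\<bar>"
          by (simp add: algebra_simps)
        then have "ennreal (norm ((k s * A (z - s)) * conv k B z - A z * B z * k s))
            = ennreal (k s) * ennreal \<bar>A (z - s) * conv k B z - A z * B z\<bar>"
          using mollifierD(2)[OF k] by (simp add: abs_mult ennreal_mult)
        then show "ennreal (norm ((k s * A (z - s)) * conv k B z - A z * B z * k s))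
            \<le> ennreal (k s) * (\<integral>\<^sup>+t. ennreal (k t) * ennreal (?G s t z) \<partial>lborel)"
          using inner by (simp add: mult_left_mono)
      qed
      finally show ?thesis .
    qed
    \<comment> \<open>Shifts beyond the radius have weight 0. For the others, Tonelli's theorem
      moves the integral over z inside both averages, where the bound \<open>G\<close> for fixed
      shifts applies.\<close>
    have zero: "k s = 0" if "\<not> norm s < min r1 r2" for s using mollifierD(3)[OF k, of s] that by simp
    have "(\<integral>\<^sup>+z. ennreal \<bar>conv k A z * conv k B z - A z * B z\<bar> \<partial>lborel)
        \<le> (\<integral>\<^sup>+z. \<integral>\<^sup>+s. ennreal (k s) * (\<integral>\<^sup>+t. ennreal (k t) * ennreal (?G s t z) \<partial>lborel) \<partial>lborel \<partial>lborel)"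
      by (intro nn_integral_mono outer)
    also have "\<dots> = (\<integral>\<^sup>+s. \<integral>\<^sup>+z. ennreal (k s) * (\<integral>\<^sup>+t. ennreal (k t) * ennreal (?G s t z) \<partial>lborel) \<partial>lborel \<partial>lborel)"
      by (rule lborel_pair.Fubini') measurable
    also have "\<dots> = (\<integral>\<^sup>+s. ennreal (k s) * (\<integral>\<^sup>+z. \<integral>\<^sup>+t. ennreal (k t) * ennreal (?G s t z) \<partial>lborel \<partial>lborel) \<partial>lborel)"
      by (intro nn_integral_cong nn_integral_cmult) measurable
    also have "\<dots> = (\<integral>\<^sup>+s. ennreal (k s) * (\<integral>\<^sup>+t. \<integral>\<^sup>+z. ennreal (k t) * ennreal (?G s t z) \<partial>lborel \<partial>lborel) \<partial>lborel)"
      by (intro nn_integral_cong arg_cong2[where f = "(*)"] refl lborel_pair.Fubini') measurable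
    also have "\<dots> = (\<integral>\<^sup>+s. ennreal (k s) * (\<integral>\<^sup>+t. ennreal (k t) * (\<integral>\<^sup>+z. ennreal (?G s t z) \<partial>lborel) \<partial>lborel) \<partial>lborel)"
      by (intro nn_integral_cong arg_cong2[where f = "(*)"] refl nn_integral_cmult) measurable
    also have "\<dots> \<le> (\<integral>\<^sup>+s. ennreal (k s) * (\<integral>\<^sup>+t. ennreal (k t) * ennreal e \<partial>lborel) \<partial>lborel)"
    proof (rule nn_integral_mono)
      fix s
      show "ennreal (k s) * (\<integral>\<^sup>+t. ennreal (k t) * (\<integral>\<^sup>+z. ennreal (?G s t z) \<partial>lborel) \<partial>lborel)
          \<le> ennreal (k s) * (\<integral>\<^sup>+t. ennreal (k t) * ennreal e \<partial>lborel)"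
      proof (cases "norm s < min r1 r2")
        case True
        have "ennreal (k t) * (\<integral>\<^sup>+z. ennreal (?G s t z) \<partial>lborel) \<le> ennreal (k t) * ennreal e" for t
          using G[OF True, of t] zero[of t] by (cases "norm t < min r1 r2") (auto intro: mult_left_mono)
        then show ?thesis by (rule mult_left_mono[OF nn_integral_mono]) simp
      qed (simp add: zero)
    qed
    also have "\<dots> = ennreal e" by (simp add: nn_integral_multc k1)
    finally show "(\<integral>\<^sup>+z. ennreal \<bar>conv k A z * conv k B z - A z * B z\<bar> \<partial>lborel) \<le> ennreal e" .
  qed
qed

subsection \<open>Weak solutions on a cylinder\<close>

definition p_flux :: "real \<Rightarrow> 'a::real_normed_vector \<Rightarrow> 'a" where
  "p_flux p G = norm G powr (p - 2) *\<^sub>R G"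

lemma norm_p_flux: "norm (p_flux p G) = norm G powr (p - 1)"
proof (cases "G = 0")
  case False
  then have "norm G powr (p - 2) * norm G powr 1 = norm G powr (p - 1)"
    by (simp only: powr_add[symmetric]) simp
  then show ?thesis using False by (simp add: p_flux_def)
qed (simp add: p_flux_def)

text \<open>By the Cauchy-Schwarz inequality the pairing is at least (|a|^(p-1) - |b|^(p-1)) (|a| -
  |b|), which is nonnegative since r^(p-1) is increasing.\<close>

lemma p_flux_monotone:
  fixes a b :: "'a::real_inner"
  assumes "p > 1"
  shows "0 \<le> (p_flux p a - p_flux p b) \<bullet> (a - b)"
proof -
  define s t where "s = norm a powr (p - 2)" and "t = norm b powr (p - 2)"
  have st: "s \<ge> 0" "t \<ge> 0" by (simp_all add: s_def t_def)
  have s1: "s * norm a = norm a powr (p - 1)" and t1: "t * norm b = norm b powr (p - 1)"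
    using norm_p_flux[of p a] norm_p_flux[of p b] by (simp_all add: p_flux_def s_def t_def)
  have "0 \<le> (norm a powr (p - 1) - norm b powr (p - 1)) * (norm a - norm b)"
  proof (cases "norm a \<le> norm b")
    case True
    then show ?thesis using assms powr_mono2[of "p - 1" "norm a" "norm b"] by (intro mult_nonpos_nonpos) auto
  next
    case False
    then show ?thesis using assms powr_mono2[of "p - 1" "norm b" "norm a"] by (intro mult_nonneg_nonneg) auto
  qed
  also have "\<dots> = s * (norm a)\<^sup>2 + t * (norm b)\<^sup>2 - (s + t) * (norm a * norm b)"
    unfolding s1[symmetric] t1[symmetric] by (simp add: algebra_simps power2_eq_square)
  also have "\<dots> \<le> s * (norm a)\<^sup>2 + t * (norm b)\<^sup>2 - (s + t) * (a \<bullet> b)"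
    using st norm_cauchy_schwarz[of a b] by (intro diff_left_mono mult_left_mono) auto
  also have "\<dots> = (p_flux p a - p_flux p b) \<bullet> (a - b)"
    by (simp add: p_flux_def s_def t_def inner_diff_left inner_diff_right power2_norm_eq_inner inner_commute algebra_simps)
  finally show ?thesis .
qed

section \<open>Time slices of test functions and the equation as an identity of space-time
  integrals\<close>

lemma test_function_slice:
  fixes \<phi> :: "'a::euclidean_space \<times> real \<Rightarrow> real"
  assumes \<phi>: "test_function (U \<times> I) \<phi>"
  shows "test_function U (\<lambda>x. \<phi> (x, t))"
proof -
  let ?K = "closure {z. \<phi> z \<noteq> 0}"
  have "bounded_linear (\<lambda>x::'a. (x, 0::real))"
    by (intro bounded_linear_Pair bounded_linear_ident bounded_linear_zero)
  from Ck_compose_affine[OF this test_functionD(1)[OF \<phi>], of _ "(0, t)"]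
  have ck: "Ck k (\<lambda>x. \<phi> (x, t))" for k by simp
  have "compact (fst ` ?K)" 
    using test_functionD(2)[OF \<phi>] by (intro compact_continuous_image continuous_intros)
  moreover have "{x. \<phi> (x, t) \<noteq> 0} \<subseteq> fst ` ?K"
    using closure_subset[of "{z. \<phi> z \<noteq> 0}"] by force
  ultimately have "closure {x. \<phi> (x, t) \<noteq> 0} \<subseteq> fst ` ?K" "compact (closure {x. \<phi> (x, t) \<noteq> 0})"
    using closure_minimal compact_imp_closed bounded_subset compact_imp_bounded compact_closure by metis+
  moreover have "fst ` ?K \<subseteq> U" using test_functionD(3)[OF \<phi>] by auto
  ultimately show ?thesis using ck unfolding test_function_def compactly_contained_def by blast
qed

lemma grad_slice:
  fixes \<phi> :: "(real^'n) \<times> real \<Rightarrow> real"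
  assumes \<phi>: "test_function W \<phi>"
  shows "grad (\<lambda>y. \<phi> (y, t)) x $ i = frechet_derivative \<phi> (at (x, t)) (axis i 1, 0)"
proof -
  have "((\<lambda>y. \<phi> (y, t)) has_derivative (\<lambda>v. frechet_derivative \<phi> (at (x, t)) (v, 0))) (at x)"
    by (rule has_derivative_compose[OF _ test_functionD(4)[OF \<phi>], of "\<lambda>y. (y, t)"])
       (auto intro!: derivative_eq_intros)
  from frechet_derivative_at[OF this] show ?thesis by (simp add: grad_def fun_eq_iff)
qed

lemma deriv_slice:
  fixes \<phi> :: "(real^'n) \<times> real \<Rightarrow> real"
  assumes \<phi>: "test_function W \<phi>"
  shows "((\<lambda>s. \<phi> (x, s)) has_real_derivative frechet_derivative \<phi> (at (x, t)) (0, 1)) (at t)"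
    "deriv (\<lambda>s. \<phi> (x, s)) t = frechet_derivative \<phi> (at (x, t)) (0, 1)"
proof -
  have "((\<lambda>s. \<phi> (x, s)) has_derivative (\<lambda>h. frechet_derivative \<phi> (at (x, t)) (0, h))) (at t)"
    by (rule has_derivative_compose[OF _ test_functionD(4)[OF \<phi>], of "\<lambda>s. (x, s)"])
       (auto intro!: derivative_eq_intros)
  moreover have "(\<lambda>h. frechet_derivative \<phi> (at (x, t)) (0, h)) = (*) (frechet_derivative \<phi> (at (x, t)) (0, 1))"
  proof
    fix h
    show "frechet_derivative \<phi> (at (x, t)) (0, h) = frechet_derivative \<phi> (at (x, t)) (0, 1) * h"
      using linear_cmul[OF has_derivative_linear[OF test_functionD(4)[OF \<phi>]], of "(x, t)" h "(0, 1)"]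
      by simp
  qed
  ultimately show d: "((\<lambda>s. \<phi> (x, s)) has_real_derivative frechet_derivative \<phi> (at (x, t)) (0, 1)) (at t)"
    by (simp add: has_field_derivative_def)
  then show "deriv (\<lambda>s. \<phi> (x, s)) t = frechet_derivative \<phi> (at (x, t)) (0, 1)" by (rule DERIV_imp_deriv)
qed

text \<open>On the support |f| \<le> 1 + |f|^p, and the constant 1 is integrable over a set of
  finite measure.\<close>

lemma integrable_Lp_finite_support:
  fixes f :: "'a::euclidean_space \<Rightarrow> real"
  assumes [measurable]: "f \<in> borel_measurable borel" "V \<in> sets borel"
    and "emeasure lborel V < \<infinity>" "\<And>z. z \<notin> V \<Longrightarrow> f z = 0" "p \<ge> 1" "Lp_mass p f < \<infinity>"
  shows "integrable lborel f"
proof (rule integrableI_bounded)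
  have "\<bar>f z\<bar> \<le> indicator V z + \<bar>f z\<bar> powr p" for z
  proof (cases "\<bar>f z\<bar> \<le> 1")
    case False
    then have "\<bar>f z\<bar> powr 1 \<le> \<bar>f z\<bar> powr p" using \<open>p \<ge> 1\<close> by (intro powr_mono) auto
    then show ?thesis using False by (simp add: indicator_def)
  qed (use assms(4)[of z] in \<open>cases "z \<in> V", auto intro: add_increasing2\<close>)
  then have "(\<integral>\<^sup>+z. ennreal (norm (f z)) \<partial>lborel) \<le> (\<integral>\<^sup>+z. indicator V z + ennreal (\<bar>f z\<bar> powr p) \<partial>lborel)"
    by (intro nn_integral_mono) (auto simp: ennreal_indicator[symmetric] ennreal_plus[symmetric] simp del: ennreal_plus)
  also have "\<dots> = emeasure lborel V + Lp_mass p f"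
    by (subst nn_integral_add) (auto simp: Lp_mass_def)
  finally show "(\<integral>\<^sup>+z. ennreal (norm (f z)) \<partial>lborel) < \<infinity>"
    using assms(3,6) by (simp add: le_less_trans)
qed simp

abbreviation space_dir :: "'n::finite \<Rightarrow> (real^'n) \<times> real" where
  "space_dir i \<equiv> (axis i 1, 0)"

lemma dir_Basis: "space_dir i \<in> Basis" "(0, 1) \<in> (Basis :: ((real^'n) \<times> real) set)"
  by (auto simp: Basis_prod_def axis_in_Basis_iff)

lemma integral_lborel_snd:
  fixes f :: "'a::euclidean_space \<times> real \<Rightarrow> real"
  assumes "integrable lborel f"
  shows "(LBINT z. f z) = (LBINT t. LBINT x. f (x, t))"
  using lborel_pair.integral_snd[of "\<lambda>x t. f (x, t)"] assms by (simp add: lborel_prod)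

lemma borel_measurable_component [measurable (raw)]:
  fixes f :: "'a \<Rightarrow> real^'n"
  shows "f \<in> borel_measurable M \<Longrightarrow> (\<lambda>z. f z $ i) \<in> borel_measurable M"
  unfolding cart_eq_inner_axis by (intro borel_measurable_inner borel_measurable_const)

lemma Lp_mass_component:
  fixes \<Gamma> :: "'a::euclidean_space \<Rightarrow> real^'n"
  assumes "p \<ge> 0"
  shows "Lp_mass p (\<lambda>z. \<Gamma> z $ i) \<le> (\<integral>\<^sup>+z. ennreal (norm (\<Gamma> z) powr p) \<partial>lborel)"
  unfolding Lp_mass_def using assms component_le_norm_cart
  by (intro nn_integral_mono ennreal_leI powr_mono2) auto

lemma Lp_mass_p_flux_component:
  fixes \<Gamma> :: "'a::euclidean_space \<Rightarrow> real^'n"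
  assumes "p > 1"
  shows "Lp_mass (p / (p - 1)) (\<lambda>z. p_flux p (\<Gamma> z) $ i) \<le> (\<integral>\<^sup>+z. ennreal (norm (\<Gamma> z) powr p) \<partial>lborel)"
proof -
  have "\<bar>p_flux p (\<Gamma> z) $ i\<bar> powr (p / (p - 1)) \<le> norm (\<Gamma> z) powr p" for z
    using assms powr_mono2[OF _ _ component_le_norm_cart[of "p_flux p (\<Gamma> z)" i], of "p / (p - 1)"]
    by (simp add: norm_p_flux powr_powr)
  then show ?thesis unfolding Lp_mass_def by (intro nn_integral_mono ennreal_leI)
qed

lemma borel_measurable_p_flux [measurable (raw)]:
  fixes \<Gamma> :: "'a \<Rightarrow> 'b::euclidean_space"
  shows "\<Gamma> \<in> borel_measurable M \<Longrightarrow> (\<lambda>z. p_flux p (\<Gamma> z)) \<in> borel_measurable M"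
  unfolding p_flux_def by measurable

lemma integrable_indicator_mult_continuous:
  fixes h :: "'a::euclidean_space \<Rightarrow> real"
  assumes "compact (closure V)" "V \<in> sets borel" "continuous_on (closure V) h"
  shows "integrable lborel (\<lambda>z. indicator V z * h z)"
proof -
  have "set_integrable lborel (closure V) h"
    unfolding set_integrable_def by (intro borel_integrable_compact assms)
  then have "set_integrable lborel V h"
    by (rule set_integrable_subset) (use assms closure_subset in auto)
  then show ?thesis by (simp add: set_integrable_def)
qed

text \<open>The form of the weak equation that the comparison argument uses. The gradient is a Borel
  function on all of space-time, extended by 0 off \<open>V\<close>, so that it can be convolved
  freely; both identities are integrals over space-time, tested with functions of x and t together,
  and they involve \<open>h\<close> itself instead of a representative.\<close>

definition cylinder_gradient ::
  "real \<Rightarrow> ((real^'n) \<times> real) set \<Rightarrow> ((real^'n) \<times> real \<Rightarrow> real) \<Rightarrow> ((real^'n) \<times> real \<Rightarrow> real^'n) \<Rightarrow> bool" where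
  "cylinder_gradient p V h \<Gamma> \<longleftrightarrow> \<Gamma> \<in> borel_measurable borel \<and> (\<forall>z. z \<notin> V \<longrightarrow> \<Gamma> z = 0) \<and>
    (\<integral>\<^sup>+z. ennreal (norm (\<Gamma> z) powr p) \<partial>lborel) < \<infinity> \<and>
    (\<forall>\<phi>. test_function V \<phi> \<longrightarrow>
      (\<forall>i. (LBINT z. indicator V z * h z * frechet_derivative \<phi> (at z) (space_dir i))
        = - (LBINT z. \<Gamma> z $ i * \<phi> z)) \<and>
      (\<Sum>i\<in>UNIV. LBINT z. p_flux p (\<Gamma> z) $ i * frechet_derivative \<phi> (at z) (space_dir i))
        = (LBINT z. indicator V z * h z * frechet_derivative \<phi> (at z) (0, 1)))"

lemma cylinder_gradientD:
  assumes "cylinder_gradient p V h \<Gamma>"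
  shows "\<Gamma> \<in> borel_measurable borel" "z \<notin> V \<Longrightarrow> \<Gamma> z = 0"
    "(\<integral>\<^sup>+z. ennreal (norm (\<Gamma> z) powr p) \<partial>lborel) < \<infinity>"
    "test_function V \<phi> \<Longrightarrow>
      (LBINT z. indicator V z * h z * frechet_derivative \<phi> (at z) (space_dir i)) = - (LBINT z. \<Gamma> z $ i * \<phi> z)"
    "test_function V \<phi> \<Longrightarrow>
      (\<Sum>i\<in>UNIV. LBINT z. p_flux p (\<Gamma> z) $ i * frechet_derivative \<phi> (at z) (space_dir i))
      = (LBINT z. indicator V z * h z * frechet_derivative \<phi> (at z) (0, 1))"
  using assms unfolding cylinder_gradient_def by blast+

text \<open>Fubini's theorem: the weak gradient, given on almost every time slice, is integrated
  over t, and the iterated integrals of the equation are joined into one. The representative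
  \<open>v\<close> equals \<open>h\<close> almost everywhere in space-time, so it can be exchanged
  for \<open>h\<close> once the integrals are over space-time.\<close>

lemma p_parabolic_cylinder:
  fixes h :: "(real^'n) \<times> real \<Rightarrow> real"
  assumes p: "p > 1" and h: "p_parabolic p W h"
    and U: "open U" "s1 < s2" "compactly_contained (U \<times> {s1<..<s2}) W"
  defines "V \<equiv> U \<times> {s1<..<s2}"
  shows "\<exists>\<Gamma>. cylinder_gradient p V h \<Gamma>"
proof -
  let ?I = "{s1<..<s2}"
  have ws: "weak_solution p W (\<lambda>z. ereal (h z))" using h by (simp add: p_parabolic_def)
  obtain v G where vh: "AE z in lborel. z \<in> V \<longrightarrow> ereal (h z) = ereal (v z)"
    and W: "in_Lp_W1p p s1 s2 U v G"
    and eq: "\<And>\<phi>. test_function V \<phi> \<Longrightarrow>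
             (LBINT t:?I. LBINT x:U.
                (norm (G (x, t)) powr (p - 2) *\<^sub>R G (x, t)) \<bullet> grad (\<lambda>y. \<phi> (y, t)) x)
             - (LBINT t:?I. LBINT x:U. v (x, t) * deriv (\<lambda>s. \<phi> (x, s)) t) = 0"
    using ws[unfolded weak_solution_def, rule_format, OF conjI[OF U(1) conjI[OF U(2,3)]]]
    unfolding V_def by (elim exE conjE) blast
  have Vopen: "open V" using U(1) by (simp add: V_def open_Times)
  then have [measurable]: "V \<in> sets borel" by simp
  have "bounded V" using U(3) closure_subset[of V] unfolding compactly_contained_def V_def[symmetric]
    by (meson bounded_subset compact_imp_bounded)
  then have Vfin: "emeasure lborel V < \<infinity>" by (rule emeasure_bounded_finite)
  define \<Gamma> where "\<Gamma> = (\<lambda>z. indicator V z *\<^sub>R G z)"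
  define v' where "v' = (\<lambda>z. indicator V z * v z)"
  have [measurable]: "\<Gamma> \<in> borel_measurable borel" "v' \<in> borel_measurable borel"
    using W unfolding in_Lp_W1p_def in_Lp_def set_borel_measurable_def \<Gamma>_def v'_def V_def by auto
  have \<Gamma>0: "\<Gamma> z = 0" if "z \<notin> V" for z using that by (simp add: \<Gamma>_def)
  have v0: "v' z = 0" if "z \<notin> V" for z using that by (simp add: v'_def)
  have int\<Gamma>: "integrable lborel (\<lambda>z. norm (\<Gamma> z) powr p)" and intv: "integrable lborel (\<lambda>z. \<bar>v' z\<bar> powr p)"
  proof -
    have "integrable lborel (\<lambda>z. indicator V z *\<^sub>R norm (G z) powr p)" "integrable lborel (\<lambda>z. indicator V z *\<^sub>R norm (v z) powr p)"
      using W unfolding in_Lp_W1p_def in_Lp_def set_integrable_def V_def by auto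
    moreover have "(\<lambda>z. indicator V z *\<^sub>R norm (G z) powr p) = (\<lambda>z. norm (\<Gamma> z) powr p)"
      "(\<lambda>z. indicator V z *\<^sub>R norm (v z) powr p) = (\<lambda>z. \<bar>v' z\<bar> powr p)"
      by (auto simp: \<Gamma>_def v'_def indicator_def)
    ultimately show "integrable lborel (\<lambda>z. norm (\<Gamma> z) powr p)" "integrable lborel (\<lambda>z. \<bar>v' z\<bar> powr p)" by simp_all
  qed
  have fin: "(\<integral>\<^sup>+z. ennreal (norm (\<Gamma> z) powr p) \<partial>lborel) < \<infinity>" "Lp_mass p v' < \<infinity>"
    using int\<Gamma> intv unfolding integrable_iff_bounded Lp_mass_def by auto
  have v'int: "integrable lborel v'"
    by (rule integrable_Lp_finite_support[of _ V p]) (use Vfin v0 p fin in auto)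
  have \<Gamma>int: "integrable lborel (\<lambda>z. \<Gamma> z $ i)" for i
    by (rule integrable_Lp_finite_support[of _ V p])
      (use Vfin \<Gamma>0 p order_le_less_trans[OF Lp_mass_component fin(1)] in auto)
  \<comment> \<open>The flux of an L^p gradient lies in L^q for the conjugate exponent q = p / (p -
    1), because its norm to the power q is |\<Gamma>|^p.\<close>
  have Fint: "integrable lborel (\<lambda>z. p_flux p (\<Gamma> z) $ i)" for i
    by (rule integrable_Lp_finite_support[of _ V "p / (p - 1)"])
      (use Vfin \<Gamma>0 p order_le_less_trans[OF Lp_mass_p_flux_component fin(1)] in \<open>auto simp: p_flux_def\<close>)
  have hcont: "continuous_on (closure V) h"
    using h U(3) unfolding p_parabolic_def compactly_contained_def V_def by (meson continuous_on_subset)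
  have [measurable]: "(\<lambda>z. indicator V z * h z) \<in> borel_measurable borel"
    using borel_measurable_integrable[OF integrable_indicator_mult_continuous[OF _ borel_open[OF Vopen] hcont]] U(3)
    by (simp add: compactly_contained_def V_def)
  have replace: "(LBINT z. indicator V z * h z * f z) = (LBINT z. v' z * f z)"
    if "f \<in> borel_measurable borel" for f
  proof (rule integral_cong_AE)
    note that[measurable]
    show "(\<lambda>z. indicator V z * h z * f z) \<in> borel_measurable lborel"
      "(\<lambda>z. v' z * f z) \<in> borel_measurable lborel" by simp_all
    show "AE z in lborel. indicator V z * h z * f z = v' z * f z"
      using vh by eventually_elim (auto simp: v'_def indicator_def)
  qed
  have ind: "indicator V (x, t) = (indicator U x * indicator ?I t :: real)" for x t
    by (simp add: V_def indicator_times)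
  have "cylinder_gradient p V h \<Gamma>"
    unfolding cylinder_gradient_def
  proof (intro conjI allI impI)
    fix \<phi> :: "(real^'n) \<times> real \<Rightarrow> real" assume \<phi>: "test_function V \<phi>"
    note d\<phi> = test_function_partial[OF \<phi>]
    show "(LBINT z. indicator V z * h z * frechet_derivative \<phi> (at z) (space_dir i)) = - (LBINT z. \<Gamma> z $ i * \<phi> z)" for i
    proof -
      have "(LBINT z. indicator V z * h z * frechet_derivative \<phi> (at z) (space_dir i))
          = (LBINT t. LBINT x. v' (x, t) * frechet_derivative \<phi> (at (x, t)) (space_dir i))"
        using test_function_measurable[OF d\<phi>[OF dir_Basis(1)]]
        by (subst replace, simp, subst integral_lborel_snd[OF integrable_mult_test_function[OF v'int d\<phi>[OF dir_Basis(1)]]], simp)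
      also have "\<dots> = (LBINT t. - (LBINT x. \<Gamma> (x, t) $ i * \<phi> (x, t)))"
      proof (rule integral_cong_AE)
        have "integrable (lborel \<Otimes>\<^sub>M lborel) (case_prod (\<lambda>x t. v' (x, t) * frechet_derivative \<phi> (at (x, t)) (space_dir i)))"
          "integrable (lborel \<Otimes>\<^sub>M lborel) (case_prod (\<lambda>x t. \<Gamma> (x, t) $ i * \<phi> (x, t)))"
          using integrable_mult_test_function[OF v'int d\<phi>[OF dir_Basis(1)]] integrable_mult_test_function[OF \<Gamma>int \<phi>]
          by (simp_all add: lborel_prod case_prod_beta')
        then show "(\<lambda>t. LBINT x. v' (x, t) * frechet_derivative \<phi> (at (x, t)) (space_dir i)) \<in> borel_measurable lborel"
          "(\<lambda>t. - (LBINT x. \<Gamma> (x, t) $ i * \<phi> (x, t))) \<in> borel_measurable lborel"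
          using lborel_pair.integrable_snd by (auto dest!: borel_measurable_integrable)
        have "AE t in lborel. t \<in> ?I \<longrightarrow> in_W1p p U (\<lambda>x. v (x, t)) (\<lambda>x. G (x, t))"
          using W by (simp add: in_Lp_W1p_def)
        then show "AE t in lborel. (LBINT x. v' (x, t) * frechet_derivative \<phi> (at (x, t)) (space_dir i))
            = - (LBINT x. \<Gamma> (x, t) $ i * \<phi> (x, t))"
        proof eventually_elim
          case (elim t)
          show ?case
          proof (cases "t \<in> ?I")
            case True
            have "test_function U (\<lambda>x. \<phi> (x, t))" using test_function_slice \<phi> unfolding V_def by blast
            then have "(LBINT x:U. v (x, t) * grad (\<lambda>y. \<phi> (y, t)) x $ i) = - (LBINT x:U. G (x, t) $ i * \<phi> (x, t))"
              using elim True unfolding in_W1p_def by blast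
            then show ?thesis using True
              by (simp add: set_lebesgue_integral_def grad_slice[OF \<phi>] v'_def \<Gamma>_def ind mult.assoc)
          qed (simp add: v0 \<Gamma>0 V_def)
        qed
      qed
      also have "\<dots> = - (LBINT z. \<Gamma> z $ i * \<phi> z)"
        by (simp add: integral_lborel_snd[OF integrable_mult_test_function[OF \<Gamma>int \<phi>]])
      finally show ?thesis .
    qed
    have flux: "integrable lborel (\<lambda>z. p_flux p (\<Gamma> z) $ i * frechet_derivative \<phi> (at z) (space_dir i))" for i
      by (rule integrable_mult_test_function[OF Fint d\<phi>[OF dir_Basis(1)]])
    have "(\<Sum>i\<in>UNIV. LBINT z. p_flux p (\<Gamma> z) $ i * frechet_derivative \<phi> (at z) (space_dir i))
        = (LBINT z. (\<Sum>i\<in>UNIV. p_flux p (\<Gamma> z) $ i * frechet_derivative \<phi> (at z) (space_dir i)))"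
      using flux by simp
    also have "\<dots> = (LBINT t. LBINT x. (\<Sum>i\<in>UNIV. p_flux p (\<Gamma> (x, t)) $ i * frechet_derivative \<phi> (at (x, t)) (space_dir i)))"
      by (rule integral_lborel_snd) (use flux in auto)
    also have "\<dots> = (LBINT t:?I. LBINT x:U. (norm (G (x, t)) powr (p - 2) *\<^sub>R G (x, t)) \<bullet> grad (\<lambda>y. \<phi> (y, t)) x)"
      unfolding set_lebesgue_integral_def
    proof (intro Bochner_Integration.integral_cong refl)
      fix t :: real
      show "(LBINT x. (\<Sum>i\<in>UNIV. p_flux p (\<Gamma> (x, t)) $ i * frechet_derivative \<phi> (at (x, t)) (space_dir i)))
         = indicator ?I t *\<^sub>R (LBINT x. indicator U x *\<^sub>R ((norm (G (x, t)) powr (p - 2) *\<^sub>R G (x, t)) \<bullet> grad (\<lambda>y. \<phi> (y, t)) x))"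
      proof (cases "t \<in> ?I")
        case True
        show ?thesis
          using True
          by (auto intro!: Bochner_Integration.integral_cong sum.cong
              simp: \<Gamma>_def p_flux_def inner_vec_def grad_slice[OF \<phi>] indicator_def V_def)
      qed (simp add: \<Gamma>0 V_def p_flux_def)
    qed
    also have "\<dots> = (LBINT t:?I. LBINT x:U. v (x, t) * deriv (\<lambda>s. \<phi> (x, s)) t)"
      using eq[OF \<phi>] by simp
    also have "\<dots> = (LBINT t. LBINT x. v' (x, t) * frechet_derivative \<phi> (at (x, t)) (0, 1))"
      unfolding set_lebesgue_integral_def
    proof (intro Bochner_Integration.integral_cong refl)
      fix t :: real
      show "indicator ?I t *\<^sub>R (LBINT x. indicator U x *\<^sub>R (v (x, t) * deriv (\<lambda>s. \<phi> (x, s)) t))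
        = (LBINT x. v' (x, t) * frechet_derivative \<phi> (at (x, t)) (0, 1))"
        by (cases "t \<in> ?I") (auto simp: deriv_slice(2)[OF \<phi>] v'_def ind mult.assoc)
    qed
    also have "\<dots> = (LBINT z. v' z * frechet_derivative \<phi> (at z) (0, 1))"
      by (rule integral_lborel_snd[symmetric]) (rule integrable_mult_test_function[OF v'int d\<phi>[OF dir_Basis(2)]])
    also have "\<dots> = (LBINT z. indicator V z * h z * frechet_derivative \<phi> (at z) (0, 1))"
      by (rule replace[symmetric]) (rule test_function_measurable[OF d\<phi>[OF dir_Basis(2)]])
    finally show "(\<Sum>i\<in>UNIV. LBINT z. p_flux p (\<Gamma> z) $ i * frechet_derivative \<phi> (at z) (space_dir i))
      = (LBINT z. indicator V z * h z * frechet_derivative \<phi> (at z) (0, 1))" .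
  qed (use fin \<Gamma>0 in auto)
  then show ?thesis by blast
qed

subsection \<open>The comparison principle\<close>

text \<open>The exponent is at least 2, as differentiability at 0 demands: the difference quotient
  there is h^(n+1) on the right and 0 on the left.\<close>

lemma DERIV_pos_part_power:
  "((\<lambda>s. max 0 s ^ Suc (Suc n)) has_real_derivative real (Suc (Suc n)) * max 0 s ^ Suc n) (at s)"
proof -
  consider "s > 0" | "s < 0" | "s = 0" by linarith
  then show ?thesis
  proof cases
    case 1
    have "((\<lambda>s. s ^ Suc (Suc n)) has_real_derivative real (Suc (Suc n)) * max 0 s ^ Suc n) (at s)"
      using 1 DERIV_pow[of "Suc (Suc n)" s] by simp
    then show ?thesis
      by (rule has_field_derivative_transform_within_open[where S = "{0<..}"]) (use 1 in auto)
  next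
    case 2
    have "((\<lambda>s. 0) has_real_derivative real (Suc (Suc n)) * max 0 s ^ Suc n) (at s)"
      using 2 by auto
    then show ?thesis
      by (rule has_field_derivative_transform_within_open[where S = "{..<0}"]) (use 2 in auto)
  next
    case 3
    have "((\<lambda>h. h ^ Suc n) \<longlongrightarrow> 0 ^ Suc n) (at_right (0::real))" by (intro tendsto_intros)
    then have "((\<lambda>h. h ^ Suc n) \<longlongrightarrow> 0) (at_right (0::real))" by simp
    then have r: "((\<lambda>h. (max 0 h ^ Suc (Suc n) - max 0 0 ^ Suc (Suc n)) / h) \<longlongrightarrow> 0) (at_right (0::real))"
      by (rule Lim_transform_eventually) (auto simp: eventually_at_filter)
    have "((\<lambda>h. 0) \<longlongrightarrow> 0) (at_left (0::real))" by simp
    then have l: "((\<lambda>h. (max 0 h ^ Suc (Suc n) - max 0 0 ^ Suc (Suc n)) / h) \<longlongrightarrow> 0) (at_left (0::real))"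
      by (rule Lim_transform_eventually) (auto simp: eventually_at_filter)
    show ?thesis
      using filterlim_split_at[OF l r] 3 by (simp add: DERIV_def)
  qed
qed

lemma compact_cball_neighbourhood:
  fixes S :: "'a::euclidean_space set"
  assumes "compact S"
  shows "compact {z. \<exists>y\<in>S. dist z y \<le> r}"
proof -
  have "{z. \<exists>y\<in>S. dist z y \<le> r} = {x + y |x y. x \<in> S \<and> y \<in> cball 0 r}"
  proof (intro equalityI subsetI)
    fix z assume "z \<in> {z. \<exists>y\<in>S. dist z y \<le> r}"
    then obtain y where "y \<in> S" "dist z y \<le> r" by blast
    then have "z = y + (z - y) \<and> y \<in> S \<and> z - y \<in> cball 0 r" by (simp add: dist_norm norm_minus_commute)
    then show "z \<in> {x + y |x y. x \<in> S \<and> y \<in> cball 0 r}" by blast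
  next
    fix z assume "z \<in> {x + y |x y. x \<in> S \<and> y \<in> cball 0 r}"
    then obtain x y where "z = x + y" "x \<in> S" "norm y \<le> r" by auto
    then have "x \<in> S" "dist z x \<le> r" by (auto simp: dist_norm)
    then show "z \<in> {z. \<exists>y\<in>S. dist z y \<le> r}" by blast
  qed
  then show ?thesis using compact_sums[OF assms compact_cball[of 0 r]] by simp
qed

section \<open>Shifted kernels as test functions and the energy identity for mollified
  differences\<close>

lemma frechet_derivative_reflect:
  fixes k :: "'a::euclidean_space \<Rightarrow> real"
  assumes "test_function W k"
  shows "((\<lambda>y. k (z - y)) has_derivative (\<lambda>v. - frechet_derivative k (at (z - y)) v)) (at y)"
proof -
  have "((\<lambda>y. k (z - y)) has_derivative (\<lambda>v. frechet_derivative k (at (z - y)) (- v))) (at y)"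
    by (rule has_derivative_compose[OF _ test_functionD(4)[OF assms], of "\<lambda>y. z - y"])
       (auto intro!: derivative_eq_intros)
  then show ?thesis
    by (simp add: linear_neg[OF has_derivative_linear[OF test_functionD(4)[OF assms]]])
qed

text \<open>Makes the shifted kernel admissible in the definition of the weak gradient, which
  thereby turns into the classical gradient of the mollification.\<close>

lemma test_function_reflect:
  fixes k :: "'a::euclidean_space \<Rightarrow> real"
  assumes k: "test_function UNIV k" and supp: "\<And>u. r \<le> norm u \<Longrightarrow> k u = 0" and V: "cball z r \<subseteq> V"
  shows "test_function V (\<lambda>y. k (z - y))"
proof -
  have "Ck j (\<lambda>y. k (z + (- y)))" for j
    by (rule Ck_compose_affine[OF bounded_linear_minus[OF bounded_linear_ident] test_functionD(1)[OF k]])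
  then have "Ck j (\<lambda>y. k (z - y))" for j by simp
  moreover have sub: "{y. k (z - y) \<noteq> 0} \<subseteq> cball z r"
    using supp by (force simp: dist_norm)
  then have "closure {y. k (z - y) \<noteq> 0} \<subseteq> cball z r" by (simp add: closure_minimal)
  moreover have "compact (closure {y. k (z - y) \<noteq> 0})"
    using sub bounded_subset[OF bounded_cball] by (simp add: compact_closure)
  ultimately show ?thesis using V unfolding test_function_def compactly_contained_def by blast
qed

lemma mollifier_derivative_odd:
  assumes k: "mollifier r k"
  shows "frechet_derivative k (at (- u)) v = - frechet_derivative k (at u) v"
proof -
  have "(k has_derivative (\<lambda>v. - frechet_derivative k (at (- u)) v)) (at u)"
    using frechet_derivative_reflect[OF mollifierD(1)[OF k], of 0 u] mollifierD(4)[OF k] by simp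
  then have "frechet_derivative k (at u) v = - frechet_derivative k (at (- u)) v"
    using frechet_derivative_at by metis
  then show ?thesis by simp
qed

text \<open>The derivative of an even kernel is odd, whence the minus sign.\<close>

lemma integral_mult_conv_partial:
  fixes f g :: "'a::euclidean_space \<Rightarrow> real"
  assumes k: "mollifier r k" and f: "integrable lborel f" and g: "integrable lborel g" and b: "b \<in> Basis"
  shows "(LBINT z. f z * conv (\<lambda>u. frechet_derivative k (at u) b) g z)
    = - (LBINT z. g z * conv (\<lambda>u. frechet_derivative k (at u) b) f z)"
proof -
  have "conv (\<lambda>u. frechet_derivative k (at (- u)) b) f z = - conv (\<lambda>u. frechet_derivative k (at u) b) f z" for z
    by (simp add: conv_def mollifier_derivative_odd[OF k])
  then show ?thesis
    using integral_mult_conv[OF test_function_partial[OF mollifierD(1)[OF k] b] f g] by simp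
qed

text \<open>On the flux side the outer mollifier passes to \<open>A i\<close>, and the spatial
  derivatives of the inner function give \<open>m\<close> times the mollified \<open>B i\<close>. On
  the time side it passes to \<open>D\<close>, and integrating by parts against the square of the
  cut-off in time leaves a right-hand side with a sign. The set \<open>S\<close> localises
  everything: the function before the outer mollification vanishes beyond distance r from
  \<open>S\<close>, the test function beyond 2 r, which is still inside \<open>V\<close>.\<close>

lemma energy_identity:
  fixes D :: "(real^'n) \<times> real \<Rightarrow> real" and A B :: "'n \<Rightarrow> (real^'n) \<times> real \<Rightarrow> real"
  assumes k: "mollifier r k" and r: "r > 0"
    and D: "integrable lborel D" and A: "\<And>i. integrable lborel (A i)" and B: "\<And>i. integrable lborel (B i)"
    and weak_grad: "\<And>\<phi> i. test_function V \<phi> \<Longrightarrow>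
      (LBINT z. D z * frechet_derivative \<phi> (at z) (space_dir i)) = - (LBINT z. B i z * \<phi> z)"
    and weak_eq: "\<And>\<phi>. test_function V \<phi> \<Longrightarrow>
      (\<Sum>i\<in>UNIV. LBINT z. A i z * frechet_derivative \<phi> (at z) (space_dir i))
      = (LBINT z. D z * frechet_derivative \<phi> (at z) (0, 1))"
    and S: "compact S" "\<And>y z. y \<in> S \<Longrightarrow> dist z y \<le> 2 * r \<Longrightarrow> z \<in> V"
    and conc: "\<And>z. snd z < T \<Longrightarrow> conv k D z > \<epsilon> \<Longrightarrow> \<exists>y\<in>S. dist z y \<le> r"
  defines "m \<equiv> \<lambda>z. 2 * max 0 (conv k D z - \<epsilon>) * (max 0 (T - snd z))\<^sup>2"
  shows "(\<Sum>i\<in>UNIV. LBINT z. m z * (conv k (A i) z * conv k (B i) z))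
      = - (2 / 3) * (LBINT z. max 0 (conv k D z - \<epsilon>) ^ 3 * max 0 (T - snd z))"
    and "continuous_on UNIV m" "\<And>z. m z \<noteq> 0 \<Longrightarrow> \<exists>y\<in>S. dist z y \<le> r"
    and "integrable lborel (\<lambda>z. max 0 (conv k D z - \<epsilon>) ^ 3 * max 0 (T - snd z))"
proof -
  define K where "K = {z. \<exists>y\<in>S. dist z y \<le> r}"
  have K: "compact K" unfolding K_def by (rule compact_cball_neighbourhood[OF S(1)])
  let ?k' = "\<lambda>u. frechet_derivative k (at u)"
  note tk = mollifierD(1)[OF k]
  define P where "P = (\<lambda>z. max 0 (conv k D z - \<epsilon>))"
  define X where "X = (\<lambda>z::(real^'n) \<times> real. max 0 (T - snd z))"
  have outK: "P z = 0 \<or> X z = 0" if "z \<notin> K" for z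
    using that conc[of z] by (force simp: P_def X_def K_def)
  have contD: "continuous_on UNIV (conv k D)" by (rule conv_continuous[OF tk D])
  have contP: "continuous_on UNIV P" and contX: "continuous_on UNIV X"
    unfolding P_def X_def by (intro continuous_intros contD)+
  have m: "m z = 2 * P z * (X z)\<^sup>2" for z by (simp add: m_def P_def X_def)
  show "continuous_on UNIV m" unfolding m by (intro continuous_intros contP contX)
  show mK: "\<exists>y\<in>S. dist z y \<le> r" if "m z \<noteq> 0" for z
    using outK[of z] that by (auto simp: m K_def)
  have intPX: "integrable lborel (\<lambda>z. P z ^ 3 * X z)"
    by (rule integrable_compact_support[OF _ K]) (use outK in \<open>auto intro!: continuous_intros contP contX\<close>)
  then show "integrable lborel (\<lambda>z. max 0 (conv k D z - \<epsilon>) ^ 3 * max 0 (T - snd z))"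
    by (simp add: P_def X_def)
  let ?D' = "\<lambda>z v. conv (\<lambda>u. ?k' u v) D z"
  have dD: "(conv k D has_derivative ?D' z) (at z)" for z by (rule conv_has_derivative[OF tk D])
  have contD': "continuous_on UNIV (\<lambda>z. ?D' z b)" if "b \<in> Basis" for b
    by (rule conv_continuous[OF test_function_partial[OF tk that] D])
  have dP: "((\<lambda>z. P z ^ Suc (Suc n)) has_derivative
      (\<lambda>v. ?D' z v * (real (Suc (Suc n)) * P z ^ Suc n))) (at z)" for z n
    unfolding P_def
    by (rule DERIV_compose_FDERIV[OF DERIV_pos_part_power])
       (auto intro!: derivative_eq_intros dD)
  have dX: "((\<lambda>z. (X z)\<^sup>2) has_derivative (\<lambda>v. - snd v * (2 * X z))) (at z)" for z
  proof -
    have "((\<lambda>z::(real^'n) \<times> real. T - snd z) has_derivative (\<lambda>v. - snd v)) (at z)"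
      by (auto intro!: derivative_eq_intros)
    from DERIV_compose_FDERIV[OF DERIV_pos_part_power[of 0] this] show ?thesis
      by (simp add: X_def power2_eq_square)
  qed
  \<comment> \<open>The squares make \<psi> continuously differentiable, which is enough for
    integration by parts; smoothness of the test function comes from the second
    mollification.\<close>
  define \<psi> where "\<psi> = (\<lambda>z. (P z)\<^sup>2 * (X z)\<^sup>2)"
  define \<psi>' where "\<psi>' = (\<lambda>z v. (P z)\<^sup>2 * (- snd v * (2 * X z)) + ?D' z v * (2 * P z) * (X z)\<^sup>2)"
  have d\<psi>: "(\<psi> has_derivative \<psi>' z) (at z)" for z
    unfolding \<psi>_def \<psi>'_def using has_derivative_mult[OF dP[of 0] dX] by (simp add: power2_eq_square)
  have \<psi>K: "\<psi> z = 0" if "z \<notin> K" for z using outK[OF that] by (auto simp: \<psi>_def)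
  have cont\<psi>: "continuous_on UNIV \<psi>" unfolding \<psi>_def by (intro continuous_intros contP contX)
  have int\<psi>: "integrable lborel \<psi>" by (rule integrable_compact_support[OF cont\<psi> K \<psi>K])
  have cont\<psi>': "continuous_on UNIV (\<lambda>z. \<psi>' z b)" if "b \<in> Basis" for b
    unfolding \<psi>'_def by (intro continuous_intros contP contX contD' that)
  define \<phi> where "\<phi> = conv k \<psi>"
  have d\<phi>: "frechet_derivative \<phi> (at z) v = conv (\<lambda>u. ?k' u v) \<psi> z" for z v
    unfolding \<phi>_def using frechet_derivative_at[OF conv_has_derivative[OF tk int\<psi>]] by metis
  have \<phi>: "test_function V \<phi>"
  proof -
    define K2 where "K2 = {z. \<exists>y\<in>S. dist z y \<le> 2 * r}"
    have sub: "{z. \<phi> z \<noteq> 0} \<subseteq> K2"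
    proof
      fix z assume "z \<in> {z. \<phi> z \<noteq> 0}"
      then obtain y where y: "k (z - y) \<noteq> 0" "\<psi> y \<noteq> 0"
        using conv_eq_0[of k z \<psi>] by (auto simp: \<phi>_def)
      then have "dist z y \<le> r" using mollifierD(3)[OF k, of "z - y"] by (force simp: dist_norm)
      moreover have "y \<in> K" using \<psi>K[of y] y by blast
      then obtain x where "x \<in> S" "dist y x \<le> r" unfolding K_def by blast
      ultimately have "x \<in> S" "dist z x \<le> 2 * r" using dist_triangle[of z x y] by simp_all
      then show "z \<in> K2" unfolding K2_def by blast
    qed
    have K2: "compact K2" unfolding K2_def by (rule compact_cball_neighbourhood[OF S(1)])
    have c: "closure {z. \<phi> z \<noteq> 0} \<subseteq> K2"
      by (rule closure_minimal[OF sub compact_imp_closed[OF K2]])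
    moreover have "compact (closure {z. \<phi> z \<noteq> 0})"
      using bounded_subset[OF compact_imp_bounded[OF K2] sub] by (simp add: compact_closure)
    moreover have "K2 \<subseteq> V" using S(2) by (auto simp: K2_def)
    moreover have "Ck j \<phi>" for j unfolding \<phi>_def by (rule Ck_conv[OF tk int\<psi>])
    ultimately show ?thesis unfolding test_function_def compactly_contained_def by blast
  qed
  have by_parts: "(LBINT z. \<psi> z * conv (\<lambda>u. ?k' u (space_dir i)) (A i) z)
      = - (LBINT z. \<psi>' z (space_dir i) * conv k (A i) z)" for i
  proof -
    have dA: "(conv k (A i) has_derivative (\<lambda>v. conv (\<lambda>u. ?k' u v) (A i) z)) (at z)" for z
      by (rule conv_has_derivative[OF tk A])
    have contA: "continuous_on UNIV (conv k (A i))" by (rule conv_continuous[OF tk A])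
    have contA': "continuous_on UNIV (\<lambda>z. conv (\<lambda>u. ?k' u (space_dir i)) (A i) z)"
      by (rule conv_continuous[OF test_function_partial[OF tk dir_Basis(1)] A])
    have "(LBINT z. \<psi> z * conv (\<lambda>u. ?k' u (space_dir i)) (A i) z + \<psi>' z (space_dir i) * conv k (A i) z) = 0"
      by (rule integral_directional_derivative_eq_0[OF has_derivative_mult[OF d\<psi> dA] _ K])
         (auto intro!: continuous_intros cont\<psi> cont\<psi>' contA contA' dir_Basis simp: \<psi>K)
    moreover have "integrable lborel (\<lambda>z. \<psi> z * conv (\<lambda>u. ?k' u (space_dir i)) (A i) z)"
      by (rule integrable_compact_support[OF _ K]) (auto intro!: continuous_intros cont\<psi> contA' simp: \<psi>K)
    moreover have "integrable lborel (\<lambda>z. \<psi>' z (space_dir i) * conv k (A i) z)"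
    proof (rule integrable_compact_support[OF _ K])
      show "continuous_on UNIV (\<lambda>z. \<psi>' z (space_dir i) * conv k (A i) z)"
        by (intro continuous_intros cont\<psi>' contA dir_Basis)
      show "\<psi>' z (space_dir i) * conv k (A i) z = 0" if "z \<notin> K" for z using outK[OF that] by (auto simp: \<psi>'_def)
    qed
    ultimately show ?thesis by simp
  qed
  \<comment> \<open>Where \<open>m\<close> is nonzero the ball of radius r about z lies in
    \<open>V\<close>, so the shifted kernel is a test function, and differentiating the
    mollification agrees with mollifying the weak gradient.\<close>
  have grad_D: "m z * ?D' z (space_dir i) = m z * conv k (B i) z" for z i
  proof (cases "m z = 0")
    case False
    then obtain y where y: "y \<in> S" "dist z y \<le> r" using mK by blast
    have "cball z r \<subseteq> V"
    proof
      fix x assume "x \<in> cball z r"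
      then show "x \<in> V" using y dist_triangle[of x y z] by (intro S(2)[OF y(1)]) (auto simp: dist_commute)
    qed
    then have t: "test_function V (\<lambda>y. k (z - y))"
      using test_function_reflect[OF tk mollifierD(3)[OF k]] by blast
    have "frechet_derivative (\<lambda>y. k (z - y)) (at y) v = - ?k' (z - y) v" for y v
      using frechet_derivative_at[OF frechet_derivative_reflect[OF tk]] by metis
    then show ?thesis
      using weak_grad[OF t, of i] by (simp add: conv_def mult.commute)
  qed simp
  have \<psi>'sp: "\<psi>' z (space_dir i) = m z * ?D' z (space_dir i)" for z i
    by (simp add: \<psi>'_def m)
  have "(\<Sum>i\<in>UNIV. LBINT z. A i z * frechet_derivative \<phi> (at z) (space_dir i))
      = (\<Sum>i\<in>UNIV. LBINT z. m z * (conv k (A i) z * conv k (B i) z))"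
  proof (rule sum.cong[OF refl])
    fix i :: 'n
    have "(LBINT z. A i z * frechet_derivative \<phi> (at z) (space_dir i)) = (LBINT z. \<psi>' z (space_dir i) * conv k (A i) z)"
      unfolding d\<phi> using integral_mult_conv_partial[OF k A[of i] int\<psi> dir_Basis(1)[of i]] by_parts[of i] by simp
    also have "\<dots> = (LBINT z. m z * (conv k (A i) z * conv k (B i) z))"
      unfolding \<psi>'sp grad_D by (simp add: mult_ac)
    finally show "(LBINT z. A i z * frechet_derivative \<phi> (at z) (space_dir i))
      = (LBINT z. m z * (conv k (A i) z * conv k (B i) z))" .
  qed
  \<comment> \<open>The factor 2 / 3 comes from the time derivative of P^3 X^2, whose integral
    vanishes: it is 3 P^2 X^2 times the time derivative of \<open>conv k D\<close>, minus 2 P^3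
    X.\<close>
  moreover have "(LBINT z. D z * frechet_derivative \<phi> (at z) (0, 1)) = - (2 / 3) * (LBINT z. P z ^ 3 * X z)"
  proof -
    have "((\<lambda>z. P z ^ 3 * (X z)\<^sup>2) has_derivative
        (\<lambda>v. P z ^ 3 * (- snd v * (2 * X z)) + ?D' z v * (3 * (P z)\<^sup>2) * (X z)\<^sup>2)) (at z)" for z
      using has_derivative_mult[OF dP[of 1 z] dX[of z]] by (simp add: numeral_3_eq_3 power2_eq_square)
    note d = this
    have "(LBINT z. P z ^ 3 * (- snd (0::real^'n, 1::real) * (2 * X z)) + ?D' z (0, 1) * (3 * (P z)\<^sup>2) * (X z)\<^sup>2) = 0"
    proof (rule integral_directional_derivative_eq_0[OF d _ K])
      show "continuous_on UNIV (\<lambda>z. P z ^ 3 * (- snd (0::real^'n, 1::real) * (2 * X z)) + ?D' z (0, 1) * (3 * (P z)\<^sup>2) * (X z)\<^sup>2)"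
        by (intro continuous_intros contP contX contD' dir_Basis)
      show "P z ^ 3 * (X z)\<^sup>2 = 0" if "z \<notin> K" for z using outK[OF that] by auto
    qed
    then have "(LBINT z. 3 * (\<psi> z * ?D' z (0, 1)) - 2 * (P z ^ 3 * X z)) = 0"
      by (simp add: \<psi>_def algebra_simps)
    moreover have "integrable lborel (\<lambda>z. \<psi> z * ?D' z (0, 1))"
      by (rule integrable_compact_support[OF _ K]) (auto intro!: continuous_intros cont\<psi> contD' dir_Basis simp: \<psi>K)
    ultimately have "(LBINT z. \<psi> z * ?D' z (0, 1)) = 2 / 3 * (LBINT z. P z ^ 3 * X z)"
      using intPX by simp
    then show ?thesis
      unfolding d\<phi> using integral_mult_conv_partial[OF k D int\<psi> dir_Basis(2)] by simp
  qed
  ultimately show "(\<Sum>i\<in>UNIV. LBINT z. m z * (conv k (A i) z * conv k (B i) z))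
      = - (2 / 3) * (LBINT z. max 0 (conv k D z - \<epsilon>) ^ 3 * max 0 (T - snd z))"
    using weak_eq[OF \<phi>] by (simp add: P_def X_def)
qed

lemma mollifier_mono: "mollifier r k \<Longrightarrow> r \<le> r' \<Longrightarrow> mollifier r' k"
  unfolding mollifier_def by auto

lemma integrable_mult_Lp:
  fixes A B :: "'a::euclidean_space \<Rightarrow> real"
  assumes pq: "p > 1" "q > 1" "1 / p + 1 / q = 1"
    and [measurable]: "A \<in> borel_measurable borel" "B \<in> borel_measurable borel"
    and fin: "Lp_mass q A < \<infinity>" "Lp_mass p B < \<infinity>"
  shows "integrable lborel (\<lambda>z. A z * B z)"
proof (rule integrableI_bounded)
  have "\<bar>A z * B z\<bar> \<le> \<bar>A z\<bar> powr q + \<bar>B z\<bar> powr p" for z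
  proof -
    have "\<bar>B z\<bar> * \<bar>A z\<bar> \<le> \<bar>B z\<bar> powr p / p + \<bar>A z\<bar> powr q / q"
      by (rule Youngs_inequality[OF pq]) auto
    also have "\<dots> \<le> \<bar>B z\<bar> powr p / 1 + \<bar>A z\<bar> powr q / 1"
      using pq by (intro add_mono divide_left_mono) auto
    finally show ?thesis by (simp add: abs_mult mult.commute)
  qed
  then have "(\<integral>\<^sup>+z. ennreal (norm (A z * B z)) \<partial>lborel) \<le> (\<integral>\<^sup>+z. ennreal (\<bar>A z\<bar> powr q) + ennreal (\<bar>B z\<bar> powr p) \<partial>lborel)"
    by (intro nn_integral_mono) (auto simp: ennreal_plus[symmetric] simp del: ennreal_plus)
  also have "\<dots> = Lp_mass q A + Lp_mass p B"
    by (subst nn_integral_add) (auto simp: Lp_mass_def)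
  finally show "(\<integral>\<^sup>+z. ennreal (norm (A z * B z)) \<partial>lborel) < \<infinity>"
    using fin by (simp add: le_less_trans)
qed simp

lemma Lp_mass_diff_finite:
  fixes F G :: "'a::euclidean_space \<Rightarrow> real"
  assumes [measurable]: "F \<in> borel_measurable borel" "G \<in> borel_measurable borel"
    and "p > 0" "Lp_mass p F < \<infinity>" "Lp_mass p G < \<infinity>"
  shows "Lp_mass p (\<lambda>z. F z - G z) < \<infinity>"
proof -
  have "Lp_mass p (\<lambda>z. F z - G z) \<le> ennreal (3 powr p) * (Lp_mass p F + Lp_mass p G + Lp_mass p (\<lambda>z::'a. 0))"
    by (rule Lp_mass_le_sum3) (use assms in auto)
  also have "\<dots> < \<infinity>" using assms by (simp add: Lp_mass_def ennreal_mult_less_top)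
  finally show ?thesis .
qed

text \<open>If h > w somewhere, the energy identity is contradictory: by monotonicity its left side
  is at least -c0 / 2 up to mollification errors already counted, while its right side is at most
  -c0. The interior of the top face is not part of the parabolic boundary, so all work is done at
  times up to some T < t2.\<close>

lemma p_parabolic_comparison:
  fixes a b :: "real^'n" and h w :: "(real^'n) \<times> real \<Rightarrow> real"
  assumes p: "p > 1" and ne: "box a b \<noteq> {}" "t1 < t2"
    and h: "p_parabolic p (box a b \<times> {t1<..<t2}) h" "continuous_on (closure (box a b \<times> {t1<..<t2})) h"
    and w: "p_parabolic p (box a b \<times> {t1<..<t2}) w" "continuous_on (closure (box a b \<times> {t1<..<t2})) w"
    and le: "\<And>z. z \<in> parabolic_boundary (box a b) t1 t2 \<Longrightarrow> h z \<le> w z"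
    and z0: "z0 \<in> box a b \<times> {t1<..<t2}"
  shows "h z0 \<le> w z0"
proof (rule ccontr)
  define W where "W = box a b \<times> {t1<..<t2}"
  note h = h[folded W_def] and w = w[folded W_def] and z0 = z0[folded W_def]
  have clW: "closure W = cbox a b \<times> {t1..t2}"
    using ne by (simp add: W_def closure_Times)
  have openW: "open W" by (simp add: W_def open_Times open_box)
  define d where "d = (\<lambda>z. h z - w z)"
  have contd: "continuous_on (closure W) d" unfolding d_def by (intro continuous_intros h w)
  assume "\<not> h z0 \<le> w z0"
  then have dz0: "d z0 > 0" by (simp add: d_def)
  \<comment> \<open>A positive level below \<open>d z0\<close>: the set where d is at least
    \<epsilon> misses the parabolic boundary, where d \<le> 0, and contains a neighbourhood of z0 in
    the closed cylinder.\<close>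
  define \<epsilon> where "\<epsilon> = d z0 / 2"
  have \<epsilon>: "\<epsilon> > 0" using dz0 by (simp add: \<epsilon>_def)
  have tz0: "t1 < snd z0" "snd z0 < t2" using z0 by (auto simp: W_def)
  \<comment> \<open>Stopping short of t2 keeps \<open>S\<close> at a positive distance from the top
    as well.\<close>
  define T where "T = (snd z0 + t2) / 2"
  have T: "snd z0 < T" "T < t2" using tz0 by (auto simp: T_def)
  define S where "S = {z \<in> cbox a b \<times> {t1..T}. \<epsilon> \<le> d z}"
  have subcl: "cbox a b \<times> {t1..T} \<subseteq> closure W" using T unfolding clW by auto
  have "closed S"
    unfolding S_def using continuous_on_subset[OF contd subcl]
    by (intro continuous_on_closed_Collect_le continuous_on_const closed_Times closed_cbox closed_real_atLeastAtMost)
  moreover have "compact (cbox a b \<times> {t1..T})" by (intro compact_Times compact_cbox compact_Icc)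
  moreover have "S = S \<inter> (cbox a b \<times> {t1..T})" by (auto simp: S_def)
  ultimately have S: "compact S" by (metis closed_Int_compact)
  have z0S: "z0 \<in> S"
    using z0 T tz0 dz0 box_subset_cbox[of a b] by (auto simp: S_def W_def \<epsilon>_def)
  have SW: "fst z \<in> box a b" "t1 < snd z" "snd z \<le> T" if "z \<in> S" for z
  proof -
    obtain x t where z: "z = (x, t)" by (cases z)
    have x: "x \<in> cbox a b" "t1 \<le> t" "t \<le> T" "d (x, t) > 0" using that z \<epsilon> by (auto simp: S_def)
    have nb: "(x, t) \<notin> parabolic_boundary (box a b) t1 t2" using le[of "(x, t)"] x(4) by (auto simp: d_def)
    then have "t \<noteq> t1" using x ne by (auto simp: parabolic_boundary_def closure_box)
    moreover from this have "x \<in> box a b" 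
      using nb x T ne by (auto simp: parabolic_boundary_def frontier_box)
    ultimately show "fst z \<in> box a b" "t1 < snd z" "snd z \<le> T" using x z by auto
  qed
  have cfst: "compact (fst ` S)" and csnd: "compact (snd ` S)"
    by (intro compact_continuous_image continuous_intros S)+
  obtain e1 where e1: "e1 > 0" "(\<Union>x\<in>fst ` S. cball x e1) \<subseteq> box a b"
    using compact_subset_open_imp_cball_epsilon_subset[OF cfst open_box, of a b] SW(1) by blast
  obtain e2 where e2: "e2 > 0" "(\<Union>x\<in>snd ` S. cball x e2) \<subseteq> {t1<..}"
    using compact_subset_open_imp_cball_epsilon_subset[OF csnd open_greaterThan, of t1] SW(2) by blast
  \<comment> \<open>A neighbourhood of the spatial projection of \<open>S\<close>. With the time
    interval (s1, s2) it gives a cylinder around \<open>S\<close> that is compactly contained in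
    \<open>W\<close>, where the weak equations may be used.\<close>
  define U where "U = (\<Union>x\<in>fst ` S. ball x e1)"
  define s1 where "s1 = t1 + e2 / 2"
  define s2 where "s2 = (T + t2) / 2"
  define V where "V = U \<times> {s1<..<s2}"
  have openU: "open U" by (auto simp: U_def)
  have s1: "t1 < s1" "s1 < snd z" if "z \<in> S" for z
  proof -
    have "snd z - e2 \<in> cball (snd z) e2" using e2 by (simp add: dist_norm)
    then have "snd z - e2 > t1" using e2(2) that by blast
    then show "t1 < s1" "s1 < snd z" using e2(1) by (auto simp: s1_def)
  qed
  have s2: "T < s2" "s2 < t2" using T by (auto simp: s2_def)
  have s12: "s1 < s2" using s1(2)[OF z0S] T s2 by simp
  have openV: "open V" using openU by (simp add: V_def open_Times)
  have SV: "S \<subseteq> V"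
  proof
    fix z assume z: "z \<in> S"
    then have "fst z \<in> U" using e1(1) unfolding U_def by (intro UN_I[of "fst z"]) auto
    then show "z \<in> V" using s1(2)[OF z] SW(3)[OF z] s2 by (auto simp: V_def mem_Times_iff)
  qed
  have compU: "compact {x. \<exists>y\<in>fst ` S. dist x y \<le> e1}" by (rule compact_cball_neighbourhood[OF cfst])
  have "closure U \<subseteq> {x. \<exists>y\<in>fst ` S. dist x y \<le> e1}"
    by (rule closure_minimal[OF _ compact_imp_closed[OF compU]]) (force simp: U_def dist_commute)
  also have "\<dots> \<subseteq> box a b" using e1(2) by (force simp: dist_commute)
  finally have clU: "closure U \<subseteq> box a b" .
  have clV: "closure V = closure U \<times> {s1..s2}" using s12 by (simp add: V_def closure_Times)
  have clVW: "closure V \<subseteq> W" using clU s1(1)[OF z0S] s2 unfolding clV W_def by force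
  have "bounded (closure U)" using clU bounded_box bounded_subset by blast
  then have compV: "compact (closure V)"
    unfolding clV by (intro compact_Times compact_Icc) (simp add: compact_eq_bounded_closed)
  have cc: "compactly_contained (U \<times> {s1<..<s2}) W"
    using compV clVW by (simp add: compactly_contained_def V_def)
  have [measurable]: "V \<in> sets borel" using openV by simp
  have Vfin: "emeasure lborel V < \<infinity>"
    using bounded_subset[OF compact_imp_bounded[OF compV] closure_subset] by (rule emeasure_bounded_finite)
  obtain \<Gamma>1 \<Gamma>2 where "cylinder_gradient p V h \<Gamma>1" "cylinder_gradient p V w \<Gamma>2"
    using p_parabolic_cylinder[OF p h(1) openU s12 cc] p_parabolic_cylinder[OF p w(1) openU s12 cc]
    unfolding V_def by blast
  note \<Gamma>1 = cylinder_gradientD[OF this(1)] and \<Gamma>2 = cylinder_gradientD[OF this(2)]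
  note [measurable] = \<Gamma>1(1) \<Gamma>2(1)
  define q where "q = p / (p - 1)"
  have q: "q > 1" "1 / p + 1 / q = 1" using p by (auto simp: q_def field_simps)
  define A where "A = (\<lambda>i z. p_flux p (\<Gamma>1 z) $ i - p_flux p (\<Gamma>2 z) $ i)"
  define B where "B = (\<lambda>i z. \<Gamma>1 z $ i - \<Gamma>2 z $ i)"
  define D where "D = (\<lambda>z. indicator V z * h z - indicator V z * w z)"
  have Dd: "D z = (if z \<in> V then d z else 0)" for z by (simp add: D_def d_def)
  have [measurable]: "A i \<in> borel_measurable borel" "B i \<in> borel_measurable borel" for i
    unfolding A_def B_def by measurable
  have flux_fin: "Lp_mass q (\<lambda>z. p_flux p (\<Gamma>1 z) $ i) < \<infinity>" "Lp_mass q (\<lambda>z. p_flux p (\<Gamma>2 z) $ i) < \<infinity>" for i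
    unfolding q_def using order_le_less_trans[OF Lp_mass_p_flux_component[OF p]] \<Gamma>1(3) \<Gamma>2(3) by blast+
  have grad_fin: "Lp_mass p (\<lambda>z. \<Gamma>1 z $ i) < \<infinity>" "Lp_mass p (\<lambda>z. \<Gamma>2 z $ i) < \<infinity>" for i
    using order_le_less_trans[OF Lp_mass_component[of p]] \<Gamma>1(3) \<Gamma>2(3) p by force+
  have Afin: "Lp_mass q (A i) < \<infinity>" for i
    unfolding A_def by (rule Lp_mass_diff_finite[OF _ _ _ flux_fin]) (use q in auto)
  have Bfin: "Lp_mass p (B i) < \<infinity>" for i
    unfolding B_def by (rule Lp_mass_diff_finite[OF _ _ _ grad_fin]) (use p in auto)
  have int1: "integrable lborel (\<lambda>z. p_flux p (\<Gamma>1 z) $ i)" "integrable lborel (\<lambda>z. p_flux p (\<Gamma>2 z) $ i)" for i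
    by (rule integrable_Lp_finite_support[OF _ _ Vfin _ _ flux_fin(1)]
             integrable_Lp_finite_support[OF _ _ Vfin _ _ flux_fin(2)];
        use q \<Gamma>1(2) \<Gamma>2(2) in \<open>simp add: p_flux_def\<close>)+
  have int2: "integrable lborel (\<lambda>z. \<Gamma>1 z $ i)" "integrable lborel (\<lambda>z. \<Gamma>2 z $ i)" for i
    by (rule integrable_Lp_finite_support[OF _ _ Vfin _ _ grad_fin(1)]
             integrable_Lp_finite_support[OF _ _ Vfin _ _ grad_fin(2)];
        use p \<Gamma>1(2) \<Gamma>2(2) in simp)+
  have Aint: "integrable lborel (A i)" and Bint: "integrable lborel (B i)" for i
    unfolding A_def B_def using int1 int2 by auto
  have hint: "integrable lborel (\<lambda>z. indicator V z * h z)" "integrable lborel (\<lambda>z. indicator V z * w z)"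
    using h w clVW compV closure_subset[of W]
    by (auto intro!: integrable_indicator_mult_continuous continuous_on_subset[of "closure W"])
  have Dint: "integrable lborel D" unfolding D_def using hint by simp
  have weak_grad: "(LBINT z. D z * frechet_derivative \<phi> (at z) (space_dir i)) = - (LBINT z. B i z * \<phi> z)"
    if \<phi>: "test_function V \<phi>" for \<phi> i
    using \<Gamma>1(4)[OF \<phi>, of i] \<Gamma>2(4)[OF \<phi>, of i] integrable_mult_test_function[OF hint(1) test_function_partial[OF \<phi> dir_Basis(1)]]
      integrable_mult_test_function[OF hint(2) test_function_partial[OF \<phi> dir_Basis(1)]] integrable_mult_test_function[OF int2(1) \<phi>] integrable_mult_test_function[OF int2(2) \<phi>]
    by (simp add: D_def B_def left_diff_distrib)
  have weak_eq: "(\<Sum>i\<in>UNIV. LBINT z. A i z * frechet_derivative \<phi> (at z) (space_dir i))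
      = (LBINT z. D z * frechet_derivative \<phi> (at z) (0, 1))" if \<phi>: "test_function V \<phi>" for \<phi>
    using \<Gamma>1(5)[OF \<phi>] \<Gamma>2(5)[OF \<phi>] integrable_mult_test_function[OF hint(1) test_function_partial[OF \<phi> dir_Basis(2)]]
      integrable_mult_test_function[OF hint(2) test_function_partial[OF \<phi> dir_Basis(2)]]
      integrable_mult_test_function[OF int1(1) test_function_partial[OF \<phi> dir_Basis(1)]] integrable_mult_test_function[OF int1(2) test_function_partial[OF \<phi> dir_Basis(1)]]
    by (simp add: D_def A_def left_diff_distrib sum_subtractf)
  obtain Md where Md: "Md > 0" "\<And>z. D z \<le> Md"
  proof -
    have "compact (d ` closure V)"
      using continuous_on_subset[OF contd] clVW closure_subset compV by (intro compact_continuous_image) blast+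
    then obtain B where B: "B > 0" "\<And>y. y \<in> d ` closure V \<Longrightarrow> norm y \<le> B"
      using compact_imp_bounded bounded_pos by metis
    have "D z \<le> B" for z
      using B(1) B(2)[of "d z"] closure_subset[of V] by (auto simp: Dd)
    then show ?thesis using that B(1) by blast
  qed
  obtain e3 where e3: "e3 > 0" "(\<Union>x\<in>S. cball x e3) \<subseteq> V"
    using compact_subset_open_imp_cball_epsilon_subset[OF S openV SV] by blast
  \<comment> \<open>At times below T' a mollification of radius r \<le> T - T' never looks past
    T.\<close>
  define T' where "T' = (snd z0 + T) / 2"
  have T': "snd z0 < T'" "T' < T" using T by (auto simp: T'_def)
  define \<tau> where "\<tau> = (T' - snd z0) / 2"
  have \<tau>: "\<tau> > 0" "snd z0 + \<tau> = T' - \<tau>" using T' by (auto simp: \<tau>_def field_simps)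
  have "continuous (at z0) d"
    using contd z0 openW closure_subset[of W] by (meson continuous_on_eq_continuous_at continuous_on_subset)
  then obtain r4 where r4: "r4 > 0" "\<And>z. dist z z0 < r4 \<Longrightarrow> dist (d z) (d z0) < \<epsilon> / 2"
    using \<epsilon> unfolding continuous_at_eps_delta by (metis half_gt_zero)
  \<comment> \<open>Points within r of the ball of radius r0 about z0 stay within 2 r0 of z0, hence
    in \<open>V\<close> and where d is at least 3 \<epsilon> / 2; r0 \<le> \<tau> keeps T' - t at
    least \<tau> on that ball.\<close>
  define r0 where "r0 = Min {r4 / 2, e3 / 2, \<tau>}"
  have r0: "r0 > 0" "2 * r0 \<le> r4" "2 * r0 \<le> e3" "r0 \<le> \<tau>" using r4 e3 \<tau> by (auto simp: r0_def)
  \<comment> \<open>A lower bound for 2 / 3 times the integral of \<open>Y\<close>: on the ball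
    about z0 the two positive parts are at least \<epsilon> / 2 and \<tau>.\<close>
  define c0 where "c0 = (2 / 3) * ((\<epsilon> / 2) ^ 3 * \<tau> * measure lborel (ball z0 r0))"
  have c0: "c0 > 0" using \<epsilon> \<tau> content_ball_pos[OF r0(1), of z0] by (simp add: c0_def)
  define M where "M = 2 * Md * (T' - t1)\<^sup>2"
  have M: "M > 0" using Md T' tz0 by (simp add: M_def)
  \<comment> \<open>M bounds the weight \<open>m\<close>, so the errors of all components add up to
    at most c0 / 2.\<close>
  define e where "e = c0 / (2 * (M * CARD('n)))"
  have e: "e > 0" using c0 M by (simp add: e_def)
  have "\<exists>r>0. \<forall>k. mollifier r k \<longrightarrow> (\<integral>\<^sup>+z. ennreal \<bar>conv k (A i) z * conv k (B i) z - A i z * B i z\<bar> \<partial>lborel) \<le> ennreal e" for i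
    by (rule mollifier_L1_convergence[OF p q Aint Afin Bint Bfin e]) blast
  then have "\<exists>\<rho>. \<forall>i. \<rho> i > 0 \<and> (\<forall>k. mollifier (\<rho> i) k \<longrightarrow>
      (\<integral>\<^sup>+z. ennreal \<bar>conv k (A i) z * conv k (B i) z - A i z * B i z\<bar> \<partial>lborel) \<le> ennreal e)"
    by (intro choice allI)
  then obtain \<rho> where \<rho>: "\<And>i. \<rho> i > 0"
    "\<And>i k. mollifier (\<rho> i) k \<Longrightarrow> (\<integral>\<^sup>+z. ennreal \<bar>conv k (A i) z * conv k (B i) z - A i z * B i z\<bar> \<partial>lborel) \<le> ennreal e"
    by blast
  \<comment> \<open>One radius for all components: a mollifier of radius r is also one of radius
    \<open>\<rho> i\<close> for every i.\<close>
  define r where "r = Min (insert (T - T') (insert r0 (range \<rho>)))"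
  have r: "r > 0" "r \<le> r0" "r \<le> T - T'" using \<rho>(1) r0 T' by (auto simp: r_def)
  have r\<rho>: "r \<le> \<rho> i" for i unfolding r_def by (rule Min_le) auto
  obtain k :: "(real^'n) \<times> real \<Rightarrow> real" where k: "mollifier r k" using mollifier_exists[OF r(1)] by blast
  have S2: "z \<in> V" if "y \<in> S" "dist z y \<le> 2 * r" for y z
  proof -
    have "z \<in> cball y e3" using that r r0 by (simp add: dist_commute)
    then show ?thesis using e3(2) that(1) by blast
  qed
  \<comment> \<open>If the average exceeds \<epsilon>, then so does \<open>D\<close> at some point
    within r. That point lies in \<open>V\<close> at a time not beyond T, hence in
    \<open>S\<close>.\<close>
  have conc: "\<exists>y\<in>S. dist z y \<le> r" if z: "snd z < T'" "conv k D z > \<epsilon>" for z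
  proof (rule ccontr)
    assume neg: "\<not> (\<exists>y\<in>S. dist z y \<le> r)"
    have "conv k D z \<le> \<epsilon>"
    proof (rule conv_mollifier_le[OF k Dint])
      fix y assume y: "dist z y < r"
      show "D y \<le> \<epsilon>"
      proof (rule ccontr)
        assume "\<not> D y \<le> \<epsilon>"
        then have yV: "y \<in> V" "d y > \<epsilon>" using \<epsilon> by (auto simp: Dd split: if_splits)
        have "\<bar>snd y - snd z\<bar> \<le> dist y z" using dist_snd_le[of y z] by (simp add: dist_real_def)
        then have "snd y \<le> T" using y z(1) r(3) by (simp add: dist_commute)
        moreover have "y \<in> W" using yV(1) clVW closure_subset by blast
        ultimately have "y \<in> S"
          using yV(2) box_subset_cbox[of a b] by (auto simp: S_def W_def)
        then show False using neg y by force
      qed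
    qed
    then show False using z by simp
  qed
  define m where "m = (\<lambda>z. 2 * max 0 (conv k D z - \<epsilon>) * (max 0 (T' - snd z))\<^sup>2)"
  define Y where "Y = (\<lambda>z. max 0 (conv k D z - \<epsilon>) ^ 3 * max 0 (T' - snd z))"
  have energy: "(\<Sum>i\<in>UNIV. LBINT z. m z * (conv k (A i) z * conv k (B i) z)) = - (2 / 3) * (LBINT z. Y z)"
    and contm: "continuous_on UNIV m" and msupp: "\<And>z. m z \<noteq> 0 \<Longrightarrow> \<exists>y\<in>S. dist z y \<le> r"
    and Yint: "integrable lborel Y"
    unfolding m_def Y_def
    by (rule energy_identity[OF k r(1) Dint Aint Bint weak_grad weak_eq S S2 conc]; assumption)+
  have m0: "0 \<le> m z" for z by (simp add: m_def)
  have mM: "m z \<le> M" for z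
  proof (cases "m z = 0")
    case False
    then obtain y where y: "y \<in> S" "dist z y \<le> r" using msupp by blast
    then have "z \<in> V" using S2[of y z] r(1) by simp
    then have "s1 < snd z" by (auto simp: V_def)
    then have "max 0 (T' - snd z) \<le> T' - t1" using s1(1)[OF z0S] T' tz0 by auto
    moreover have "max 0 (conv k D z - \<epsilon>) \<le> Md"
      using conv_mollifier_le[OF k Dint, of z Md] Md \<epsilon> by auto
    ultimately show ?thesis unfolding m_def M_def using Md
      by (intro mult_mono power_mono) auto
  qed (use M in simp)
  have [measurable]: "m \<in> borel_measurable borel" by (rule borel_measurable_continuous_onI[OF contm])
  have ABint: "integrable lborel (\<lambda>z. A i z * B i z)" for i
    by (rule integrable_mult_Lp[OF p q]) (use Afin Bfin in auto)
  have mABint: "integrable lborel (\<lambda>z. m z * (A i z * B i z))" for i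
    by (rule integrable_bounded_mult[OF ABint, of _ M]) (use m0 mM in auto)
  have mkint: "integrable lborel (\<lambda>z. m z * (conv k (A i) z * conv k (B i) z))" for i
  proof (rule integrable_compact_support[OF _ compact_cball_neighbourhood[OF S, of r]])
    show "continuous_on UNIV (\<lambda>z. m z * (conv k (A i) z * conv k (B i) z))"
      by (intro continuous_intros contm conv_continuous[OF mollifierD(1)[OF k]] Aint Bint)
    show "m z * (conv k (A i) z * conv k (B i) z) = 0" if "z \<notin> {z. \<exists>y\<in>S. dist z y \<le> r}" for z
      using msupp[of z] that by (cases "m z = 0") simp_all
  qed
  \<comment> \<open>Monotonicity concerns the unmollified fields; the pairing of their
    mollifications has no sign in general.\<close>
  have "0 \<le> (LBINT z. (\<Sum>i\<in>UNIV. m z * (A i z * B i z)))"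
  proof (rule integral_nonneg_AE, rule AE_I2)
    fix z
    have "0 \<le> (p_flux p (\<Gamma>1 z) - p_flux p (\<Gamma>2 z)) \<bullet> (\<Gamma>1 z - \<Gamma>2 z)" by (rule p_flux_monotone[OF p])
    then have "0 \<le> (\<Sum>i\<in>UNIV. A i z * B i z)" by (simp add: inner_vec_def A_def B_def)
    then show "0 \<le> (\<Sum>i\<in>UNIV. m z * (A i z * B i z))" using m0 by (simp add: sum_distrib_left[symmetric])
  qed
  also have "\<dots> = (\<Sum>i\<in>UNIV. LBINT z. m z * (A i z * B i z))" using mABint by simp
  also have "\<dots> \<le> (\<Sum>i\<in>UNIV. (LBINT z. m z * (conv k (A i) z * conv k (B i) z)) + M * e)"
  proof (rule sum_mono)
    fix i :: 'n
    let ?E = "\<lambda>z. conv k (A i) z * conv k (B i) z - A i z * B i z"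
    have [measurable]: "conv k (A i) \<in> borel_measurable borel" "conv k (B i) \<in> borel_measurable borel"
      using conv_continuous[OF mollifierD(1)[OF k]] Aint Bint by (auto intro: borel_measurable_continuous_onI)
    have "integrable lborel (\<lambda>z. m z * ?E z)" using mkint mABint by (simp add: right_diff_distrib)
    then have "ennreal \<bar>LBINT z. m z * ?E z\<bar> \<le> (\<integral>\<^sup>+z. ennreal (norm (m z * ?E z)) \<partial>lborel)"
      unfolding real_norm_def[symmetric] by (rule integral_norm_bound_ennreal)
    also have "\<dots> \<le> (\<integral>\<^sup>+z. ennreal M * ennreal \<bar>?E z\<bar> \<partial>lborel)"
      using m0 mM M by (intro nn_integral_mono) (simp add: abs_mult ennreal_mult[symmetric] ennreal_leI mult_right_mono)
    also have "\<dots> = ennreal M * (\<integral>\<^sup>+z. ennreal \<bar>?E z\<bar> \<partial>lborel)" by (rule nn_integral_cmult) measurable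
    also have "\<dots> \<le> ennreal M * ennreal e"
      by (intro mult_left_mono \<rho>(2) mollifier_mono[OF k r\<rho>]) simp
    also have "\<dots> = ennreal (M * e)" using M e by (simp add: ennreal_mult)
    finally have "\<bar>LBINT z. m z * ?E z\<bar> \<le> M * e" using M e by simp
    then show "(LBINT z. m z * (A i z * B i z)) \<le> (LBINT z. m z * (conv k (A i) z * conv k (B i) z)) + M * e"
      using mkint[of i] mABint[of i] by (simp add: right_diff_distrib)
  qed
  also have "\<dots> = - (2 / 3) * (LBINT z. Y z) + c0 / 2"
    using M energy by (simp add: sum.distrib e_def)
  finally have Yc: "2 / 3 * (LBINT z. Y z) \<le> c0 / 2" by simp
  have "(LBINT z. (\<epsilon> / 2) ^ 3 * \<tau> * indicator (ball z0 r0) z) \<le> (LBINT z. Y z)"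
  proof (rule integral_mono[OF _ Yint])
    show "integrable lborel (\<lambda>z. (\<epsilon> / 2) ^ 3 * \<tau> * indicator (ball z0 r0) z)"
      by (intro integrable_mult_right integrable_real_indicator)
        (auto intro!: emeasure_bounded_finite[unfolded infinity_ennreal_def])
    fix z
    show "(\<epsilon> / 2) ^ 3 * \<tau> * indicator (ball z0 r0) z \<le> Y z"
    proof (cases "z \<in> ball z0 r0")
      case True
      have "3 / 2 * \<epsilon> \<le> conv k D z"
      proof (rule conv_mollifier_ge[OF k Dint])
        fix y assume "dist z y < r"
        then have y: "dist y z0 < 2 * r0" using True r(2) dist_triangle[of y z0 z] by (simp add: dist_commute)
        have "y \<in> cball z0 e3" using y r0 by (simp add: dist_commute)
        then have "y \<in> V" using e3(2) z0S by blast
        moreover have "\<bar>d y - d z0\<bar> < \<epsilon> / 2" using r4(2)[of y] y r0 by (simp add: dist_real_def)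
        then have "3 / 2 * \<epsilon> \<le> d y" unfolding \<epsilon>_def by linarith
        ultimately show "3 / 2 * \<epsilon> \<le> D y" by (simp add: Dd)
      qed
      then have "\<epsilon> / 2 \<le> max 0 (conv k D z - \<epsilon>)" by linarith
      moreover have "\<tau> \<le> max 0 (T' - snd z)"
      proof -
        have "\<bar>snd z - snd z0\<bar> \<le> dist z z0" using dist_snd_le[of z z0] by (simp add: dist_real_def)
        then have "\<tau> \<le> T' - snd z" using True r0(4) \<tau>(2) unfolding mem_ball dist_commute[of z0] by linarith
        then show ?thesis by simp
      qed
      ultimately have "(\<epsilon> / 2) ^ 3 * \<tau> \<le> Y z"
        unfolding Y_def using \<epsilon> \<tau>(1) by (intro mult_mono power_mono zero_le_power) linarith+
      then show ?thesis using True by simp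
    qed (simp add: Y_def)
  qed
  then have "c0 \<le> 2 / 3 * (LBINT z. Y z)"
    by (simp add: c0_def mult_ac)
  then show False using Yc c0 by simp
qed

subsection \<open>The fundamental p-harmonic profile\<close>

lemma continuous_on_extend_test:
  fixes F \<psi> :: "'a::euclidean_space \<Rightarrow> real"
  assumes "open U" "closed C" "C \<subseteq> U" "continuous_on U F" "continuous_on UNIV \<psi>" "\<And>x. x \<notin> C \<Longrightarrow> \<psi> x = 0"
  shows "continuous_on UNIV (\<lambda>x. indicator U x * (F x * \<psi> x))"
proof -
  let ?g = "\<lambda>x. indicator U x * (F x * \<psi> x)"
  have "continuous_on U (\<lambda>x. F x * \<psi> x)"
    by (intro continuous_intros assms continuous_on_subset[OF assms(5)]) auto
  then have "continuous_on U ?g" by (rule continuous_on_eq) auto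
  moreover have "continuous_on (- C) (\<lambda>x. 0::real)" by simp
  then have "continuous_on (- C) ?g" by (rule continuous_on_eq) (use assms(6) in auto)
  ultimately have "continuous_on (U \<union> - C) ?g"
    using assms(1,2) by (intro continuous_on_open_Un) auto
  moreover have "U \<union> - C = UNIV" using assms(3) by auto
  ultimately show ?thesis by simp
qed

text \<open>The support of \<phi> is compact in \<open>U\<close>, so f \<phi> extended by 0 is
  differentiable on the whole space, however f behaves near the boundary of
  \<open>U\<close>.\<close>

lemma integration_by_parts_test:
  fixes f :: "'a::euclidean_space \<Rightarrow> real"
  assumes U: "open U" and \<phi>: "test_function U \<phi>" and b: "b \<in> Basis"
    and df: "\<And>x. x \<in> U \<Longrightarrow> (f has_derivative f' x) (at x)" and contf': "continuous_on U (\<lambda>x. f' x b)"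
  shows "(LBINT x. indicator U x * (f x * frechet_derivative \<phi> (at x) b))
      = - (LBINT x. indicator U x * (f' x b * \<phi> x))"
    and "integrable lborel (\<lambda>x. indicator U x * (f x * frechet_derivative \<phi> (at x) b))"
    and "integrable lborel (\<lambda>x. indicator U x * (f' x b * \<phi> x))"
proof -
  define C where "C = closure {z. \<phi> z \<noteq> 0}"
  have C: "compact C" "closed C" "C \<subseteq> U" using test_functionD(2,3)[OF \<phi>] by (auto simp: C_def)
  have \<phi>0: "\<phi> x = 0" if "x \<notin> C" for x
    using that closure_subset[of "{z. \<phi> z \<noteq> 0}"] by (auto simp: C_def)
  have \<phi>'0: "frechet_derivative \<phi> (at x) v = 0" if "x \<notin> C" for x v
    using that frechet_derivative_eq_0_outside_support by (auto simp: C_def)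
  have contf: "continuous_on U f"
    using df has_derivative_continuous by (blast intro: continuous_at_imp_continuous_on)
  have c1: "continuous_on UNIV (\<lambda>x. indicator U x * (f x * frechet_derivative \<phi> (at x) b))"
    by (rule continuous_on_extend_test[OF U C(2,3) contf test_functionD(5)[OF \<phi> b] \<phi>'0])
  have c2: "continuous_on UNIV (\<lambda>x. indicator U x * (f' x b * \<phi> x))"
    by (rule continuous_on_extend_test[OF U C(2,3) contf' test_functionD(6)[OF \<phi>] \<phi>0])
  show i1: "integrable lborel (\<lambda>x. indicator U x * (f x * frechet_derivative \<phi> (at x) b))"
    by (rule integrable_compact_support[OF c1 C(1)]) (simp add: \<phi>'0)
  show i2: "integrable lborel (\<lambda>x. indicator U x * (f' x b * \<phi> x))"
    by (rule integrable_compact_support[OF c2 C(1)]) (simp add: \<phi>0)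
  let ?g = "\<lambda>x. indicator U x * (f x * \<phi> x)"
  let ?g' = "\<lambda>x v. indicator U x * (f x * frechet_derivative \<phi> (at x) v) + indicator U x * (f' x v * \<phi> x)"
  have "(LBINT x. ?g' x b) = 0"
  proof (rule integral_directional_derivative_eq_0[where g = ?g and g' = ?g', OF _ _ C(1)])
    fix x
    show "(?g has_derivative ?g' x) (at x)"
    proof (cases "x \<in> U")
      case True
      have "((\<lambda>x. f x * \<phi> x) has_derivative (\<lambda>v. f x * frechet_derivative \<phi> (at x) v + f' x v * \<phi> x)) (at x)"
        by (rule has_derivative_mult[OF df[OF True] test_functionD(4)[OF \<phi>]])
      then have "(?g has_derivative (\<lambda>v. f x * frechet_derivative \<phi> (at x) v + f' x v * \<phi> x)) (at x)"
        by (rule has_derivative_transform_within_open[OF _ U True]) simp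
      then show ?thesis using True by simp
    next
      case False
      then have x: "x \<in> - C" using C by auto
      have "((\<lambda>x. 0) has_derivative (\<lambda>v. 0)) (at x)" by simp
      then have "(?g has_derivative (\<lambda>v. 0)) (at x)"
        by (rule has_derivative_transform_within_open[OF _ _ x]) (use C \<phi>0 in auto)
      then show ?thesis using False by simp
    qed
    show "?g x = 0" if "x \<notin> C" using \<phi>0[OF that] by simp
  qed (intro continuous_on_add c1 c2)
  then show "(LBINT x. indicator U x * (f x * frechet_derivative \<phi> (at x) b))
      = - (LBINT x. indicator U x * (f' x b * \<phi> x))"
    using i1 i2 by simp
qed

lemma in_Lp_continuous:
  fixes f :: "'a::euclidean_space \<Rightarrow> 'b::euclidean_space"
  assumes U: "open U" "compact (closure U)" and f: "continuous_on (closure U) f" and q: "q > 0"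
  shows "in_Lp q U f"
proof -
  have "compact (f ` closure U)" by (rule compact_continuous_image[OF f U(2)])
  then obtain B where B: "B > 0" "\<And>x. x \<in> closure U \<Longrightarrow> norm (f x) \<le> B"
    using compact_imp_bounded bounded_pos by (metis imageI)
  have m: "(\<lambda>x. indicator U x *\<^sub>R f x) \<in> borel_measurable borel"
    using U f closure_subset by (intro borel_measurable_continuous_on_indicator) (auto intro: continuous_on_subset)
  have "integrable lborel (\<lambda>x. indicator U x *\<^sub>R (norm (f x) powr q))"
  proof (rule Bochner_Integration.integrable_bound[of _ "\<lambda>x. indicator U x * B powr q"])
    have "emeasure lborel U < \<infinity>"
      using bounded_subset[OF compact_imp_bounded[OF U(2)] closure_subset] by (rule emeasure_bounded_finite)
    then show "integrable lborel (\<lambda>x. indicator U x * B powr q)"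
      using U(1) by (intro integrable_mult_left integrable_real_indicator) auto
    have "(\<lambda>x. norm (indicator U x *\<^sub>R f x) powr q) \<in> borel_measurable borel" using m by measurable
    moreover have "(\<lambda>x. norm (indicator U x *\<^sub>R f x) powr q) = (\<lambda>x. indicator U x *\<^sub>R (norm (f x) powr q))"
      by (auto simp: indicator_def)
    ultimately show "(\<lambda>x. indicator U x *\<^sub>R (norm (f x) powr q)) \<in> borel_measurable lborel" by simp
    show "AE x in lborel. norm (indicator U x *\<^sub>R (norm (f x) powr q)) \<le> norm (indicator U x * B powr q)"
    proof (rule AE_I2)
      fix x
      have "norm (f x) powr q \<le> B powr q" if "x \<in> U"
        using B(2)[of x] that closure_subset[of U] q by (intro powr_mono2) auto
      then show "norm (indicator U x *\<^sub>R (norm (f x) powr q)) \<le> norm (indicator U x * B powr q)"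
        by (auto simp: indicator_def)
    qed
  qed
  then show ?thesis using m by (simp add: in_Lp_def set_borel_measurable_def set_integrable_def)
qed

text \<open>For \<alpha> = (p - n) / (p - 1) this is the fundamental solution of the p-Laplacian
  with pole \<open>y\<close>, up to constants. Sign and pole are kept free: the upper barrier has a
  positive \<open>K\<close> and pole 0, while the function touching from below is entered with
  \<open>- K'\<close> and another pole.\<close>

definition profile :: "real \<Rightarrow> real \<Rightarrow> real^'n \<Rightarrow> real \<Rightarrow> real^'n \<Rightarrow> real" where
  "profile c K y \<alpha> x = c + K * norm (x - y) powr \<alpha>"

definition profile_grad :: "real \<Rightarrow> real^'n \<Rightarrow> real \<Rightarrow> real^'n \<Rightarrow> real^'n" where
  "profile_grad K y \<alpha> x = (K * \<alpha> * norm (x - y) powr (\<alpha> - 2)) *\<^sub>R (x - y)"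

lemma norm_powr_has_derivative:
  fixes x y :: "'a::real_inner"
  assumes "x \<noteq> y"
  shows "((\<lambda>x. norm (x - y) powr s) has_derivative (\<lambda>v. s * norm (x - y) powr (s - 2) * ((x - y) \<bullet> v))) (at x)"
proof -
  have pos: "norm (x - y) > 0" using assms by simp
  have "((\<lambda>x. norm (x - y)) has_derivative (\<lambda>v. (sgn (x - y)) \<bullet> v)) (at x)"
  proof -
    have "((\<lambda>x. x - y) has_derivative (\<lambda>v. v)) (at x)" by (auto intro!: derivative_eq_intros)
    moreover have "x - y \<noteq> 0" using assms by simp
    ultimately have "((\<lambda>x. norm (x - y)) has_derivative (\<lambda>v. v \<bullet> sgn (x - y))) (at x)"
      by (rule has_derivative_compose[OF _ has_derivative_norm])
    then show ?thesis by (simp add: inner_commute)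
  qed
  from DERIV_compose_FDERIV[OF has_real_derivative_powr[OF pos] this]
  have "((\<lambda>x. norm (x - y) powr s) has_derivative (\<lambda>v. (sgn (x - y) \<bullet> v) * (s * norm (x - y) powr (s - 1)))) (at x)" .
  moreover have "(sgn (x - y) \<bullet> v) * (s * norm (x - y) powr (s - 1)) = s * norm (x - y) powr (s - 2) * ((x - y) \<bullet> v)" for v
  proof -
    have "norm (x - y) powr (s - 1) = norm (x - y) powr (s - 2) * norm (x - y)"
      using pos powr_add[of "norm (x - y)" "s - 2" 1] by simp
    moreover have "(sgn (x - y) \<bullet> v) * norm (x - y) = (x - y) \<bullet> v"
      using pos by (simp add: sgn_div_norm)
    ultimately show ?thesis by (metis mult.assoc mult.commute)
  qed
  ultimately show ?thesis by simp
qed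

lemma profile_has_derivative:
  assumes "x \<noteq> y"
  shows "(profile c K y \<alpha> has_derivative (\<lambda>v. profile_grad K y \<alpha> x \<bullet> v)) (at x)"
  unfolding profile_def profile_grad_def
  by (rule has_derivative_eq_rhs[OF has_derivative_add[OF has_derivative_const
        has_derivative_mult_right[OF norm_powr_has_derivative[OF assms]]]]) (auto simp: mult_ac)

text \<open>The exponent makes the flux a multiple of |x - y|^(-n) (x - y), the field of a point
  source, whatever p is. The factor |K \<alpha>|^(p-2) K \<alpha> keeps track of the sign of
  \<open>K\<close>.\<close>

lemma p_flux_profile_grad:
  fixes x y :: "real^'n" and p \<alpha> :: real
  assumes "p > 1" "x \<noteq> y" and \<alpha>: "\<alpha> = (p - real CARD('n)) / (p - 1)"
  shows "p_flux p (profile_grad K y \<alpha> x) = (\<bar>K * \<alpha>\<bar> powr (p - 2) * (K * \<alpha>)) *\<^sub>R (norm (x - y) powr (- real CARD('n)) *\<^sub>R (x - y))"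
proof -
  define N where "N = norm (x - y)"
  have N: "N > 0" using assms by (simp add: N_def)
  have "norm (profile_grad K y \<alpha> x) = \<bar>K * \<alpha>\<bar> * (N powr (\<alpha> - 2) * N)"
    by (simp add: profile_grad_def N_def abs_mult)
  also have "N powr (\<alpha> - 2) * N = N powr (\<alpha> - 1)"
    using N powr_add[of N "\<alpha> - 2" 1] by simp
  finally have n: "norm (profile_grad K y \<alpha> x) = \<bar>K * \<alpha>\<bar> * N powr (\<alpha> - 1)" .
  have "norm (profile_grad K y \<alpha> x) powr (p - 2) * (K * \<alpha> * N powr (\<alpha> - 2))
      = (\<bar>K * \<alpha>\<bar> powr (p - 2) * (K * \<alpha>)) * (N powr ((\<alpha> - 1) * (p - 2)) * N powr (\<alpha> - 2))"
    unfolding n using N by (simp add: powr_mult powr_powr mult_ac)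
  also have "N powr ((\<alpha> - 1) * (p - 2)) * N powr (\<alpha> - 2) = N powr (- real CARD('n))"
  proof -
    \<comment> \<open>The defining property of \<alpha>: the power |x - y|^(\<alpha> - 1), raised to
      p - 1, is |x - y|^(1 - n).\<close>
    have "(\<alpha> - 1) * (p - 1) = 1 - real CARD('n)" using \<open>p > 1\<close> by (simp add: \<alpha> field_simps)
    then have "(\<alpha> - 1) * (p - 2) + (\<alpha> - 2) = - real CARD('n)" by (simp add: algebra_simps)
    then show ?thesis by (simp add: powr_add[symmetric])
  qed
  finally have e: "norm (profile_grad K y \<alpha> x) powr (p - 2) * (K * \<alpha> * N powr (\<alpha> - 2))
      = (\<bar>K * \<alpha>\<bar> powr (p - 2) * (K * \<alpha>)) * N powr (- real CARD('n))" .
  have "p_flux p (profile_grad K y \<alpha> x)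
      = (norm (profile_grad K y \<alpha> x) powr (p - 2) * (K * \<alpha> * N powr (\<alpha> - 2))) *\<^sub>R (x - y)"
    unfolding p_flux_def by (subst (2) profile_grad_def) (simp add: N_def)
  then show ?thesis unfolding e by (simp add: N_def)
qed

text \<open>Off the pole, the divergence of |x|^(-n) x is n |x|^(-n) - n |x|^(-n-2) |x|^2 = 0; the
  rest is integration by parts in each coordinate.\<close>

lemma integral_divergence_free_flux:
  fixes y :: "real^'n"
  assumes U: "open U" "y \<notin> U" and \<phi>: "test_function U \<phi>"
  shows "(LBINT x. indicator U x * ((norm (x - y) powr (- real CARD('n)) *\<^sub>R (x - y)) \<bullet> grad \<phi> x)) = 0"
proof -
  let ?n = "real CARD('n)"
  let ?F = "\<lambda>i x. norm (x - y) powr (- ?n) * (x - y) $ i"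
  let ?F' = "\<lambda>i x v. norm (x - y) powr (- ?n) * v $ i
      + (- ?n * norm (x - y) powr (- ?n - 2) * ((x - y) \<bullet> v)) * (x - y) $ i"
  have dF: "(?F i has_derivative ?F' i x) (at x)" if "x \<in> U" for i x
  proof -
    have "((\<lambda>x. (x - y) $ i) has_derivative (\<lambda>v. v $ i)) (at x)"
      by (auto intro!: derivative_eq_intros bounded_linear.has_derivative[OF bounded_linear_vec_nth])
    moreover have "x \<noteq> y" using that U by auto
    ultimately show ?thesis using has_derivative_mult[OF norm_powr_has_derivative] by blast
  qed
  have cont: "continuous_on U (\<lambda>x. ?F' i x (axis i 1))" for i
    using U by (auto intro!: continuous_intros)
  have b: "axis i 1 \<in> (Basis :: (real^'n) set)" for i by (simp add: axis_in_Basis_iff)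
  note parts = integration_by_parts_test[OF U(1) \<phi> b dF cont]
  have div: "(\<Sum>i\<in>UNIV. ?F' i x (axis i 1)) = 0" if "x \<in> U" for x
  proof -
    have N: "norm (x - y) > 0" using that U by auto
    have "(\<Sum>i\<in>UNIV. ((x - y) $ i)\<^sup>2) = (norm (x - y))\<^sup>2"
      unfolding power2_norm_eq_inner inner_vec_def by (simp add: power2_eq_square)
    moreover have "norm (x - y) powr (- ?n - 2) * (norm (x - y))\<^sup>2 = norm (x - y) powr (- ?n)"
      using N powr_add[of "norm (x - y)" "- ?n - 2" 2] by simp
    moreover have "(\<Sum>i\<in>UNIV. ?F' i x (axis i 1)) = ?n * norm (x - y) powr (- ?n)
        - ?n * (norm (x - y) powr (- ?n - 2) * (\<Sum>i\<in>UNIV. ((x - y) $ i)\<^sup>2))"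
      by (simp add: inner_axis sum.distrib sum_distrib_left sum_negf power2_eq_square mult.assoc sum_subtractf)
    ultimately show ?thesis by simp
  qed
  have "(LBINT x. indicator U x * ((norm (x - y) powr (- ?n) *\<^sub>R (x - y)) \<bullet> grad \<phi> x))
      = (LBINT x. (\<Sum>i\<in>UNIV. indicator U x * (?F i x * frechet_derivative \<phi> (at x) (axis i 1))))"
    by (intro Bochner_Integration.integral_cong refl)
       (simp add: inner_vec_def grad_def sum_distrib_left mult_ac)
  also have "\<dots> = (\<Sum>i\<in>UNIV. LBINT x. indicator U x * (?F i x * frechet_derivative \<phi> (at x) (axis i 1)))"
    by (rule Bochner_Integration.integral_sum) (rule parts(2))
  also have "\<dots> = - (\<Sum>i\<in>UNIV. LBINT x. indicator U x * (?F' i x (axis i 1) * \<phi> x))"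
    unfolding sum_negf[symmetric] by (intro sum.cong refl parts(1))
  also have "(\<Sum>i\<in>UNIV. LBINT x. indicator U x * (?F' i x (axis i 1) * \<phi> x))
      = (LBINT x. (\<Sum>i\<in>UNIV. indicator U x * (?F' i x (axis i 1) * \<phi> x)))"
    by (rule Bochner_Integration.integral_sum[symmetric]) (rule parts(3))
  also have "\<dots> = (LBINT x. indicator U x * ((\<Sum>i\<in>UNIV. ?F' i x (axis i 1)) * \<phi> x))"
    by (simp only: sum_distrib_left sum_distrib_right)
  also have "\<dots> = (LBINT (x::real^'n). 0)"
    by (intro Bochner_Integration.integral_cong refl) (use div in \<open>auto simp: indicator_def\<close>)
  finally show ?thesis by simp
qed

lemma profile_p_parabolic:
  fixes y :: "real^'n" and p \<alpha> :: real
  assumes p: "p > 1" and \<alpha>: "\<alpha> = (p - real CARD('n)) / (p - 1)" and y: "y \<notin> Q"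
  shows "p_parabolic p (Q \<times> I) (\<lambda>z. profile c K y \<alpha> (fst z))"
proof -
  have contu: "continuous_on S (profile c K y \<alpha>)" if "y \<notin> S" for S
    unfolding profile_def using that by (auto intro!: continuous_intros)
  have contG: "continuous_on S (profile_grad K y \<alpha>)" if "y \<notin> S" for S
    unfolding profile_grad_def using that by (auto intro!: continuous_intros)
  have "weak_solution p (Q \<times> I) (\<lambda>z. ereal (profile c K y \<alpha> (fst z)))"
    unfolding weak_solution_def
  proof (intro allI impI, elim conjE)
    fix U :: "(real^'n) set" and t1 t2 :: real
    assume U: "open U" and t: "t1 < t2" and cc: "compactly_contained (U \<times> {t1<..<t2}) (Q \<times> I)"
    have cl: "closure (U \<times> {t1<..<t2}) = closure U \<times> {t1..t2}" using t by (simp add: closure_Times)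
    \<comment> \<open>The closed cylinder lies in Q \<times> I and Q excludes the pole, so even the
      closure of \<open>U\<close> avoids it; profile and gradient are continuous up to the boundary,
      which settles all integrability.\<close>
    have yU: "y \<notin> closure U"
    proof
      assume "y \<in> closure U"
      then have "(y, t1) \<in> closure U \<times> {t1..t2}" using t by simp
      then have "(y, t1) \<in> Q \<times> I" using cc unfolding compactly_contained_def cl by blast
      then show False using y by simp
    qed
    have compV: "compact (closure U \<times> {t1..t2})" using cc unfolding compactly_contained_def cl by simp
    have "compact (fst ` (closure U \<times> {t1..t2}))" by (intro compact_continuous_image continuous_intros compV)
    then have compU: "compact (closure U)" using t by simp
    have yV: "fst z \<noteq> y" if "z \<in> closure U \<times> {t1..t2}" for z using yU that by auto
    have c1: "continuous_on (closure (U \<times> {t1<..<t2})) (\<lambda>z. profile c K y \<alpha> (fst z))"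
      unfolding cl by (rule continuous_on_compose2[OF contu[OF yU]]) (auto intro!: continuous_intros)
    have c2: "continuous_on (closure (U \<times> {t1<..<t2})) (\<lambda>z. profile_grad K y \<alpha> (fst z))"
      unfolding cl by (rule continuous_on_compose2[OF contG[OF yU]]) (auto intro!: continuous_intros)
    have openV: "open (U \<times> {t1<..<t2})" using U by (simp add: open_Times)
    show "\<exists>v G. (AE z in lborel. z \<in> U \<times> {t1<..<t2} \<longrightarrow> ereal (profile c K y \<alpha> (fst z)) = ereal (v z)) \<and>
          in_C_L2 t1 t2 U v \<and> in_Lp_W1p p t1 t2 U v G \<and>
          (\<forall>\<phi>. test_function (U \<times> {t1<..<t2}) \<phi> \<longrightarrow>
             (LBINT t:{t1<..<t2}. LBINT x:U.
                (norm (G (x, t)) powr (p - 2) *\<^sub>R G (x, t)) \<bullet> grad (\<lambda>y. \<phi> (y, t)) x)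
             - (LBINT t:{t1<..<t2}. LBINT x:U. v (x, t) * deriv (\<lambda>s. \<phi> (x, s)) t)
             = 0)"
    proof (intro exI conjI allI impI)
      show "AE z in lborel. z \<in> U \<times> {t1<..<t2} \<longrightarrow> ereal (profile c K y \<alpha> (fst z)) = ereal (profile c K y \<alpha> (fst z))"
        by simp
      show "in_C_L2 t1 t2 U (\<lambda>z. profile c K y \<alpha> (fst z))"
        unfolding in_C_L2_def using in_Lp_continuous[OF U compU contu[OF yU], of 2] by simp
      show "in_Lp_W1p p t1 t2 U (\<lambda>z. profile c K y \<alpha> (fst z)) (\<lambda>z. profile_grad K y \<alpha> (fst z))"
        unfolding in_Lp_W1p_def
      proof (intro conjI AE_I2 impI)
        show "in_Lp p (U \<times> {t1<..<t2}) (\<lambda>z. profile c K y \<alpha> (fst z))"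
          "in_Lp p (U \<times> {t1<..<t2}) (\<lambda>z. profile_grad K y \<alpha> (fst z))"
          using p compV cl by (auto intro!: in_Lp_continuous openV c1 c2)
        fix t
        show "in_W1p p U (\<lambda>x. profile c K y \<alpha> (fst (x, t))) (\<lambda>x. profile_grad K y \<alpha> (fst (x, t)))"
          unfolding in_W1p_def fst_conv
        proof (intro conjI allI impI)
          show "in_Lp p U (profile c K y \<alpha>)" "in_Lp p U (profile_grad K y \<alpha>)"
            using p by (auto intro!: in_Lp_continuous[OF U compU] contu contG yU)
          fix \<phi> :: "real^'n \<Rightarrow> real" and i assume \<phi>: "test_function U \<phi>"
          have yU': "x \<noteq> y" if "x \<in> U" for x using yU that closure_subset by blast
          have c: "continuous_on U (\<lambda>x. profile_grad K y \<alpha> x \<bullet> axis i 1)"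
            using contG[of U] yU' by (intro continuous_intros) auto
          have "axis i 1 \<in> (Basis :: (real^'n) set)" by (simp add: axis_in_Basis_iff)
          from integration_by_parts_test(1)[OF U \<phi> this profile_has_derivative[OF yU'] c]
          show "(LBINT x:U. profile c K y \<alpha> x * grad \<phi> x $ i) = - (LBINT x:U. profile_grad K y \<alpha> x $ i * \<phi> x)"
            by (simp add: set_lebesgue_integral_def grad_def inner_axis)
        qed
      qed
      fix \<phi> :: "(real^'n) \<times> real \<Rightarrow> real" assume \<phi>: "test_function (U \<times> {t1<..<t2}) \<phi>"
      let ?\<kappa> = "\<bar>K * \<alpha>\<bar> powr (p - 2) * (K * \<alpha>)"
      have "(LBINT x:U. (norm (profile_grad K y \<alpha> x) powr (p - 2) *\<^sub>R profile_grad K y \<alpha> x) \<bullet> grad (\<lambda>y. \<phi> (y, t)) x) = 0" for t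
      proof -
        have yU': "y \<notin> U" using yU closure_subset by blast
        have "(LBINT x:U. (norm (profile_grad K y \<alpha> x) powr (p - 2) *\<^sub>R profile_grad K y \<alpha> x) \<bullet> grad (\<lambda>y. \<phi> (y, t)) x)
          = (LBINT x. ?\<kappa> * (indicator U x * ((norm (x - y) powr (- real CARD('n)) *\<^sub>R (x - y)) \<bullet> grad (\<lambda>y. \<phi> (y, t)) x)))"
          unfolding set_lebesgue_integral_def
        proof (intro Bochner_Integration.integral_cong refl)
          fix x
          show "indicator U x *\<^sub>R ((norm (profile_grad K y \<alpha> x) powr (p - 2) *\<^sub>R profile_grad K y \<alpha> x) \<bullet> grad (\<lambda>y. \<phi> (y, t)) x)
            = ?\<kappa> * (indicator U x * ((norm (x - y) powr (- real CARD('n)) *\<^sub>R (x - y)) \<bullet> grad (\<lambda>y. \<phi> (y, t)) x))"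
          proof (cases "x \<in> U")
            case True
            then have "x \<noteq> y" using yU' by auto
            then show ?thesis
              using p_flux_profile_grad[OF p _ \<alpha>, of x y K] True unfolding p_flux_def by simp
          qed simp
        qed
        also have "\<dots> = 0"
          using integral_divergence_free_flux[OF U yU' test_function_slice[OF \<phi>]] by simp
        finally show ?thesis .
      qed
      \<comment> \<open>Integration by parts in time leaves the derivative of a stationary function
        in direction (0, 1), which is 0.\<close>
      moreover have "(LBINT t:{t1<..<t2}. LBINT x:U. profile c K y \<alpha> x * deriv (\<lambda>s. \<phi> (x, s)) t) = 0"
      proof -
        let ?f = "\<lambda>z. profile c K y \<alpha> (fst z)"
        have d: "(?f has_derivative (\<lambda>v. profile_grad K y \<alpha> (fst z) \<bullet> fst v)) (at z)"
          if "z \<in> U \<times> {t1<..<t2}" for z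
        proof -
          have "fst z \<noteq> y" using yU closure_subset[of U] that by auto
          then show ?thesis
            by (intro has_derivative_compose[OF _ profile_has_derivative]) (auto intro!: derivative_eq_intros)
        qed
        have "continuous_on (U \<times> {t1<..<t2}) (\<lambda>z. profile_grad K y \<alpha> (fst z) \<bullet> fst (0::real^'n, 1::real))" by simp
        note parts = integration_by_parts_test[OF openV \<phi> dir_Basis(2) d this]
        have "(LBINT t:{t1<..<t2}. LBINT x:U. profile c K y \<alpha> x * deriv (\<lambda>s. \<phi> (x, s)) t)
          = (LBINT t. LBINT x. indicator (U \<times> {t1<..<t2}) (x, t) * (?f (x, t) * frechet_derivative \<phi> (at (x, t)) (0, 1)))"
          unfolding set_lebesgue_integral_def
        proof (intro Bochner_Integration.integral_cong refl)
          fix t :: real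
          show "indicator {t1<..<t2} t *\<^sub>R (LBINT x. indicator U x *\<^sub>R (profile c K y \<alpha> x * deriv (\<lambda>s. \<phi> (x, s)) t))
            = (LBINT x. indicator (U \<times> {t1<..<t2}) (x, t) * (?f (x, t) * frechet_derivative \<phi> (at (x, t)) (0, 1)))"
            by (cases "t \<in> {t1<..<t2}") (auto simp: deriv_slice(2)[OF \<phi>] indicator_times)
        qed
        also have "\<dots> = (LBINT z. indicator (U \<times> {t1<..<t2}) z * (?f z * frechet_derivative \<phi> (at z) (0, 1)))"
          by (rule integral_lborel_snd[symmetric]) (rule parts(2))
        also have "\<dots> = 0" using parts(1) by simp
        finally show ?thesis .
      qed
      ultimately show "(LBINT t:{t1<..<t2}. LBINT x:U.
                (norm (profile_grad K y \<alpha> (fst (x, t))) powr (p - 2) *\<^sub>R profile_grad K y \<alpha> (fst (x, t))) \<bullet> grad (\<lambda>y. \<phi> (y, t)) x)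
             - (LBINT t:{t1<..<t2}. LBINT x:U. profile c K y \<alpha> (fst (x, t)) * deriv (\<lambda>s. \<phi> (x, s)) t)
             = 0"
        by simp
    qed
  qed
  moreover have "continuous_on (Q \<times> I) (\<lambda>z. profile c K y \<alpha> (fst z))"
    by (rule continuous_on_compose2[OF contu[OF y]]) (auto intro!: continuous_intros)
  ultimately show ?thesis by (simp add: p_parabolic_def)
qed

subsection \<open>Barriers\<close>

lemma continuous_on_profile: "\<alpha> > 0 \<Longrightarrow> continuous_on S (profile c K y \<alpha>)"
  unfolding profile_def by (auto intro!: continuous_intros continuous_on_powr')

text \<open>Every box compactly contained in \<Theta> misses the pole, so the profile is p-parabolic
  there and the comparison principle applies, for either sign of \<open>K\<close>. Positive \<alpha>
  makes the profile finite and continuous everywhere.\<close>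

lemma profile_superparabolic:
  fixes y :: "real^'n" and p \<alpha> :: real
  assumes p: "p > 1" and \<alpha>: "\<alpha> = (p - real CARD('n)) / (p - 1)" "\<alpha> > 0" and y: "y \<notin> fst ` \<Theta>"
  shows "superparabolic p \<Theta> (\<lambda>z. ereal (profile c K y \<alpha> (fst z)))"
proof -
  have cont: "continuous_on S (\<lambda>z. profile c K y \<alpha> (fst z))" for S :: "((real^'n) \<times> real) set"
    by (rule continuous_on_compose2[OF continuous_on_profile[OF \<alpha>(2)]]) (auto intro!: continuous_intros)
  have "openin (top_of_set \<Theta>) {z \<in> \<Theta>. C < ereal (profile c K y \<alpha> (fst z))}" for C
    using continuous_openin_preimage_gen[OF continuous_on_ereal[OF cont] open_greaterThan, of \<Theta> C]
    by (simp add: vimage_def Int_def)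
  moreover have cmp: "ereal (h z) \<le> ereal (profile c K y \<alpha> (fst z))"
    if ne: "box a b \<noteq> {}" "t1 < t2" and cc: "compactly_contained (box a b \<times> {t1<..<t2}) \<Theta>"
      and h: "p_parabolic p (box a b \<times> {t1<..<t2}) h" "continuous_on (closure (box a b \<times> {t1<..<t2})) h"
      and le: "\<forall>z\<in>parabolic_boundary (box a b) t1 t2. ereal (h z) \<le> ereal (profile c K y \<alpha> (fst z))"
      and z: "z \<in> box a b \<times> {t1<..<t2}" for a b t1 t2 h z
  proof -
    have "y \<notin> box a b"
    proof
      assume "y \<in> box a b"
      then have "(y, (t1 + t2) / 2) \<in> box a b \<times> {t1<..<t2}" using ne by simp
      then have "(y, (t1 + t2) / 2) \<in> \<Theta>"
        using cc closure_subset[of "box a b \<times> {t1<..<t2}"] unfolding compactly_contained_def by blast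
      then show False using y by force
    qed
    from p_parabolic_comparison[OF p ne h profile_p_parabolic[OF p \<alpha>(1) this] cont _ z] le
    show ?thesis by simp
  qed
  ultimately show ?thesis
    unfolding superparabolic_def
  proof (intro conjI allI impI ballI)
    fix a b :: "real^'n" and t1 t2 h z
    assume "box a b \<noteq> {} \<and> t1 < t2 \<and> compactly_contained (box a b \<times> {t1<..<t2}) \<Theta> \<and>
        p_parabolic p (box a b \<times> {t1<..<t2}) h \<and> continuous_on (closure (box a b \<times> {t1<..<t2})) h \<and>
        (\<forall>z\<in>parabolic_boundary (box a b) t1 t2. ereal (h z) \<le> ereal (profile c K y \<alpha> (fst z)))"
      and "z \<in> box a b \<times> {t1<..<t2}"
    then show "ereal (h z) \<le> ereal (profile c K y \<alpha> (fst z))" by (elim conjE) (rule cmp)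
  next
    show "\<Theta> \<subseteq> closure {z \<in> \<Theta>. \<bar>ereal (profile c K y \<alpha> (fst z))\<bar> \<noteq> \<infinity>}"
      using closure_subset[of \<Theta>] by simp
  qed simp
qed

text \<open>
  \<open>K'\<close> matches the derivatives at \<open>r\<close>. The shifted power is then less concave than \<open>a\<^sup>\<beta>\<close>, because
  \<open>\<beta> < \<alpha>\<close> and \<open>\<sigma>\<close> is small.
\<close>

lemma shifted_power_touches:
  fixes \<alpha> \<beta> K r :: real
  assumes ab: "0 < \<beta>" "\<beta> < \<alpha>" "\<alpha> \<le> 1" and K: "K > 0" and r: "r > 0"
  defines "\<sigma> \<equiv> (\<alpha> - \<beta>) / 2 * r"
  obtains K' where "K' > 0" "\<And>a. a > r / 2 \<Longrightarrow> a \<noteq> r \<Longrightarrow>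
    K * (a powr \<beta> - r powr \<beta>) < K' * ((a - \<sigma>) powr \<alpha> - (r - \<sigma>) powr \<alpha>)"
proof -
  have "(\<alpha> - \<beta>) / 2 * r < 1 / 2 * r" using ab r by (intro mult_strict_right_mono) auto
  then have \<sigma>: "0 < \<sigma>" "\<sigma> < r / 2" using ab r by (auto simp: \<sigma>_def)
  define K' where "K' = K * \<beta> * r powr (\<beta> - 1) / (\<alpha> * (r - \<sigma>) powr (\<alpha> - 1))"
  have K': "K' > 0" using K ab r \<sigma> by (simp add: K'_def)
  \<comment> \<open>Up to a constant, the logarithm of the ratio of the two derivatives, K' \<alpha>
    (a - \<sigma>)^(\<alpha> - 1) over K \<beta> a^(\<beta> - 1). Since it increases strictly, the
    derivative of the difference \<open>F\<close> changes sign exactly at r, from minus to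
    plus.\<close>
  define E where "E = (\<lambda>a. (\<alpha> - 1) * ln (a - \<sigma>) + (1 - \<beta>) * ln a)"
  have E_mono: "E a < E b" if "r / 2 < a" "a < b" for a b
  proof (rule DERIV_pos_imp_increasing[OF that(2)])
    fix x assume x: "a \<le> x" "x \<le> b"
    have xp: "x > 0" "x - \<sigma> > 0" using x that \<sigma> r by auto
    have "(E has_real_derivative (\<alpha> - 1) / (x - \<sigma>) + (1 - \<beta>) / x) (at x)"
      unfolding E_def using xp by (auto intro!: derivative_eq_intros simp: divide_inverse)
    moreover have "(\<alpha> - 1) / (x - \<sigma>) + (1 - \<beta>) / x > 0"
    proof -
      \<comment> \<open>Here x > r / 2 enters: (\<alpha> - \<beta>) x > (\<alpha> - \<beta>) r / 2 =
        \<sigma>, which is the reason for this value of \<sigma>.\<close>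
      have "(1 - \<beta>) * \<sigma> \<le> 1 * \<sigma>" using ab \<sigma> by (intro mult_right_mono) auto
      also have "1 * \<sigma> < (\<alpha> - \<beta>) * x"
        using ab x that by (simp add: \<sigma>_def mult.commute)
      finally have "(\<alpha> - 1) * x + (1 - \<beta>) * (x - \<sigma>) > 0" by (simp add: algebra_simps)
      then have "((\<alpha> - 1) * x + (1 - \<beta>) * (x - \<sigma>)) / ((x - \<sigma>) * x) > 0" using xp by simp
      then show ?thesis using xp by (simp add: add_frac_eq)
    qed
    ultimately show "\<exists>y. (E has_real_derivative y) (at x) \<and> 0 < y" by blast
  qed
  define F where "F = (\<lambda>a. K' * (a - \<sigma>) powr \<alpha> - K * a powr \<beta>)"
  have dF: "(F has_real_derivative K * \<beta> * a powr (\<beta> - 1) * (exp (E a - E r) - 1)) (at a)" if "a > r / 2" for a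
  proof -
    have ap: "a > 0" "a - \<sigma> > 0" using that \<sigma> r by auto
    have d1: "((\<lambda>a. (a - \<sigma>) powr \<alpha>) has_real_derivative \<alpha> * (a - \<sigma>) powr (\<alpha> - 1)) (at a)"
    proof -
      have "((\<lambda>a. a - \<sigma>) has_real_derivative 1) (at a)" by (auto intro!: derivative_eq_intros)
      from DERIV_chain2[where f = "\<lambda>z. z powr \<alpha>" and g = "\<lambda>a. a - \<sigma>", OF has_real_derivative_powr[OF ap(2)] this]
      show ?thesis by simp
    qed
    have d: "(F has_real_derivative K' * (\<alpha> * (a - \<sigma>) powr (\<alpha> - 1)) - K * (\<beta> * a powr (\<beta> - 1))) (at a)"
      unfolding F_def by (intro DERIV_diff DERIV_cmult d1 has_real_derivative_powr ap)
    have rp: "r - \<sigma> > 0" using \<sigma> r by simp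
    have "exp (E a - E r) = (a - \<sigma>) powr (\<alpha> - 1) * a powr (1 - \<beta>) / ((r - \<sigma>) powr (\<alpha> - 1) * r powr (1 - \<beta>))"
      unfolding E_def exp_diff exp_add using ap rp r by (simp add: powr_def)
    then have "K * \<beta> * a powr (\<beta> - 1) * exp (E a - E r)
        = K * \<beta> * (a - \<sigma>) powr (\<alpha> - 1) * (a powr (\<beta> - 1) * a powr (1 - \<beta>)) / ((r - \<sigma>) powr (\<alpha> - 1) * r powr (1 - \<beta>))"
      by simp
    also have "a powr (\<beta> - 1) * a powr (1 - \<beta>) = 1" using ap by (simp add: powr_add[symmetric])
    also have "K * \<beta> * (a - \<sigma>) powr (\<alpha> - 1) * 1 / ((r - \<sigma>) powr (\<alpha> - 1) * r powr (1 - \<beta>))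
        = K * \<beta> * (a - \<sigma>) powr (\<alpha> - 1) * r powr (\<beta> - 1) / (r - \<sigma>) powr (\<alpha> - 1)"
      using powr_minus_divide[of r "1 - \<beta>"] by simp
    also have "\<dots> = K' * (\<alpha> * (a - \<sigma>) powr (\<alpha> - 1))"
      using ab rp by (simp add: K'_def field_simps)
    finally have "K' * (\<alpha> * (a - \<sigma>) powr (\<alpha> - 1)) - K * (\<beta> * a powr (\<beta> - 1))
        = K * \<beta> * a powr (\<beta> - 1) * (exp (E a - E r) - 1)" by (simp add: algebra_simps)
    with d show ?thesis by simp
  qed
  have contF: "continuous_on {a..b} F" if "a > r / 2" for a b
  proof (intro continuous_at_imp_continuous_on ballI)
    fix x assume "x \<in> {a..b}"
    then show "isCont F x" using that by (intro DERIV_isCont[OF dF]) auto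
  qed
  have "F r < F a" if "a > r / 2" "a \<noteq> r" for a
  proof (cases "a < r")
    case True
    show ?thesis
    proof (rule DERIV_neg_imp_decreasing_open[OF True _ contF[OF that(1)]])
      fix x assume x: "a < x" "x < r"
      then have "E x < E r" "x > 0" using E_mono[of x r] that r by auto
      then have "K * \<beta> * x powr (\<beta> - 1) * (exp (E x - E r) - 1) < 0"
        using K ab by (intro mult_pos_neg) auto
      then show "\<exists>y. (F has_real_derivative y) (at x) \<and> y < 0" using dF[of x] x that by auto
    qed
  next
    case False
    then have ra: "r < a" using that by simp
    show ?thesis
    proof (rule DERIV_pos_imp_increasing_open[OF ra _ contF])
      fix x assume x: "r < x" "x < a"
      then have "E r < E x" "x > 0" using E_mono[of r x] r by auto
      then have "K * \<beta> * x powr (\<beta> - 1) * (exp (E x - E r) - 1) > 0"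
        using K ab by (intro mult_pos_pos) auto
      then show "\<exists>y. (F has_real_derivative y) (at x) \<and> y > 0" using dF[of x] x r by auto
    qed (use r in simp)
  qed
  then show ?thesis using that[OF K'] by (simp add: F_def algebra_simps)
qed

text \<open>With y on the segment from 0 to x0, |x - y| \<ge> |x| - |y| holds with equality at x0,
  so the scalar inequality for a = |x| gives strictness off the sphere |x| = |x0|. On that sphere x0
  is the only point closest to y, which gives strictness there.\<close>

lemma profile_touches:
  fixes x0 :: "'a::real_inner" and \<alpha> \<beta> K :: real
  assumes ab: "0 < \<beta>" "\<beta> < \<alpha>" "\<alpha> \<le> 1" and K: "K > 0" and x0: "x0 \<noteq> 0"
  obtains y K' where "norm y < norm x0 / 2"
    "\<And>x. norm x > norm x0 / 2 \<Longrightarrow> x \<noteq> x0 \<Longrightarrow>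
      K * (norm x powr \<beta> - norm x0 powr \<beta>) < K' * (norm (x - y) powr \<alpha> - norm (x0 - y) powr \<alpha>)"
proof -
  define s where "s = (\<alpha> - \<beta>) / 2"
  have s: "0 < s" "s < 1 / 2" using ab by (auto simp: s_def)
  define y where "y = s *\<^sub>R x0"
  have nx0: "norm x0 > 0" using x0 by simp
  have ny: "norm y = s * norm x0" using s by (simp add: y_def)
  have nxy: "norm (x0 - y) = norm x0 - s * norm x0"
  proof -
    have "x0 - y = (1 - s) *\<^sub>R x0" by (simp add: y_def algebra_simps)
    then have "norm (x0 - y) = (1 - s) * norm x0" using s by simp
    then show ?thesis by (simp add: left_diff_distrib)
  qed
  obtain K' where K': "K' > 0" "\<And>a. a > norm x0 / 2 \<Longrightarrow> a \<noteq> norm x0 \<Longrightarrow>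
    K * (a powr \<beta> - norm x0 powr \<beta>) < K' * ((a - s * norm x0) powr \<alpha> - (norm x0 - s * norm x0) powr \<alpha>)"
    using shifted_power_touches[OF ab K nx0] unfolding s_def by metis
  show ?thesis
  proof (rule that[of y K'])
    have "s * norm x0 < 1 / 2 * norm x0" using s nx0 by (intro mult_strict_right_mono)
    then show half: "norm y < norm x0 / 2" by (simp add: ny)
    fix x assume x: "norm x > norm x0 / 2" "x \<noteq> x0"
    show "K * (norm x powr \<beta> - norm x0 powr \<beta>) < K' * (norm (x - y) powr \<alpha> - norm (x0 - y) powr \<alpha>)"
    proof (cases "norm x = norm x0")
      case False
      have "norm x - s * norm x0 \<le> norm (x - y)" using norm_triangle_ineq2[of x y] ny by simp
      then have "(norm x - s * norm x0) powr \<alpha> \<le> norm (x - y) powr \<alpha>"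
        using x half ny ab by (intro powr_mono2) auto
      then have "K' * ((norm x - s * norm x0) powr \<alpha> - (norm x0 - s * norm x0) powr \<alpha>)
          \<le> K' * (norm (x - y) powr \<alpha> - norm (x0 - y) powr \<alpha>)"
        using K'(1) by (intro mult_left_mono) (auto simp: nxy)
      then show ?thesis using K'(2)[OF x(1) False] by linarith
    next
      case True
      have "0 < (norm (x - x0))\<^sup>2" using x(2) by simp
      also have "\<dots> = 2 * (norm x0)\<^sup>2 - 2 * (x \<bullet> x0)"
        unfolding dot_norm_neg[of x x0] True by (simp add: field_simps)
      finally have "s * (x \<bullet> x0) < s * (norm x0)\<^sup>2" using s by (intro mult_strict_left_mono) auto
      moreover have "(norm (x - y))\<^sup>2 = (norm x0)\<^sup>2 - 2 * (s * (x \<bullet> x0)) + s\<^sup>2 * (norm x0)\<^sup>2"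
      proof -
        have "s * (x \<bullet> x0) = x \<bullet> y" by (simp add: y_def)
        then show ?thesis unfolding dot_norm_neg[of x y] True ny by (simp add: power_mult_distrib field_simps)
      qed
      ultimately have "(norm x0 - s * norm x0)\<^sup>2 < (norm (x - y))\<^sup>2"
        by (simp add: power2_eq_square algebra_simps)
      then have "norm (x0 - y) < norm (x - y)" unfolding nxy by (rule power2_less_imp_less) simp
      then have "norm (x0 - y) powr \<alpha> < norm (x - y) powr \<alpha>" using ab by (intro powr_less_mono2) auto
      then show ?thesis using K'(1) True by simp
    qed
  qed
qed

text \<open>If there were no minimum, the open sets on which u - v exceeds its value at some c in
  \<open>L\<close> would cover \<open>L\<close>. In a finite subcover, the c with the least value is
  not covered.\<close>

lemma lsc_attains_min:
  fixes u :: "'a::euclidean_space \<Rightarrow> ereal" and v :: "'a \<Rightarrow> real"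
  assumes "compact L" "L \<noteq> {}" and lsc: "\<And>q::real. open {\<eta> \<in> \<Theta>. ereal (q + v \<eta>) < u \<eta>}" and "L \<subseteq> \<Theta>"
    and fin: "\<And>\<eta>. \<eta> \<in> L \<Longrightarrow> \<bar>u \<eta>\<bar> \<noteq> \<infinity>"
  obtains z0 where "z0 \<in> L" "\<And>\<eta>. \<eta> \<in> L \<Longrightarrow> real_of_ereal (u z0) - v z0 \<le> real_of_ereal (u \<eta>) - v \<eta>"
proof -
  define g where "g = (\<lambda>\<eta>. real_of_ereal (u \<eta>) - v \<eta>)"
  define O' where "O' = (\<lambda>c. {\<eta> \<in> \<Theta>. ereal (g c + v \<eta>) < u \<eta>})"
  have O': "\<eta> \<in> O' c \<longleftrightarrow> g c < g \<eta>" if "\<eta> \<in> L" for \<eta> c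
  proof -
    have "u \<eta> = ereal (g \<eta> + v \<eta>)" using fin[OF that] by (simp add: g_def ereal_real)
    then show ?thesis using that assms(4) by (auto simp: O'_def)
  qed
  have "\<exists>z0\<in>L. \<forall>\<eta>\<in>L. g z0 \<le> g \<eta>"
  proof (rule ccontr)
    assume "\<not> ?thesis"
    then have "\<forall>\<eta>\<in>L. \<exists>c\<in>L. g c < g \<eta>" by (meson not_less)
    then have "L \<subseteq> (\<Union>c\<in>L. O' c)" using O' by blast
    moreover have "open (O' c)" for c unfolding O'_def by (rule lsc)
    ultimately obtain C where C: "C \<subseteq> L" "finite C" "L \<subseteq> (\<Union>c\<in>C. O' c)"
      using compactE_image[OF assms(1), of L O'] by metis
    then have "C \<noteq> {}" using assms(2) by auto
    define c where "c = arg_min_on g C"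
    have c: "c \<in> C" "\<And>c'. c' \<in> C \<Longrightarrow> g c \<le> g c'"
      unfolding c_def using arg_min_if_finite(1)[OF C(2) \<open>C \<noteq> {}\<close>] arg_min_least[OF C(2) \<open>C \<noteq> {}\<close>] by blast+
    then obtain c' where "c' \<in> C" "c \<in> O' c'" using C by blast
    then have "g c' < g c" using O'[of c c'] C(1) c(1) by blast
    then show False using c(2)[OF \<open>c' \<in> C\<close>] by simp
  qed
  then show ?thesis using that unfolding g_def by blast
qed

text \<open>Subtraction of extended reals is avoided by a real m between q + v and u, which splits
  the condition into an open one on u and an open one on v.\<close>

lemma lsc_minus_continuous:
  fixes u :: "'a::euclidean_space \<Rightarrow> ereal" and v :: "'a \<Rightarrow> real"
  assumes "open \<Theta>" and lsc: "\<And>c. openin (top_of_set \<Theta>) {z \<in> \<Theta>. c < u z}" and v: "continuous_on UNIV v"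
  shows "open {\<eta> \<in> \<Theta>. ereal (q + v \<eta>) < u \<eta>}"
proof -
  have "{\<eta> \<in> \<Theta>. ereal (q + v \<eta>) < u \<eta>} = (\<Union>m::real. {z \<in> \<Theta>. ereal m < u z} \<inter> {\<eta>. q + v \<eta> < m})"
    (is "?A = ?B")
  proof (intro equalityI subsetI)
    fix \<eta> assume \<eta>: "\<eta> \<in> ?A"
    then obtain m where "ereal (q + v \<eta>) < ereal m" "ereal m < u \<eta>" using ereal_dense2 by blast
    then show "\<eta> \<in> ?B" using \<eta> by auto
  next
    fix \<eta> assume "\<eta> \<in> ?B"
    then obtain m where m: "\<eta> \<in> \<Theta>" "ereal m < u \<eta>" "q + v \<eta> < m" by blast
    then have "ereal (q + v \<eta>) < u \<eta>" by (meson ereal_less(3) less_ereal.simps(1) less_trans)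
    then show "\<eta> \<in> ?A" using m by simp
  qed
  moreover have "open ({z \<in> \<Theta>. ereal m < u z} \<inter> {\<eta>. q + v \<eta> < m})" for m
  proof (rule open_Int)
    show "open {z \<in> \<Theta>. ereal m < u z}" using lsc openin_open_trans assms(1) by blast
    show "open {\<eta>. q + v \<eta> < m}" using v by (intro open_Collect_less continuous_intros)
  qed
  ultimately show ?thesis by auto
qed

text \<open>The boundary condition confines the points where u lies well below v to a compact subset
  of \<Theta>, so u - v has a negative minimum g0, attained at some z0. On a small box about z0 a
  p-parabolic h is at most v + g0 \<le> u on the parabolic boundary, but larger than u = v + g0 at
  z0 itself.\<close>

lemma superparabolic_ge_barrier:
  fixes \<Theta> :: "((real^'n) \<times> real) set" and p \<alpha> \<beta> c K \<delta> :: real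
  assumes p: "p > 1" and \<alpha>: "\<alpha> = (p - real CARD('n)) / (p - 1)" and ab: "0 < \<beta>" "\<beta> < \<alpha>" "\<alpha> \<le> 1"
    and \<Theta>: "open \<Theta>" "bounded \<Theta>" "0 \<notin> fst ` \<Theta>" and K: "K > 0" and \<delta>: "\<delta> > 0"
    and u: "superparabolic p \<Theta> u"
  defines "v \<equiv> \<lambda>z. c - K * norm (fst z) powr \<beta> - \<delta> * snd z"
  assumes bd: "\<And>\<xi>. \<xi> \<in> frontier \<Theta> \<Longrightarrow> ereal (v \<xi>) \<le> Liminf (at \<xi> within \<Theta>) u"
    and z: "z \<in> \<Theta>"
  shows "ereal (v z) \<le> u z"
proof (rule ccontr)
  have contv: "continuous_on UNIV v"
    unfolding v_def using ab by (auto intro!: continuous_intros continuous_on_powr')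
  have uninf: "u z \<noteq> - \<infinity>" if "z \<in> \<Theta>" for z using u that by (simp add: superparabolic_def)
  have lsc: "open {\<eta> \<in> \<Theta>. ereal (q + v \<eta>) < u \<eta>}" for q
    by (rule lsc_minus_continuous[OF \<Theta>(1) _ contv]) (use u in \<open>simp add: superparabolic_def\<close>)
  assume "\<not> ereal (v z) \<le> u z"
  then have "u z < ereal (v z)" by simp
  then obtain m where m: "u z < ereal m" "m < v z" using ereal_dense2[of "u z" "ereal (v z)"] by auto
  define c0 where "c0 = v z - m"
  have c0: "c0 > 0" using m by (simp add: c0_def)
  \<comment> \<open>The fixed gap c0 makes this set closed: limit points in \<Theta> belong to it by
    lower semicontinuity, and the boundary condition excludes limit points on the frontier.\<close>
  define L where "L = {\<eta> \<in> \<Theta>. u \<eta> \<le> ereal (v \<eta> - c0)}"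
  have zL: "z \<in> L" using m z by (simp add: L_def c0_def)
  have Lfin: "\<bar>u \<eta>\<bar> \<noteq> \<infinity>" if "\<eta> \<in> L" for \<eta> using that uninf[of \<eta>] by (auto simp: L_def)
  have compl: "\<eta> \<notin> L \<longleftrightarrow> \<eta> \<in> {\<eta> \<in> \<Theta>. ereal (- c0 + v \<eta>) < u \<eta>}" if "\<eta> \<in> \<Theta>" for \<eta>
    using that by (auto simp: L_def not_le)
  have "closure L \<subseteq> L"
  proof (rule subsetI, rule ccontr)
    fix \<xi> assume \<xi>: "\<xi> \<in> closure L" "\<xi> \<notin> L"
    obtain N where N: "open N" "\<xi> \<in> N" "N \<inter> L = {}"
    proof (cases "\<xi> \<in> \<Theta>")
      case True
      let ?N = "{\<eta> \<in> \<Theta>. ereal (- c0 + v \<eta>) < u \<eta>}"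
      have "\<xi> \<in> ?N" using compl[OF True] \<xi>(2) by blast
      moreover have "?N \<inter> L = {}" using compl by blast
      ultimately show ?thesis using that[of ?N] lsc by blast
    next
      case False
      have "L \<subseteq> \<Theta>" by (auto simp: L_def)
      then have "\<xi> \<in> closure \<Theta>" using \<xi>(1) closure_mono by blast
      then have "\<xi> \<in> frontier \<Theta>" using False \<Theta>(1) by (simp add: frontier_def interior_open)
      then have "eventually (\<lambda>\<eta>. ereal (v \<xi> - c0 / 2) < u \<eta>) (at \<xi> within \<Theta>)"
        using bd c0 by (auto simp: le_Liminf_iff)
      then obtain N1 where N1: "open N1" "\<xi> \<in> N1" "\<And>\<eta>. \<eta> \<in> N1 \<Longrightarrow> \<eta> \<noteq> \<xi> \<Longrightarrow> \<eta> \<in> \<Theta> \<Longrightarrow> ereal (v \<xi> - c0 / 2) < u \<eta>"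
        unfolding eventually_at_topological by blast
      let ?N2 = "{\<eta>. v \<eta> < v \<xi> + c0 / 2}"
      have N2: "open ?N2" "\<xi> \<in> ?N2" using c0 contv by (auto intro!: open_Collect_less)
      have "N1 \<inter> ?N2 \<inter> L = {}"
      proof (rule ccontr)
        assume "N1 \<inter> ?N2 \<inter> L \<noteq> {}"
        then obtain \<eta> where \<eta>: "\<eta> \<in> N1" "v \<eta> < v \<xi> + c0 / 2" "\<eta> \<in> L" by blast
        then have "\<eta> \<in> \<Theta>" "\<eta> \<noteq> \<xi>" "u \<eta> \<le> ereal (v \<eta> - c0)" using False by (auto simp: L_def)
        then have "ereal (v \<xi> - c0 / 2) < ereal (v \<eta> - c0)" using N1(3)[OF \<eta>(1)] by (meson less_le_trans)
        then show False using \<eta>(2) by simp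
      qed
      then show ?thesis using that[of "N1 \<inter> ?N2"] N1(1,2) N2 by blast
    qed
    then show False using \<xi>(1) by (metis Int_commute open_Int_closure_eq_empty Int_iff empty_iff)
  qed
  then have "closed L" by (simp add: closure_subset_eq)
  moreover have "bounded L" using \<Theta>(2) by (rule bounded_subset) (auto simp: L_def)
  ultimately have L: "compact L" by (simp add: compact_eq_bounded_closed)
  obtain z0 where z0: "z0 \<in> L" "\<And>\<eta>. \<eta> \<in> L \<Longrightarrow> real_of_ereal (u z0) - v z0 \<le> real_of_ereal (u \<eta>) - v \<eta>"
    using lsc_attains_min[OF L _ lsc _ Lfin] zL by (metis (no_types, lifting) L_def empty_iff mem_Collect_eq subsetI)
  define g0 where "g0 = real_of_ereal (u z0) - v z0"
  have uz0: "u z0 = ereal (v z0 + g0)" using Lfin[OF z0(1)] by (simp add: g0_def ereal_real)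
  have g0c: "g0 \<le> - c0" using z0(1) uz0 by (simp add: L_def)
  \<comment> \<open>Outside \<open>L\<close> one has u > v - c0 \<ge> v + g0, so the minimum over
    \<open>L\<close> is a lower bound on all of \<Theta>.\<close>
  have ge: "ereal (v \<eta> + g0) \<le> u \<eta>" if "\<eta> \<in> \<Theta>" for \<eta>
  proof (cases "\<eta> \<in> L")
    case True
    have "u \<eta> = ereal (real_of_ereal (u \<eta>))" using Lfin[OF True] by (simp add: ereal_real)
    moreover have "v \<eta> + g0 \<le> real_of_ereal (u \<eta>)" using z0(2)[OF True] by (simp add: g0_def)
    ultimately show ?thesis by (metis ereal_less_eq(3))
  next
    case False
    then have "ereal (v \<eta> - c0) < u \<eta>" using that by (simp add: L_def not_le)
    moreover have "ereal (v \<eta> + g0) \<le> ereal (v \<eta> - c0)" using g0c by simp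
    ultimately show ?thesis by (meson less_imp_le order_trans)
  qed
  obtain x0 t0 where xt: "z0 = (x0, t0)" by (cases z0)
  have z0\<Theta>: "z0 \<in> \<Theta>" using z0(1) by (simp add: L_def)
  have x0: "x0 \<noteq> 0" using \<Theta>(3) z0\<Theta> xt by force
  obtain y K' where y: "norm y < norm x0 / 2" and touch: "\<And>x. norm x > norm x0 / 2 \<Longrightarrow> x \<noteq> x0 \<Longrightarrow>
      K * (norm x powr \<beta> - norm x0 powr \<beta>) < K' * (norm (x - y) powr \<alpha> - norm (x0 - y) powr \<alpha>)"
    using profile_touches[OF ab K x0] by metis
  \<comment> \<open>The spatial gap between the barrier and the touching profile, both normalised at
    x0: it is 0 at x0 and positive elsewhere on the box chosen below.\<close>
  define \<omega> where "\<omega> = (\<lambda>x. K' * (norm (x - y) powr \<alpha> - norm (x0 - y) powr \<alpha>) - K * (norm x powr \<beta> - norm x0 powr \<beta>))"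
  have cont\<omega>: "continuous_on S \<omega>" for S
    unfolding \<omega>_def using ab by (auto intro!: continuous_intros continuous_on_powr')
  obtain A B where AB: "open A" "open B" "x0 \<in> A" "t0 \<in> B" "A \<times> B \<subseteq> \<Theta>"
    using \<Theta>(1) z0\<Theta> unfolding xt by (metis open_prod_elim mem_Times_iff fst_conv snd_conv)
  have "open (A \<inter> {x. norm x > norm x0 / 2})" by (intro open_Int AB open_Collect_less continuous_intros)
  moreover have "x0 \<in> A \<inter> {x. norm x > norm x0 / 2}" using AB x0 by simp
  ultimately obtain a b where box: "cbox a b \<subseteq> A \<inter> {x. norm x > norm x0 / 2}" "x0 \<in> box a b"
    by (rule open_contains_cbox)
  obtain \<rho> where \<rho>: "\<rho> > 0" "cball t0 \<rho> \<subseteq> B" using AB open_contains_cball by blast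
  have ne: "box a b \<noteq> {}" using box by auto
  have \<omega>0: "\<omega> x \<ge> 0" if "x \<in> cbox a b" for x
    using touch[of x] box that by (cases "x = x0") (auto simp: \<omega>_def less_imp_le)
  have "\<exists>\<gamma>>0. \<forall>x\<in>frontier (box a b). \<gamma> \<le> \<omega> x"
  proof (cases "frontier (box a b) = {}")
    case False
    have "compact (frontier (box a b))" by (simp add: compact_frontier_bounded)
    then obtain x where x: "x \<in> frontier (box a b)" "\<And>x'. x' \<in> frontier (box a b) \<Longrightarrow> \<omega> x \<le> \<omega> x'"
      using continuous_attains_inf[OF _ False cont\<omega>] by blast
    have "x \<in> cbox a b" "x \<notin> box a b" using x(1) ne by (auto simp: frontier_box)
    then have "norm x > norm x0 / 2" "x \<noteq> x0" using box by auto
    then have "\<omega> x > 0" using touch[of x] by (simp add: \<omega>_def)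
    then show ?thesis using x(2) by blast
  qed (auto intro: exI[of _ 1])
  then obtain \<gamma> where \<gamma>: "\<gamma> > 0" "\<And>x. x \<in> frontier (box a b) \<Longrightarrow> \<gamma> \<le> \<omega> x" by blast
  \<comment> \<open>On the lateral faces one half of \<gamma> pays for raising h by \<delta> \<tau>,
    the other half for the drop of v by at most \<delta> \<tau> after t0.\<close>
  define \<tau> where "\<tau> = min \<rho> (\<gamma> / (2 * \<delta>))"
  have \<tau>: "\<tau> > 0" "\<tau> \<le> \<rho>" using \<rho> \<gamma> \<delta> by (auto simp: \<tau>_def)
  have "\<delta> * \<tau> \<le> \<delta> * (\<gamma> / (2 * \<delta>))" using \<delta> by (intro mult_left_mono) (auto simp: \<tau>_def)
  then have \<delta>\<tau>: "2 * (\<delta> * \<tau>) \<le> \<gamma>" using \<delta> by simp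
  define t1 t2 where "t1 = t0 - \<tau>" and "t2 = t0 + \<tau>"
  have t: "t1 < t2" "t1 < t0" "t0 < t2" using \<tau> by (auto simp: t1_def t2_def)
  have cl: "closure (box a b \<times> {t1<..<t2}) = cbox a b \<times> {t1..t2}"
    using ne t by (simp add: closure_Times)
  have "{t1..t2} \<subseteq> cball t0 \<rho>" using \<tau> by (auto simp: t1_def t2_def dist_real_def)
  then have cl\<Theta>: "cbox a b \<times> {t1..t2} \<subseteq> \<Theta>" using box(1) \<rho>(2) AB(5) by blast
  have cc: "compactly_contained (box a b \<times> {t1<..<t2}) \<Theta>"
    unfolding compactly_contained_def cl using cl\<Theta> by (intro conjI compact_Times compact_cbox compact_Icc)
  have ybox: "y \<notin> box a b" using box(1) y box_subset_cbox[of a b] by auto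
  \<comment> \<open>At time t1 the barrier lies \<delta> \<tau> higher than at t0. Raised by exactly
    this amount, h still stays below v + g0 at the bottom, yet exceeds it by \<delta> \<tau> at
    z0.\<close>
  define c' where "c' = K' * norm (x0 - y) powr \<alpha> + v z0 + g0 + \<delta> * \<tau>"
  define h where "h = (\<lambda>z::(real^'n) \<times> real. profile c' (- K') y \<alpha> (fst z))"
  have hv: "v (x, s) + g0 - h (x, s) = \<omega> x - \<delta> * (s - t0) - \<delta> * \<tau>" for x s
    by (simp add: h_def c'_def \<omega>_def v_def xt profile_def algebra_simps)
  have hpar: "p_parabolic p (box a b \<times> {t1<..<t2}) h"
    unfolding h_def by (rule profile_p_parabolic[OF p \<alpha> ybox])
  have hcont: "continuous_on S h" for S
    unfolding h_def using ab
    by (intro continuous_on_compose2[OF continuous_on_profile[of \<alpha> UNIV]]) (auto intro!: continuous_intros)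
  have hle: "ereal (h \<zeta>) \<le> u \<zeta>" if "\<zeta> \<in> parabolic_boundary (box a b) t1 t2" for \<zeta>
  proof -
    obtain x s where \<zeta>: "\<zeta> = (x, s)" by (cases \<zeta>)
    have "h (x, s) \<le> v (x, s) + g0 \<and> (x, s) \<in> cbox a b \<times> {t1..t2}"
    proof (cases "s = t1 \<and> x \<in> cbox a b")
      case True
      then have "\<delta> * (s - t0) = - (\<delta> * \<tau>)" by (simp add: t1_def)
      then show ?thesis using hv[of x s] \<omega>0[of x] True t by simp
    next
      case False
      then have xs: "x \<in> frontier (box a b)" "t1 < s" "s \<le> t2"
        using that ne unfolding \<zeta> by (auto simp: parabolic_boundary_def closure_box)
      have "\<delta> * (s - t0) \<le> \<delta> * \<tau>" using xs(3) \<delta> by (intro mult_left_mono) (auto simp: t2_def)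
      moreover have "x \<in> cbox a b" using xs(1) ne by (auto simp: frontier_box)
      ultimately show ?thesis using hv[of x s] \<gamma>(2)[OF xs(1)] \<delta>\<tau> xs by auto
    qed
    then show ?thesis using ge[of \<zeta>] cl\<Theta> unfolding \<zeta> by (meson ereal_less_eq(3) order_trans subsetD)
  qed
  have "\<forall>z\<in>box a b \<times> {t1<..<t2}. ereal (h z) \<le> u z"
    by (rule u[unfolded superparabolic_def, THEN conjunct2, THEN conjunct2, THEN conjunct2,
          THEN spec, THEN spec, THEN spec, THEN spec, THEN spec, THEN mp])
       (intro conjI ne t(1) cc hpar hcont ballI hle)
  then have "ereal (h z0) \<le> u z0" using box(2) t(2,3) by (simp add: xt)
  then have "h z0 \<le> v z0 + g0" using uz0 by simp
  moreover have "v z0 + g0 - h z0 = - (\<delta> * \<tau>)" using hv[of x0 t0] by (simp add: xt \<omega>_def)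
  moreover have "\<delta> * \<tau> > 0" using \<delta> \<tau> by simp
  ultimately show False by simp
qed

lemma ereal_tendstoI:
  fixes g :: "'a \<Rightarrow> ereal"
  assumes "\<And>e::real. e > 0 \<Longrightarrow> eventually (\<lambda>x. ereal (l - e) \<le> g x \<and> g x \<le> ereal (l + e)) F"
  shows "(g \<longlongrightarrow> ereal l) F"
proof (rule order_tendstoI)
  fix a assume "a < ereal l"
  then obtain m where m: "a < ereal m" "m < l" using ereal_dense2[of a "ereal l"] by auto
  show "eventually (\<lambda>x. a < g x) F"
    using assms[of "l - m"] m by (auto elim!: eventually_mono intro: less_le_trans)
next
  fix a assume "ereal l < a"
  then obtain m where m: "ereal m < a" "l < m" using ereal_dense2[of "ereal l" a] by auto
  show "eventually (\<lambda>x. g x < a) F"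
    using assms[of "m - l"] m by (auto elim!: eventually_mono intro: le_less_trans)
qed

subsection \<open>The domain\<close>

context
  fixes l \<theta> :: real
  assumes l: "l > 0" and \<theta>: "\<theta> > 0"
begin

lemma continuous_on_norm_powr: "continuous_on S (\<lambda>z::(real^'n) \<times> real. norm (fst z) powr l)"
  using l by (auto intro!: continuous_intros continuous_on_powr')

lemma open_Theta_dom: "open (Theta_dom l \<theta> :: ((real^'n) \<times> real) set)"
proof -
  have "(Theta_dom l \<theta> :: ((real^'n) \<times> real) set) = {z. 0 < - snd z} \<inter> {z. - snd z < \<theta> * norm (fst z) powr l}
      \<inter> {z. \<theta> * norm (fst z) powr l < \<theta>}"
    by (auto simp: Theta_dom_def)
  then show ?thesis
    by (auto intro!: open_Int open_Collect_less continuous_intros continuous_on_norm_powr)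
qed

lemma closure_Theta_dom:
  fixes z :: "(real^'n) \<times> real"
  assumes "z \<in> closure (Theta_dom l \<theta>)"
  shows "snd z \<le> 0" "- snd z \<le> \<theta> * norm (fst z) powr l" "norm (fst z) powr l \<le> 1"
proof -
  let ?C = "{z::(real^'n) \<times> real. snd z \<le> 0} \<inter> {z. - snd z \<le> \<theta> * norm (fst z) powr l}
      \<inter> {z. norm (fst z) powr l \<le> 1}"
  have "closure (Theta_dom l \<theta>) \<subseteq> ?C"
  proof (rule closure_minimal)
    show "closed ?C" by (intro closed_Int closed_Collect_le continuous_intros continuous_on_norm_powr)
    show "Theta_dom l \<theta> \<subseteq> ?C" using \<theta> by (auto simp: Theta_dom_def)
  qed
  then show "snd z \<le> 0" "- snd z \<le> \<theta> * norm (fst z) powr l" "norm (fst z) powr l \<le> 1"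
    using assms by auto
qed

lemma bounded_Theta_dom: "bounded (Theta_dom l \<theta> :: ((real^'n) \<times> real) set)"
proof (rule bounded_subset)
  show "bounded (cball (0::real^'n) 1 \<times> {- \<theta>..0})" by (intro bounded_Times) auto
  show "Theta_dom l \<theta> \<subseteq> cball (0::real^'n) 1 \<times> {- \<theta>..0}"
  proof
    fix z :: "(real^'n) \<times> real" assume "z \<in> Theta_dom l \<theta>"
    then have z: "0 < - snd z" "- snd z < \<theta> * norm (fst z) powr l" "\<theta> * norm (fst z) powr l < \<theta>"
      by (auto simp: Theta_dom_def)
    then have "norm (fst z) powr l < 1" using \<theta> by simp
    then have "norm (fst z) \<le> 1" using ge_one_powr_ge_zero[of "norm (fst z)" l] l by linarith
    then show "z \<in> cball 0 1 \<times> {- \<theta>..0}" using z by (auto simp: mem_Times_iff)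
  qed
qed

lemma zero_notin_Theta_dom: "0 \<notin> fst ` (Theta_dom l \<theta> :: ((real^'n) \<times> real) set)"
  by (auto simp: Theta_dom_def)

lemma origin_frontier_Theta_dom: "(0, 0) \<in> frontier (Theta_dom l \<theta> :: ((real^'n) \<times> real) set)"
proof -
  fix i :: 'n
  \<comment> \<open>A curve into the origin at half the admissible depth |t| < \<theta>
    |x|^l.\<close>
  define \<gamma> where "\<gamma> = (\<lambda>r::real. (r *\<^sub>R axis i 1 :: real^'n, - (\<theta> * r powr l / 2)))"
  have powr0: "((\<lambda>r::real. r powr l) \<longlongrightarrow> 0 powr l) (at_right 0)"
    using l by (intro tendsto_powr' tendsto_intros) (auto simp: eventually_at_filter)
  then have powr0': "((\<lambda>r::real. r powr l) \<longlongrightarrow> 0) (at_right 0)" by simp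
  have "((\<lambda>r. r *\<^sub>R axis i (1::real)) \<longlongrightarrow> 0 *\<^sub>R (axis i 1 :: real^'n)) (at_right 0)"
    by (intro tendsto_intros)
  moreover have "((\<lambda>r. - (\<theta> * r powr l / 2)) \<longlongrightarrow> - (\<theta> * 0 / 2)) (at_right 0)"
    by (intro tendsto_intros powr0') simp
  ultimately have lim: "(\<gamma> \<longlongrightarrow> (0, 0)) (at_right 0)"
    unfolding \<gamma>_def using tendsto_Pair by fastforce
  have "eventually (\<lambda>r. r powr l < 1) (at_right 0)" using powr0' by (simp add: order_tendsto_iff)
  moreover have "eventually (\<lambda>r::real. r > 0) (at_right 0)" by (rule eventually_at_right_less)
  ultimately have "eventually (\<lambda>r. \<gamma> r \<in> closure (Theta_dom l \<theta>)) (at_right 0)"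
  proof eventually_elim
    case (elim r)
    have "\<gamma> r \<in> Theta_dom l \<theta>" using elim \<theta> by (simp add: \<gamma>_def Theta_dom_def)
    then show ?case using closure_subset by blast
  qed
  then have "(0, 0) \<in> closure (Theta_dom l \<theta> :: ((real^'n) \<times> real) set)"
    by (intro Lim_in_closed_set[OF closed_closure _ _ lim]) auto
  moreover have "(0::real^'n, 0::real) \<notin> Theta_dom l \<theta>" by (simp add: Theta_dom_def)
  ultimately show ?thesis by (simp add: frontier_def interior_open[OF open_Theta_dom])
qed

text \<open>Smallness of x alone forces smallness of t on the boundary, so continuity of the data at
  the origin can be expressed through |x| only, as a stationary barrier requires.\<close>

lemma Theta_dom_frontier_near_origin:
  assumes "d > 0"
  obtains d' where "d' > 0"
    "\<And>z::(real^'n) \<times> real. z \<in> frontier (Theta_dom l \<theta>) \<Longrightarrow> norm (fst z) < d' \<Longrightarrow> dist z (0, 0) < d"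
proof -
  have "continuous_on {0..} (\<lambda>r::real. r + \<theta> * r powr l)"
    using l by (auto intro!: continuous_intros continuous_on_powr')
  then have "\<exists>d'>0. \<forall>r\<in>{0..}. dist r 0 < d' \<longrightarrow> dist (r + \<theta> * r powr l) (0 + \<theta> * 0 powr l) < d"
    using \<open>d > 0\<close> unfolding continuous_on_iff by (meson atLeast_iff order_refl)
  then obtain d' where d': "d' > 0" "\<And>r. r \<ge> 0 \<Longrightarrow> r < d' \<Longrightarrow> \<bar>r + \<theta> * r powr l\<bar> < d"
    by (auto simp: dist_real_def)
  show ?thesis
  proof (rule that[OF d'(1)])
    fix z :: "(real^'n) \<times> real" assume z: "z \<in> frontier (Theta_dom l \<theta>)" "norm (fst z) < d'"
    have "z \<in> closure (Theta_dom l \<theta>)" using z(1) by (simp add: frontier_def)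
    from closure_Theta_dom[OF this] have "\<bar>snd z\<bar> \<le> \<theta> * norm (fst z) powr l" by simp
    moreover have "dist z (0, 0) \<le> norm (fst z) + \<bar>snd z\<bar>"
      using norm_Pair_le[of "fst z" "snd z"] by (simp add: dist_norm zero_prod_def[symmetric])
    ultimately show "dist z (0, 0) < d" using d'(2)[of "norm (fst z)"] z(2) by simp
  qed
qed

end

theorem proposition1p3:
  fixes p l \<theta> :: real
  assumes "p > 1" and "p > real CARD('n)" and "l > 0" and "\<theta> > 0"
  shows "regular_point p (Theta_dom l \<theta>) (0 :: real^'n, 0 :: real)"
  unfolding regular_point_def
proof (intro conjI allI impI)
  let ?\<Theta> = "Theta_dom l \<theta> :: ((real^'n) \<times> real) set"
  let ?o = "(0 :: real^'n, 0 :: real)"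
  note dom = assms(3,4)
  show o: "?o \<in> frontier ?\<Theta>" by (rule origin_frontier_Theta_dom[OF dom])
  define \<alpha> where "\<alpha> = (p - real CARD('n)) / (p - 1)"
  \<comment> \<open>Any exponent strictly between 0 and \<alpha> would serve for the strict
    barrier.\<close>
  define \<beta> where "\<beta> = \<alpha> / 2"
  have "real CARD('n) \<ge> 1" by (simp add: Suc_leI)
  then have "\<alpha> > 0" "\<alpha> \<le> 1" using assms by (auto simp: \<alpha>_def)
  then have ab: "\<alpha> > 0" "0 < \<beta>" "\<beta> < \<alpha>" "\<alpha> \<le> 1" by (auto simp: \<beta>_def)
  fix f :: "(real^'n) \<times> real \<Rightarrow> real" assume f: "continuous_on (frontier ?\<Theta>) f"
  have "compact (f ` frontier ?\<Theta>)"
    using compact_continuous_image[OF f] compact_frontier_bounded[OF bounded_Theta_dom[OF dom]] by blast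
  then obtain M where M: "M > 0" "\<And>\<xi>. \<xi> \<in> frontier ?\<Theta> \<Longrightarrow> \<bar>f \<xi>\<bar> \<le> M"
    using compact_imp_bounded bounded_pos by (metis imageI real_norm_def)
  show "(upper_perron p ?\<Theta> f \<longlongrightarrow> ereal (f ?o)) (at ?o within ?\<Theta>)"
  proof (rule ereal_tendstoI)
    fix e :: real assume "e > 0"
    \<comment> \<open>The lower barrier takes the value f(0) - 2 e' at the origin; a quarter of e
      leaves a margin for nearby points.\<close>
    define e' where "e' = e / 4"
    have e': "e' > 0" using \<open>e > 0\<close> by (simp add: e'_def)
    obtain d where d: "d > 0" "\<And>\<xi>. \<xi> \<in> frontier ?\<Theta> \<Longrightarrow> dist \<xi> ?o < d \<Longrightarrow> dist (f \<xi>) (f ?o) < e'"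
      using f o e' unfolding continuous_on_iff by meson
    obtain d' where d': "d' > 0" "\<And>\<xi>. \<xi> \<in> frontier ?\<Theta> \<Longrightarrow> norm (fst \<xi>) < d' \<Longrightarrow> dist \<xi> ?o < d"
      using Theta_dom_frontier_near_origin[OF dom d(1)] by metis
    have near: "\<bar>f \<xi> - f ?o\<bar> < e'" if "\<xi> \<in> frontier ?\<Theta>" "norm (fst \<xi>) < d'" for \<xi>
      using d(2) d'(2) that by (simp add: dist_real_def)
    \<comment> \<open>The coefficient 2 M / d'^s makes the last term at least 2 M, a bound for the
      oscillation of f, as soon as |x| \<ge> d'. The exponent s is free because the two barriers use
      \<alpha> and \<beta>.\<close>
    have bound: "\<bar>f \<xi> - f ?o\<bar> \<le> e' + 2 * M / d' powr s * norm (fst \<xi>) powr s"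
      if "\<xi> \<in> frontier ?\<Theta>" "s > 0" for \<xi> s
    proof (cases "norm (fst \<xi>) < d'")
      case True
      have "0 \<le> 2 * M / d' powr s * norm (fst \<xi>) powr s" using M by simp
      then show ?thesis using near[OF that(1) True] by linarith
    next
      case False
      then have "d' powr s \<le> norm (fst \<xi>) powr s" using d'(1) that(2) by (intro powr_mono2) auto
      then have "2 * M / d' powr s * d' powr s \<le> 2 * M / d' powr s * norm (fst \<xi>) powr s"
        using M(1) by (intro mult_left_mono) auto
      then have "2 * M \<le> 2 * M / d' powr s * norm (fst \<xi>) powr s" using d'(1) by simp
      then show ?thesis using M(2)[OF that(1)] M(2)[OF o] e' by linarith
    qed
    define w where "w = (\<lambda>z::(real^'n) \<times> real. profile (f ?o + e') (2 * M / d' powr \<alpha>) 0 \<alpha> (fst z))"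
    \<comment> \<open>On the closure of the domain -t \<le> \<theta>, so the term -(e' / \<theta>) t
      adds at most e'; the second e' subtracted from f(0) absorbs it.\<close>
    define v where "v = (\<lambda>z::(real^'n) \<times> real. (f ?o - 2 * e') - (2 * M / d' powr \<beta>) * norm (fst z) powr \<beta> - (e' / \<theta>) * snd z)"
    have contw: "continuous_on UNIV w"
      unfolding w_def using ab
      by (intro continuous_on_compose2[OF continuous_on_profile[of \<alpha> UNIV]]) (auto intro!: continuous_intros)
    have contv: "continuous_on UNIV v"
      unfolding v_def using ab d'(1) dom by (auto intro!: continuous_intros continuous_on_powr')
    have wupper: "(\<lambda>z. ereal (w z)) \<in> upper_class p ?\<Theta> f"
      unfolding upper_class_def
    proof (intro CollectI conjI ballI)
      show "superparabolic p ?\<Theta> (\<lambda>z. ereal (w z))"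
        unfolding w_def by (rule profile_superparabolic[OF assms(1) \<alpha>_def ab(1) zero_notin_Theta_dom[OF dom]])
      fix \<xi> assume \<xi>: "\<xi> \<in> frontier ?\<Theta>"
      have "\<xi> \<in> closure ?\<Theta>" "\<xi> \<notin> ?\<Theta>"
        using \<xi> interior_open[OF open_Theta_dom[OF dom]] by (auto simp: frontier_def)
      then have nt: "at \<xi> within ?\<Theta> \<noteq> bot" by (simp add: trivial_limit_within islimpt_in_closure)
      have "(w \<longlongrightarrow> w \<xi>) (at \<xi> within ?\<Theta>)"
        using contw by (meson UNIV_I continuous_on_def continuous_on_subset subset_UNIV tendsto_within_subset)
      then have "Liminf (at \<xi> within ?\<Theta>) (\<lambda>z. ereal (w z)) = ereal (w \<xi>)"
        by (intro lim_imp_Liminf[OF nt] tendsto_intros) simp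
      moreover have "f \<xi> \<le> w \<xi>" using bound[OF \<xi> ab(1)] by (simp add: w_def profile_def)
      ultimately show "ereal (f \<xi>) \<le> Liminf (at \<xi> within ?\<Theta>) (\<lambda>z. ereal (w z))" by simp
    qed
    have vlower: "ereal (v z) \<le> u z" if u: "u \<in> upper_class p ?\<Theta> f" and z: "z \<in> ?\<Theta>" for u z
      unfolding v_def
    proof (rule superparabolic_ge_barrier[OF assms(1) \<alpha>_def ab(2-4) open_Theta_dom[OF dom] bounded_Theta_dom[OF dom]
          zero_notin_Theta_dom[OF dom] _ _ _ _ z])
      show "2 * M / d' powr \<beta> > 0" "e' / \<theta> > 0" using M d' e' dom by simp_all
      show "superparabolic p ?\<Theta> u" using u by (simp add: upper_class_def)
      fix \<xi> assume \<xi>: "\<xi> \<in> frontier ?\<Theta>"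
      then have "\<xi> \<in> closure ?\<Theta>" by (simp add: frontier_def)
      note c = closure_Theta_dom[OF dom this]
      have "\<theta> * norm (fst \<xi>) powr l \<le> \<theta> * 1" using c(3) dom by (intro mult_left_mono) auto
      then have "- snd \<xi> \<le> \<theta>" using c(2) by linarith
      then have "(e' / \<theta>) * (- snd \<xi>) \<le> (e' / \<theta>) * \<theta>" using e' dom by (intro mult_left_mono) auto
      then have "- ((e' / \<theta>) * snd \<xi>) \<le> e'" using dom by simp
      then have "f ?o - 2 * e' - 2 * M / d' powr \<beta> * norm (fst \<xi>) powr \<beta> - e' / \<theta> * snd \<xi> \<le> f \<xi>"
        using bound[OF \<xi> ab(2)] by linarith
      then show "ereal (f ?o - 2 * e' - 2 * M / d' powr \<beta> * norm (fst \<xi>) powr \<beta> - e' / \<theta> * snd \<xi>)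
          \<le> Liminf (at \<xi> within ?\<Theta>) u"
        using u \<xi> unfolding upper_class_def by (force intro: order_trans[rotated])
    qed
    have "w ?o = f ?o + e'" "v ?o = f ?o - 2 * e'" by (simp_all add: w_def v_def profile_def)
    then have "open {z. w z < f ?o + e}" "?o \<in> {z. w z < f ?o + e}" "open {z. f ?o - e < v z}" "?o \<in> {z. f ?o - e < v z}"
      using contw contv \<open>e > 0\<close> by (auto intro!: open_Collect_less continuous_intros simp: e'_def)
    then have "eventually (\<lambda>z. w z < f ?o + e) (at ?o within ?\<Theta>)" "eventually (\<lambda>z. f ?o - e < v z) (at ?o within ?\<Theta>)"
      unfolding eventually_at_topological by blast+
    moreover have "eventually (\<lambda>z. z \<in> ?\<Theta>) (at ?o within ?\<Theta>)" by (simp add: eventually_at_filter)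
    ultimately show "eventually (\<lambda>z. ereal (f ?o - e) \<le> upper_perron p ?\<Theta> f z \<and> upper_perron p ?\<Theta> f z \<le> ereal (f ?o + e)) (at ?o within ?\<Theta>)"
    proof eventually_elim
      case (elim z)
      have "ereal (v z) \<le> upper_perron p ?\<Theta> f z"
        unfolding upper_perron_def using vlower elim(3) by (intro INF_greatest)
      moreover have "upper_perron p ?\<Theta> f z \<le> ereal (w z)"
        unfolding upper_perron_def using INF_lower[OF wupper, of "\<lambda>u. u z"] by simp
      moreover have "ereal (f ?o - e) \<le> ereal (v z)" "ereal (w z) \<le> ereal (f ?o + e)" using elim by simp_all
      ultimately show ?case by (meson order_trans)
    qed
  qed
qed

end
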